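(* Let $\mathbb{K}$ be a field, $R=\mathbb{K}[X_1,\ldots,X_n]$ the standard graded polynomial ring, and $I\subsetneq R$ a homogeneous ideal. Then there exists an integer $i$ such that $\beta_{i,\,i+\operatorname{reg}(R/I^s)}(R/I^s)$ is an extremal Betti number of $R/I^s$ for all $s\gg 0$ (with $i$ independent of $s$).
   Context: The graded Betti numbers are $\beta_{i,j}(R/J)=\dim_{\mathbb{K}}\operatorname{Tor}_i^R(\mathbb{K},R/J)_j$ for a homogeneous ideal $J$. The (Castelnuovo–Mumford) regularity is $\operatorname{reg}(R/J)=\max\{j-i : \beta_{i,j}(R/J)\ne 0\}$. A nonzero graded Betti number $\beta_{i,j}(R/J)$ is called extremal if $\beta_{k,l}(R/J)=0$ for all pairs $(k,l)\neq(i,j)$ with $k\ge i$ and $l\ge j$. $I^s$ denotes the ordinary $s$-th power of $I$.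
   Formalization: "Extremal" is taken in the standard sense: β_{k,l}=0 for all (k,l)≠(i,j) with k≥i and l−k≥j−i. With l≥j instead of l−k≥j−i the claim is false, e.g. for I=(x^3,xyz,y^2z,yz^2), where reg(R/I^s)=3s occurs only at i=2 but β_{3,3s+2}≠0. *)

theory Defs
  imports Complex_Main "HOL-Library.Function_Algebras" "HOL-Library.Poly_Mapping"
begin

text \<open>The polynomial ring over \<open>'k\<close> whose variables are indexed by the finite type \<open>'n\<close>.
  A monomial is a finitely supported exponent vector.\<close>

type_synonym ('n, 'k) mpoly = "('n \<Rightarrow>\<^sub>0 nat) \<Rightarrow>\<^sub>0 'k"

definition var :: "'n \<Rightarrow> ('n, 'k::zero_neq_one) mpoly" where
  "var v = Poly_Mapping.single (Poly_Mapping.single v 1) 1"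

definition mon_deg :: "('n::finite \<Rightarrow>\<^sub>0 nat) \<Rightarrow> nat" where
  "mon_deg m = (\<Sum>v\<in>UNIV. Poly_Mapping.lookup m v)"

text \<open>The zero polynomial is homogeneous of every degree, and it is the only homogeneous
  polynomial of negative degree.\<close>

definition homogeneous :: "int \<Rightarrow> ('n::finite, 'k::zero) mpoly \<Rightarrow> bool" where
  "homogeneous d p \<longleftrightarrow> (\<forall>m\<in>Poly_Mapping.keys p. int (mon_deg m) = d)"

text \<open>The ideals of a commutative ring are its submodules: \<open>ideal.subspace J\<close> says that \<open>J\<close> is an
  ideal, and \<open>ideal.span G\<close> is the ideal generated by \<open>G\<close>.\<close>

global_interpretation ideal: module "(*) :: 'a::comm_ring_1 \<Rightarrow> 'a \<Rightarrow> 'a"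
  by standard (simp_all add: algebra_simps)

definition homogeneous_ideal :: "('n::finite, 'k::field) mpoly set \<Rightarrow> bool" where
  "homogeneous_ideal I \<longleftrightarrow> (\<exists>G. (\<forall>g\<in>G. \<exists>d. homogeneous d g) \<and> I = ideal.span G)"

definition ideal_power :: "'a::comm_ring_1 set \<Rightarrow> nat \<Rightarrow> 'a set" where
  "ideal_power I s = ideal.span {\<Prod>t<s. f t | f. \<forall>t<s. f t \<in> I}"

text \<open>The homogeneous maximal ideal; the residue field, as a module over the polynomial ring, is
  the quotient by it.\<close>

definition irrelevant_ideal :: "('n::finite, 'k::field) mpoly set" where
  "irrelevant_ideal = ideal.span (range var)"


text \<open>Write \<open>R\<close> for the polynomial ring. An augmented complex
  \<open>\<cdots> \<rightarrow> F\<^sub>2 \<rightarrow> F\<^sub>1 \<rightarrow> F\<^sub>0 \<rightarrow> R/L\<close> of finitely generated graded free modules is given by matrices: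
  \<open>F\<^sub>i\<close> is the direct sum of the \<open>R(- shift i a)\<close> for \<open>a < rk i\<close>, the matrix \<open>mat i\<close> represents
  \<open>F\<^bsub>i+1\<^esub> \<rightarrow> F\<^sub>i\<close>, and the row \<open>aug\<close> represents the augmentation \<open>F\<^sub>0 \<rightarrow> R/L\<close>. Elements of \<open>F\<^sub>i\<close> are
  functions on the natural numbers that vanish from \<open>rk i\<close> on.\<close>

record (overloaded) ('n, 'k) free_complex =
  rk :: "nat \<Rightarrow> nat"
  shift :: "nat \<Rightarrow> nat \<Rightarrow> int"
  mat :: "nat \<Rightarrow> nat \<Rightarrow> nat \<Rightarrow> ('n, 'k) mpoly"
  aug :: "nat \<Rightarrow> ('n, 'k) mpoly"

definition free_mod :: "('n::finite, 'k::field) free_complex \<Rightarrow> nat \<Rightarrow> (nat \<Rightarrow> ('n, 'k) mpoly) set" where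
  "free_mod F i = {f. \<forall>a\<ge>rk F i. f a = 0}"

definition free_mod_deg ::
    "('n::finite, 'k::field) free_complex \<Rightarrow> nat \<Rightarrow> int \<Rightarrow> (nat \<Rightarrow> ('n, 'k) mpoly) set" where
  "free_mod_deg F i j = {f \<in> free_mod F i. \<forall>a<rk F i. homogeneous (j - shift F i a) (f a)}"

definition diff ::
    "('n::finite, 'k::field) free_complex \<Rightarrow> nat \<Rightarrow> (nat \<Rightarrow> ('n, 'k) mpoly) \<Rightarrow> nat \<Rightarrow> ('n, 'k) mpoly" where
  "diff F i g = (\<lambda>a. if a < rk F i then \<Sum>b<rk F (Suc i). mat F i a b * g b else 0)"

definition aug_map ::
    "('n::finite, 'k::field) free_complex \<Rightarrow> (nat \<Rightarrow> ('n, 'k) mpoly) \<Rightarrow> ('n, 'k) mpoly" where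
  "aug_map F f = (\<Sum>a<rk F 0. aug F a * f a)"

definition graded_free_resolution ::
    "('n::finite, 'k::field) mpoly set \<Rightarrow> ('n, 'k) free_complex \<Rightarrow> bool" where
  "graded_free_resolution L F \<longleftrightarrow>
     \<comment> \<open>all maps are graded of degree 0\<close>
     (\<forall>a<rk F 0. homogeneous (shift F 0 a) (aug F a)) \<and>
     (\<forall>i. \<forall>a<rk F i. \<forall>b<rk F (Suc i).
        homogeneous (shift F (Suc i) b - shift F i a) (mat F i a b)) \<and>
     \<comment> \<open>the augmented complex is exact at \<open>R/L\<close>, at \<open>F\<^sub>0\<close>, and at every \<open>F\<^bsub>i+1\<^esub>\<close>\<close>
     (\<forall>h. \<exists>f\<in>free_mod F 0. h - aug_map F f \<in> L) \<and>
     (\<forall>f\<in>free_mod F 0. aug_map F f \<in> L \<longleftrightarrow> f \<in> diff F 0 ` free_mod F 1) \<and>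
     (\<forall>i. \<forall>f\<in>free_mod F (Suc i).
        diff F i f = 0 \<longleftrightarrow> f \<in> diff F (Suc i) ` free_mod F (Suc (Suc i)))"

text \<open>Since \<open>F\<^sub>i \<otimes> R/J = F\<^sub>i / J F\<^sub>i\<close>, the degree \<open>j\<close> part of \<open>H\<^sub>i(F \<otimes> R/J)\<close> is the quotient of the
  following two subspaces of the degree \<open>j\<close> part of \<open>F\<^sub>i\<close>: the elements whose differential vanishes
  modulo \<open>J\<close>, and the elements that are congruent to a boundary modulo \<open>J\<close>.\<close>

definition tor_cycles ::
    "('n::finite, 'k::field) free_complex \<Rightarrow> ('n, 'k) mpoly set \<Rightarrow> nat \<Rightarrow> int
      \<Rightarrow> (nat \<Rightarrow> ('n, 'k) mpoly) set" where
  "tor_cycles F J i j =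
     {f \<in> free_mod_deg F i j. case i of 0 \<Rightarrow> True | Suc i' \<Rightarrow> \<forall>a. diff F i' f a \<in> J}"

definition tor_boundaries ::
    "('n::finite, 'k::field) free_complex \<Rightarrow> ('n, 'k) mpoly set \<Rightarrow> nat \<Rightarrow> int
      \<Rightarrow> (nat \<Rightarrow> ('n, 'k) mpoly) set" where
  "tor_boundaries F J i j =
     {f \<in> free_mod_deg F i j. \<exists>g\<in>free_mod_deg F (Suc i) j. \<forall>a. f a - diff F i g a \<in> J}"

definition vec_scale ::
    "'k::field \<Rightarrow> (nat \<Rightarrow> ('n::finite, 'k) mpoly) \<Rightarrow> nat \<Rightarrow> ('n, 'k) mpoly" where
  "vec_scale c f = (\<lambda>a. Poly_Mapping.single 0 c * f a)"

global_interpretation poly_vec: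
  vector_space "vec_scale :: 'k::field \<Rightarrow> (nat \<Rightarrow> ('n::finite, 'k) mpoly) \<Rightarrow> nat \<Rightarrow> ('n, 'k) mpoly"
proof
  fix a b :: 'k and f g :: "nat \<Rightarrow> ('n, 'k) mpoly"
  show "vec_scale a (f + g) = vec_scale a f + vec_scale a g"
    by (rule ext) (simp add: vec_scale_def distrib_left)
  show "vec_scale (a + b) f = vec_scale a f + vec_scale b f"
    by (rule ext) (simp add: vec_scale_def single_add distrib_right)
  show "vec_scale a (vec_scale b f) = vec_scale (a * b) f"
    by (rule ext) (simp add: vec_scale_def mult_single mult.assoc [symmetric])
  show "vec_scale 1 f = f"
    by (rule ext) (simp add: vec_scale_def)
qed

text \<open>\<open>tor_dim L J i j\<close> is the dimension over \<open>'k\<close> of the degree \<open>j\<close> part of \<open>Tor\<^sub>i(R/L, R/J)\<close>, for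
  homogeneous ideals \<open>L\<close> and \<open>J\<close>. As usual, Tor is computed from a chosen graded free resolution of
  the first argument, and it does not depend on the choice. Both subspaces below are
  finite-dimensional and the second is contained in the first, so the difference is the dimension
  of the quotient.\<close>

definition tor_dim ::
    "('n::finite, 'k::field) mpoly set \<Rightarrow> ('n, 'k) mpoly set \<Rightarrow> nat \<Rightarrow> int \<Rightarrow> nat" where
  "tor_dim L J i j =
     (let F = SOME F. graded_free_resolution L F
      in poly_vec.dim (tor_cycles F J i j) - poly_vec.dim (tor_boundaries F J i j))"

text \<open>The invariants below take the ideal \<open>J\<close> as argument and are those of the quotient \<open>R/J\<close>.\<close>

definition betti :: "nat \<Rightarrow> int \<Rightarrow> ('n::finite, 'k::field) mpoly set \<Rightarrow> nat" where
  "betti i j J = tor_dim irrelevant_ideal J i j"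

definition reg :: "('n::finite, 'k::field) mpoly set \<Rightarrow> int" where
  "reg J = Max {j - int i | i j. betti i j J \<noteq> 0}"

text \<open>Extremality (Bayer, Charalambous, Popescu) refers to positions in the Betti table, whose rows
  are indexed by \<open>j - i\<close>: with \<open>\<beta>\<^bsub>i,i+r\<^esub>\<close> in column \<open>i\<close> and row \<open>r\<close>, all other entries in columns
  \<open>\<ge> i\<close> and rows \<open>\<ge> r\<close> vanish. The second index must not be compared as an internal degree: for
  \<open>I = (x\<^sup>3, y z\<^sup>2, x y z, y\<^sup>2 z)\<close> and every \<open>s \<ge> 1\<close> one has \<open>reg (R/I\<^sup>s) = 3 s\<close>, which is attained in
  column 2 only, whereas \<open>\<beta>\<^bsub>3,3s+2\<^esub>\<close> is nonzero with the same internal degree as \<open>\<beta>\<^bsub>2,2+3s\<^esub>\<close>.\<close>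

definition extremal_betti :: "nat \<Rightarrow> int \<Rightarrow> ('n::finite, 'k::field) mpoly set \<Rightarrow> bool" where
  "extremal_betti i j J \<longleftrightarrow>
     betti i j J \<noteq> 0 \<and>
     (\<forall>k l. k \<ge> i \<longrightarrow> l - int k \<ge> j - int i \<longrightarrow> (k, l) \<noteq> (i, j) \<longrightarrow> betti k l J = 0)"

end

theory Submission
  imports Defs "HOL-Library.Product_Lexorder"
begin

text \<open>Only the position of the regularity in the Betti table matters: in the last nonzero row, the
  rightmost nonzero entry is extremal. So it has to be shown that the column of this entry is
  eventually constant. This follows once, for every column \<open>i\<close>, the largest \<open>j\<close> with
  \<open>\<beta>\<^bsub>i,j\<^esub>(R/I\<^sup>s) \<noteq> 0\<close> is for large \<open>s\<close> an affine function of \<open>s\<close>, or the column is zero for all large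
  \<open>s\<close>. Indeed there are finitely many columns, two affine functions compare in the same way at all
  large arguments, and column \<open>0\<close> is nonzero for \<open>s \<ge> 1\<close>. The column wanted is thus the last one among those in
  which the maximum of these functions, diminished by the column number, is attained.

  The asymptotic linearity (a theorem of Cutkosky, Herzog and Trung, and of Kodiyalam) is proved as
  follows. Let \<open>F\<close> be a graded free resolution of the residue field, and \<open>B\<close> the image of
  \<open>F\<^bsub>i+1\<^esub>\<close> in \<open>F\<^sub>i\<close>. Then Tor in degree \<open>i + 1\<close> of the residue field and \<open>R/I\<^sup>s\<close> is
  \<open>(B \<inter> I\<^sup>s F\<^sub>i) / I\<^sup>s B\<close> (lemma \<open>betti_Suc_iff\<close>). The sum over all \<open>s\<close> is a bigraded module over
  the Rees algebra, finitely generated by Hilbert's basis theorem (\<open>graded_noetherian\<close>), and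
  annihilated by the variables (\<open>ideal_mult_boundary\<close>). It is therefore a finitely generated module
  over the polynomial ring in variables \<open>T\<^sub>k\<close> corresponding to homogeneous generators \<open>g\<^sub>k\<close> of \<open>I\<close>,
  where \<open>T\<^sub>k\<close> has bidegree \<open>(deg g\<^sub>k, 1)\<close>. Such a module has a basis of standard monomials
  (\<open>eventually_linear_top_quotient\<close>); for each module generator their exponents form a downward closed
  set, and for downward closed sets linearity is elementary (\<open>eventually_linear_top_monomials\<close>).

  The Betti numbers are defined by an arbitrarily chosen resolution. That one exists, and that the
  columns beyond the number of variables vanish, comes from the Koszul resolution, built by iterated
  mapping cones (\<open>koszul_resolution\<close>), and from the comparison of resolutions
  (\<open>boundary_past_length\<close>).\<close>

section \<open>Vectors of polynomials and linear maps\<close>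

abbreviation lookup where "lookup \<equiv> Poly_Mapping.lookup"

abbreviation keys where "keys \<equiv> Poly_Mapping.keys"

abbreviation single where "single \<equiv> Poly_Mapping.single"

text \<open>As a rewrite rule this law is the reverse of associativity of multiplication, so the two
  together do not terminate.\<close>

declare ideal.scale_scale [simp del]

definition smul :: "('n::finite, 'k::field) mpoly \<Rightarrow> (nat \<Rightarrow> ('n, 'k) mpoly) \<Rightarrow> nat \<Rightarrow> ('n, 'k) mpoly"
  where "smul p f = (\<lambda>a. p * f a)"

definition unit_vec :: "nat \<Rightarrow> nat \<Rightarrow> ('n::finite, 'k::field) mpoly"
  where "unit_vec a = (\<lambda>b. if b = a then 1 else 0)"

global_interpretation vec_mod: module smul
proof
  fix a b :: "('n::finite, 'k::field) mpoly" and f g :: "nat \<Rightarrow> ('n, 'k) mpoly"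
  show "smul a (f + g) = smul a f + smul a g"
    by (rule ext) (simp add: smul_def distrib_left)
  show "smul (a + b) f = smul a f + smul b f"
    by (rule ext) (simp add: smul_def distrib_right)
  show "smul a (smul b f) = smul (a * b) f"
    by (rule ext) (simp add: smul_def mult.assoc)
  show "smul 1 f = f"
    by (rule ext) (simp add: smul_def)
qed

abbreviation rlin ::
    "((nat \<Rightarrow> ('n::finite, 'k::field) mpoly) \<Rightarrow> nat \<Rightarrow> ('n, 'k) mpoly) \<Rightarrow> bool"
  where "rlin \<equiv> module_hom smul smul"

lemma rlinI:
  assumes "\<And>f g. \<phi> (f + g) = \<phi> f + \<phi> g" and "\<And>p f. \<phi> (smul p f) = smul p (\<phi> f)"
  shows "rlin \<phi>"
  using assms by unfold_locales auto

lemma sum_fun_apply: "(\<Sum>a\<in>A. f a) b = (\<Sum>a\<in>A. f a b)"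
  for f :: "'a \<Rightarrow> 'b \<Rightarrow> 'c::comm_monoid_add"
  by (induction A rule: infinite_finite_induct) auto

lemma smul_apply: "smul p f a = p * f a"
  by (simp add: smul_def)

lemma vec_scale_eq_smul: "vec_scale c f = smul (single 0 c) f"
  by (simp add: vec_scale_def smul_def)

lemma smul_smul: "smul p (smul q f) = smul (p * q) f"
  by (fact vec_mod.scale_scale)

lemma smul_vec_scale: "smul p (vec_scale c f) = vec_scale c (smul p f)"
  by (simp add: vec_scale_eq_smul smul_smul mult.commute)

lemma smul_subspace: "vec_mod.subspace S \<Longrightarrow> poly_vec.subspace S"
  by (auto simp: vec_mod.subspace_def poly_vec.subspace_def vec_scale_eq_smul)

text \<open>The shape of this rule (a span over the field on both sides, multiplication by a
  polynomial in between) is what the graded arguments below need: multiplication by a monomial maps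
  one graded piece to another, and it suffices to check this on spanning sets.\<close>

lemma smul_span:
  assumes "f \<in> poly_vec.span S" and "\<And>g. g \<in> S \<Longrightarrow> smul p g \<in> poly_vec.span T"
  shows "smul p f \<in> poly_vec.span T"
  using assms(1)
proof (induction rule: poly_vec.span_induct_alt)
  case base
  show ?case
    by (subst vec_mod.scale_zero_right) (rule poly_vec.span_zero)
next
  case (step c x y)
  have "smul p (vec_scale c x + y) = vec_scale c (smul p x) + smul p y"
    by (simp only: vec_mod.scale_right_distrib smul_vec_scale)
  with step show ?case
    by (simp only: poly_vec.span_add poly_vec.span_scale assms(2))
qed

lemma vec_expand:
  assumes "\<And>a. r \<le> a \<Longrightarrow> f a = 0"
  shows "f = (\<Sum>a<r. smul (f a) (unit_vec a))"
proof
  fix b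
  have "(\<Sum>a<r. smul (f a) (unit_vec a)) b = (\<Sum>a<r. if a = b then f a else 0)"
    by (simp add: sum_fun_apply smul_def unit_vec_def if_distrib [of "\<lambda>x. _ * x"] eq_commute cong: if_cong)
  also have "\<dots> = f b"
    using assms[of b] by (cases "b < r") auto
  finally show "f b = (\<Sum>a<r. smul (f a) (unit_vec a)) b" by simp
qed

text \<open>Identities between linear maps on a free module are checked on the standard basis: apply
  this to the submodule on which the two sides agree.\<close>

lemma subspace_contains_free:
  assumes "vec_mod.subspace S" and "\<And>a. a < r \<Longrightarrow> unit_vec a \<in> S" and "\<And>a. r \<le> a \<Longrightarrow> f a = 0"
  shows "f \<in> S"
proof -
  have "(\<Sum>a<r. smul (f a) (unit_vec a)) \<in> S"
    by (intro vec_mod.subspace_sum[OF assms(1)] vec_mod.subspace_scale[OF assms(1)] assms(2)) simp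
  then show ?thesis by (simp only: vec_expand[OF assms(3), symmetric])
qed

lemma extend_linear_map:
  fixes h :: "nat \<Rightarrow> nat \<Rightarrow> ('n::finite, 'k::field) mpoly"
  assumes S: "vec_mod.subspace S" and h: "\<forall>a<r. h a \<in> S"
  shows "\<exists>H. rlin H \<and> (\<forall>f. H f \<in> S) \<and> (\<forall>a<r. H (unit_vec a) = h a)"
proof -
  define H where "H f = (\<Sum>a<r. smul (f a) (h a))" for f :: "nat \<Rightarrow> ('n, 'k) mpoly"
  have "rlin H"
  proof (rule rlinI)
    fix f g :: "nat \<Rightarrow> ('n, 'k) mpoly" and p
    show "H (f + g) = H f + H g"
      by (simp add: H_def vec_mod.scale_left_distrib sum.distrib)
    show "H (smul p f) = smul p (H f)"
      by (simp add: H_def vec_mod.scale_sum_right smul_apply)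
  qed
  moreover have "H f \<in> S" for f
    unfolding H_def using h by (intro vec_mod.subspace_sum[OF S] vec_mod.subspace_scale[OF S]) simp
  moreover have "H (unit_vec a) = h a" if "a < r" for a
  proof -
    have "H (unit_vec a) = (\<Sum>b<r. if b = a then h b else 0)"
      unfolding H_def by (rule sum.cong) (auto simp: unit_vec_def)
    also have "\<dots> = h a" using that by simp
    finally show ?thesis .
  qed
  ultimately show ?thesis by (intro exI[of _ H] conjI allI impI)
qed

text \<open>The projectivity of free modules, in the form in which it is used to build chain maps and
  homotopies degree by degree: a linear map whose values on the basis lie in the image of
  \<open>\<Delta>\<close> factors through \<open>\<Delta>\<close>.\<close>

lemma lift_linear_map:
  assumes \<Delta>: "rlin \<Delta>" and \<theta>: "rlin \<theta>" and S: "vec_mod.subspace S"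
    and ex: "\<forall>a<r. \<theta> (unit_vec a) \<in> \<Delta> ` S"
  shows "\<exists>H. rlin H \<and> (\<forall>f. H f \<in> S) \<and> (\<forall>f. (\<forall>a\<ge>r. f a = 0) \<longrightarrow> \<Delta> (H f) = \<theta> f)"
proof -
  have "\<forall>a\<in>{..<r}. \<exists>x. x \<in> S \<and> \<Delta> x = \<theta> (unit_vec a)"
    using ex by fastforce
  from bchoice[OF this] obtain h
    where h: "\<forall>a<r. h a \<in> S" "\<And>a. a < r \<Longrightarrow> \<Delta> (h a) = \<theta> (unit_vec a)"
    by auto
  from extend_linear_map[OF S h(1)] obtain H
    where H: "rlin H" "\<forall>f. H f \<in> S" "\<forall>a<r. H (unit_vec a) = h a"
    by (elim exE conjE)
  have "vec_mod.subspace {f. \<Delta> (H f) = \<theta> f}"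
  proof (rule vec_mod.subspaceI; unfold mem_Collect_eq)
    show "\<Delta> (H 0) = \<theta> 0"
      by (simp only: module_hom.zero[OF H(1)] module_hom.zero[OF \<Delta>] module_hom.zero[OF \<theta>])
    show "\<Delta> (H (x + y)) = \<theta> (x + y)" if "\<Delta> (H x) = \<theta> x" "\<Delta> (H y) = \<theta> y" for x y
      by (simp only: module_hom.add[OF H(1)] module_hom.add[OF \<Delta>] module_hom.add[OF \<theta>] that)
    show "\<Delta> (H (smul c x)) = \<theta> (smul c x)" if "\<Delta> (H x) = \<theta> x" for c x
      by (simp only: module_hom.scale[OF H(1)] module_hom.scale[OF \<Delta>] module_hom.scale[OF \<theta>] that)
  qed
  from subspace_contains_free[OF this, of r] have "\<Delta> (H f) = \<theta> f" if "\<forall>a\<ge>r. f a = 0" for f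
    using that h(2) H(3) by (simp only: mem_Collect_eq)
  with H(1,2) show ?thesis by (intro exI[of _ H] conjI) simp_all
qed

section \<open>Homogeneous components\<close>

definition hcomp :: "int \<Rightarrow> ('n::finite, 'k::field) mpoly \<Rightarrow> ('n, 'k) mpoly" where
  "hcomp d p = Poly_Mapping.mapp (\<lambda>m c. c when int (mon_deg m) = d) p"

lemma lookup_hcomp: "lookup (hcomp d p) m = (lookup p m when int (mon_deg m) = d)"
  by (auto simp: hcomp_def lookup_mapp when_def in_keys_iff)

lemma hcomp_add: "hcomp d (p + q) = hcomp d p + hcomp d q"
  by (rule poly_mapping_eqI) (simp add: lookup_hcomp lookup_add when_add_distrib)

lemma hcomp_0 [simp]: "hcomp d 0 = 0"
  by (rule poly_mapping_eqI) (simp add: lookup_hcomp)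

lemma hcomp_sum: "hcomp d (sum f A) = (\<Sum>a\<in>A. hcomp d (f a))"
  by (rule poly_mapping_eqI) (simp add: lookup_hcomp lookup_sum when_def)

lemma homogeneous_hcomp: "homogeneous d (hcomp d p)"
  by (auto simp: homogeneous_def in_keys_iff lookup_hcomp)

lemma hcomp_homogeneous: "homogeneous d p \<Longrightarrow> hcomp e p = (if e = d then p else 0)"
  by (rule poly_mapping_eqI) (auto simp: homogeneous_def lookup_hcomp when_def in_keys_iff)

lemma homogeneous_iff_hcomp: "homogeneous d p \<longleftrightarrow> hcomp d p = p"
  using homogeneous_hcomp[of d p] hcomp_homogeneous[of d p d] by auto

lemma mon_deg_add: "mon_deg (m + l) = mon_deg m + mon_deg l"
  by (simp add: mon_deg_def lookup_add sum.distrib)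

lemma mon_deg_0 [simp]: "mon_deg 0 = 0"
  by (simp add: mon_deg_def)

lemma mon_deg_single [simp]: "mon_deg (single v k) = k"
  by (simp add: mon_deg_def lookup_single when_def)

lemma homogeneous_mult:
  fixes p q :: "('n::finite, 'k::field) mpoly"
  shows "homogeneous d p \<Longrightarrow> homogeneous e q \<Longrightarrow> homogeneous (d + e) (p * q)"
  using keys_mult[of p q] by (fastforce simp: homogeneous_def mon_deg_add)

lemma homogeneous_0 [simp]: "homogeneous d 0"
  by (simp add: homogeneous_def)

lemma homogeneous_1 [simp]: "homogeneous 0 1"
  by (simp add: homogeneous_def)

lemma homogeneous_var: "homogeneous 1 (var v)"
  by (auto simp: homogeneous_def var_def split: if_splits)

lemma homogeneous_const: "homogeneous 0 (single 0 c)"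
  by (auto simp: homogeneous_def split: if_splits)

lemma homogeneous_add: "homogeneous d p \<Longrightarrow> homogeneous d q \<Longrightarrow> homogeneous d (p + q)"
  for p :: "('n::finite, 'k::field) mpoly"
  by (simp add: homogeneous_iff_hcomp hcomp_add)

lemma homogeneous_uminus: "homogeneous d p \<Longrightarrow> homogeneous d (- p)"
  by (simp add: homogeneous_def)

lemma homogeneous_power: "homogeneous d p \<Longrightarrow> homogeneous (int k * d) (p ^ k)"
  for p :: "('n::finite, 'k::field) mpoly"
  by (induction k) (auto simp: algebra_simps intro: homogeneous_mult)

lemma homogeneous_prod:
  fixes p :: "'a \<Rightarrow> ('n::finite, 'k::field) mpoly"
  assumes "\<And>a. a \<in> A \<Longrightarrow> homogeneous (d a) (p a)"
  shows "homogeneous (\<Sum>a\<in>A. d a) (\<Prod>a\<in>A. p a)"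
  using assms by (induction A rule: infinite_finite_induct) (auto intro: homogeneous_mult)

text \<open>Split off from \<open>q\<close> its component of degree \<open>e - d\<close>: its product with \<open>p\<close> is homogeneous of
  degree \<open>e\<close>, and no product of a monomial of \<open>p\<close> with one of the remaining monomials has degree \<open>e\<close>.\<close>

lemma hcomp_mult:
  fixes p q :: "('n::finite, 'k::field) mpoly"
  assumes "homogeneous d p"
  shows "hcomp e (p * q) = p * hcomp (e - d) q"
proof -
  define r where "r = q - hcomp (e - d) q"
  have r: "int (mon_deg m) \<noteq> e - d" if "m \<in> keys r" for m
    using that by (auto simp: r_def in_keys_iff lookup_minus lookup_hcomp)
  have "hcomp e (p * r) = 0"
  proof (rule poly_mapping_eqI)
    fix m
    have "lookup (p * r) m = 0" if "int (mon_deg m) = e"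
    proof (rule ccontr)
      assume "lookup (p * r) m \<noteq> 0"
      then obtain a b where "a \<in> keys p" "b \<in> keys r" "m = a + b"
        using keys_mult[of p r] by (auto simp: in_keys_iff)
      then show False
        using assms r[of b] that by (auto simp: homogeneous_def mon_deg_add)
    qed
    then show "lookup (hcomp e (p * r)) m = lookup 0 m"
      by (simp add: lookup_hcomp when_def)
  qed
  moreover have "homogeneous e (p * hcomp (e - d) q)"
    using homogeneous_mult[OF assms homogeneous_hcomp[of "e - d" q]] by simp
  moreover have "q = hcomp (e - d) q + r"
    by (simp add: r_def)
  ultimately show ?thesis
    by (metis hcomp_add distrib_left homogeneous_iff_hcomp add.right_neutral)
qed

lemma sum_hcomp:
  "p = (\<Sum>d\<in>(int \<circ> mon_deg) ` keys p. hcomp d p)"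
proof (rule poly_mapping_eqI)
  fix m
  show "lookup p m = lookup (\<Sum>d\<in>(int \<circ> mon_deg) ` keys p. hcomp d p) m"
  proof (cases "m \<in> keys p")
    case True
    then show ?thesis
      by (simp add: lookup_sum lookup_hcomp when_def)
  next
    case False
    then show ?thesis
      by (simp add: lookup_sum lookup_hcomp in_keys_iff)
  qed
qed

text \<open>Homogeneity of an ideal as closure under homogeneous components; unlike the existence of
  homogeneous generators it can be used on single elements.\<close>

definition graded :: "('n::finite, 'k::field) mpoly set \<Rightarrow> bool" where
  "graded J \<longleftrightarrow> ideal.subspace J \<and> (\<forall>p\<in>J. \<forall>d. hcomp d p \<in> J)"

lemma graded_span:
  fixes G :: "('n::finite, 'k::field) mpoly set"
  assumes "\<And>g. g \<in> G \<Longrightarrow> \<exists>d. homogeneous d g"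
  shows "graded (ideal.span G)"
  unfolding graded_def
proof (intro conjI ballI allI)
  show "ideal.subspace (ideal.span G)" by simp
next
  fix p d assume "p \<in> ideal.span G"
  then show "hcomp d p \<in> ideal.span G"
  proof (induction arbitrary: d rule: ideal.span_induct_alt)
    case base
    then show ?case by (simp add: ideal.span_zero)
  next
    case (step c x y)
    obtain e where "homogeneous e x" using assms step by blast
    then have "hcomp d (c * x + y) = hcomp (d - e) c * x + hcomp d y"
      using hcomp_mult[of e x d c] by (simp add: hcomp_add mult.commute)
    then show ?case
      by (simp add: ideal.span_add ideal.span_scale ideal.span_base step)
  qed
qed

section \<open>Ideals generated by variables\<close>

lemma keys_var_mult:
  "keys (var v * p) = (\<lambda>m. m + single v 1) ` keys p"
  for p :: "('n::finite, 'k::field) mpoly"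
proof -
  have shifted: "lookup (var v * p) (m + single v 1) = lookup p m" for m
  proof -
    have "lookup (var v * p) (m + single v 1)
        = (\<Sum>l. (1 when single v 1 = l) *
            (\<Sum>q. lookup p q when m + single v 1 = l + q))"
      by (simp add: lookup_mult var_def lookup_single)
    also have "\<dots> = (\<Sum>l. (\<Sum>q. lookup p q when m + single v 1 = l + q)
          when single v 1 = l)"
      by (simp add: when_mult)
    also have "\<dots> = (\<Sum>q. lookup p q when m = q)"
      by (simp add: add.commute)
    finally show ?thesis by simp
  qed
  show ?thesis
  proof (intro equalityI subsetI)
    fix x assume "x \<in> keys (var v * p)"
    then show "x \<in> (\<lambda>m. m + single v 1) ` keys p"
      using keys_mult[of "var v" p] by (auto simp: var_def add.commute split: if_splits)
  next
    fix x assume "x \<in> (\<lambda>m. m + single v 1) ` keys p"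
    then show "x \<in> keys (var v * p)"
      using shifted by (auto simp: in_keys_iff)
  qed
qed

lemma single_split_var:
  assumes "lookup m v \<noteq> 0"
  shows "single m (c::'k::field) =
    single (m - single v 1) c * var (v::'n::finite)"
proof -
  have "m - single v 1 + single v 1 = m"
    using assms by (intro poly_mapping_eqI) (auto simp: lookup_add lookup_minus lookup_single when_def)
  then show ?thesis by (simp add: var_def mult_single)
qed

lemma poly_mapping_sum_single: "p = (\<Sum>m\<in>keys p. single m (lookup p m))"
  by (rule poly_mapping_eqI)
    (auto simp: lookup_sum lookup_single when_def in_keys_iff)

lemma mem_span_vars_iff:
  fixes p :: "('n::finite, 'k::field) mpoly"
  shows "p \<in> ideal.span (var ` S) \<longleftrightarrow> (\<forall>m\<in>keys p. \<exists>v\<in>S. lookup m v \<noteq> 0)"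
proof
  assume "p \<in> ideal.span (var ` S)"
  then show "\<forall>m\<in>keys p. \<exists>v\<in>S. lookup m v \<noteq> 0"
  proof (induction rule: ideal.span_induct_alt)
    case base
    then show ?case by simp
  next
    case (step c x y)
    then obtain v where v: "v \<in> S" "x = var v" by blast
    have "\<exists>v\<in>S. lookup m v \<noteq> 0" if "m \<in> keys (c * x)" for m
      using that v by (intro bexI[of _ v]) (auto simp: mult.commute[of c] keys_var_mult lookup_add)
    then show ?case using step Poly_Mapping.keys_add[of "c * x" y] by blast
  qed
next
  assume *: "\<forall>m\<in>keys p. \<exists>v\<in>S. lookup m v \<noteq> 0"
  have "single m (lookup p m) \<in> ideal.span (var ` S)"
    if "m \<in> keys p" for m
  proof -
    from bspec[OF * that] obtain v where "v \<in> S" "lookup m v \<noteq> 0" by (elim bexE)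
    then have "single (m - single v 1) (lookup p m) * var v
        \<in> ideal.span (var ` S)"
      by (metis ideal.span_scale ideal.span_base imageI)
    then show ?thesis
      using single_split_var[OF \<open>lookup m v \<noteq> 0\<close>] by metis
  qed
  then show "p \<in> ideal.span (var ` S)"
    using ideal.span_sum[of "keys p"
        "\<lambda>m. single m (lookup p m)" "var ` S"]
    by (simp only: poly_mapping_sum_single[of p, symmetric])
qed

text \<open>A monomial divisible by a variable from \<open>S\<close> after multiplication by another variable was
  so before. Hence the variables form a regular sequence, which makes the mapping cones below
  exact.\<close>

lemma var_nonzerodivisor:
  fixes p :: "('n::finite, 'k::field) mpoly"
  assumes "v \<notin> S" "var v * p \<in> ideal.span (var ` S)"
  shows "p \<in> ideal.span (var ` S)"
  unfolding mem_span_vars_iff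
proof
  fix m assume "m \<in> keys p"
  then obtain w where "w \<in> S" "lookup (m + single v 1) w \<noteq> 0"
    using assms(2) unfolding mem_span_vars_iff keys_var_mult by blast
  then show "\<exists>v\<in>S. lookup m v \<noteq> 0"
    using assms(1) by (intro bexI[of _ w]) (auto simp: lookup_add lookup_single when_def split: if_splits)
qed

lemma mem_irrelevant_iff: "p \<in> irrelevant_ideal \<longleftrightarrow> lookup p 0 = 0"
  for p :: "('n::finite, 'k::field) mpoly"
proof -
  have "(\<exists>v. lookup m v \<noteq> 0) \<longleftrightarrow> m \<noteq> 0" for m :: "'n \<Rightarrow>\<^sub>0 nat"
    by (metis lookup_zero poly_mapping_eqI)
  then show ?thesis
    by (auto simp: irrelevant_ideal_def mem_span_vars_iff in_keys_iff)
qed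

lemma mon_deg_eq_0_iff: "mon_deg m = 0 \<longleftrightarrow> m = 0"
  by (auto simp: mon_deg_def intro: poly_mapping_eqI)

lemma homogeneous_mem_irrelevant: "homogeneous d p \<Longrightarrow> d \<noteq> 0 \<Longrightarrow> p \<in> irrelevant_ideal"
  by (auto simp: mem_irrelevant_iff homogeneous_def in_keys_iff mon_deg_eq_0_iff)

lemma hcomp_0_const: "hcomp 0 p = single 0 (lookup p 0)"
  by (rule poly_mapping_eqI) (auto simp: lookup_hcomp when_def lookup_single mon_deg_eq_0_iff)

text \<open>The constant term of an element of a homogeneous ideal is again in the ideal, and a nonzero
  constant is a unit.\<close>

lemma graded_proper_le_irrelevant:
  assumes "graded J" "J \<noteq> UNIV"
  shows "J \<subseteq> irrelevant_ideal"
proof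
  fix p assume p: "p \<in> J"
  show "p \<in> irrelevant_ideal"
  proof (rule ccontr)
    define c where "c = lookup p 0"
    assume "p \<notin> irrelevant_ideal"
    then have c: "c \<noteq> 0" by (simp add: mem_irrelevant_iff c_def)
    have "single 0 c \<in> J"
      using assms(1) p by (metis hcomp_0_const c_def graded_def)
    then have "(q * single 0 (inverse c)) * single 0 c \<in> J" for q
      using assms(1) unfolding graded_def by (metis ideal.subspace_scale)
    then have "q \<in> J" for q
      using c by (simp add: mult.assoc mult_single)
    then show False using assms(2) by auto
  qed
qed

section \<open>Graded free complexes\<close>

lemma free_mod_subspace: "vec_mod.subspace (free_mod F i)"
  by (rule vec_mod.subspaceI) (simp_all add: free_mod_def smul_apply)

lemma diff_in_free_mod: "diff F i f \<in> free_mod F i"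
  by (simp add: free_mod_def diff_def)

lemma rlin_diff: "rlin (diff F i)"
proof (rule rlinI; rule ext)
  fix f g a
  show "diff F i (f + g) a = (diff F i f + diff F i g) a"
    by (simp add: diff_def distrib_left sum.distrib)
next
  fix p f a
  show "diff F i (smul p f) a = smul p (diff F i f) a"
    by (simp add: diff_def smul_apply sum_distrib_left mult.left_commute)
qed

lemmas diff_add = module_hom.add [OF rlin_diff]
  and diff_smul = module_hom.scale [OF rlin_diff]
  and diff_minus = module_hom.diff [OF rlin_diff]
  and diff_uminus = module_hom.neg [OF rlin_diff]
  and diff_0 = module_hom.zero [OF rlin_diff]

lemma aug_map_add: "aug_map F (f + g) = aug_map F f + aug_map F g"
  by (simp add: aug_map_def distrib_left sum.distrib)

lemma aug_map_smul: "aug_map F (smul p f) = p * aug_map F f"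
  by (simp add: aug_map_def smul_apply sum_distrib_left mult.left_commute)

lemma aug_map_diff: "aug_map F (f - g) = aug_map F f - aug_map F g"
  by (simp add: aug_map_def right_diff_distrib sum_subtractf)

lemma aug_map_0: "aug_map F 0 = 0"
  by (simp add: aug_map_def)

lemma diff_image_subspace: "vec_mod.subspace (diff F i ` free_mod F (Suc i))"
  by (rule module_hom.subspace_image[OF rlin_diff free_mod_subspace])

context
  fixes L :: "('n::finite, 'k::field) mpoly set" and F
  assumes F: "graded_free_resolution L F"
begin

lemma homogeneous_aug: "a < rk F 0 \<Longrightarrow> homogeneous (shift F 0 a) (aug F a)"
  using F by (simp add: graded_free_resolution_def)

lemma homogeneous_mat:
  "a < rk F i \<Longrightarrow> b < rk F (Suc i) \<Longrightarrow> homogeneous (shift F (Suc i) b - shift F i a) (mat F i a b)"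
  using F by (simp add: graded_free_resolution_def)

lemma aug_surj: "\<exists>f\<in>free_mod F 0. h - aug_map F f \<in> L"
  using F by (simp add: graded_free_resolution_def)

lemma aug_exact: "f \<in> free_mod F 0 \<Longrightarrow> aug_map F f \<in> L \<longleftrightarrow> f \<in> diff F 0 ` free_mod F (Suc 0)"
  using F unfolding graded_free_resolution_def One_nat_def by blast

lemma diff_exact:
  "f \<in> free_mod F (Suc i) \<Longrightarrow> diff F i f = 0 \<longleftrightarrow> f \<in> diff F (Suc i) ` free_mod F (Suc (Suc i))"
  using F unfolding graded_free_resolution_def by blast

lemma aug_diff: "f \<in> free_mod F (Suc 0) \<Longrightarrow> aug_map F (diff F 0 f) \<in> L"
  using aug_exact[OF diff_in_free_mod] by blast

lemma diff_diff: "f \<in> free_mod F (Suc (Suc i)) \<Longrightarrow> diff F i (diff F (Suc i) f) = 0"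
  using diff_exact[OF diff_in_free_mod] by blast

end

section \<open>Mapping cones and the Koszul resolution\<close>

definition join :: "nat \<Rightarrow> (nat \<Rightarrow> 'a) \<Rightarrow> (nat \<Rightarrow> 'a) \<Rightarrow> nat \<Rightarrow> 'a" where
  "join k u w = (\<lambda>a. if a < k then u a else w (a - k))"

text \<open>The mapping cone of multiplication by a linear form \<open>x\<close> on \<open>F\<close>. In degree \<open>i\<close> it is
  \<open>F\<^sub>i\<close> plus a copy of \<open>F\<^bsub>i-1\<^esub>\<close> with shifts raised by one, and the differential sends
  \<open>(u, w)\<close> to \<open>(d u + x w, - d w)\<close>. The indices below \<open>rk F i\<close> number the basis of the first
  summand, the others that of the second.\<close>

definition cone :: "('n::finite, 'k::field) mpoly \<Rightarrow> ('n, 'k) free_complex \<Rightarrow> ('n, 'k) free_complex" where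
  "cone x F = \<lparr>
     rk = (\<lambda>i. rk F i + (case i of 0 \<Rightarrow> 0 | Suc i' \<Rightarrow> rk F i')),
     shift = (\<lambda>i a. if a < rk F i then shift F i a else shift F (i - 1) (a - rk F i) + 1),
     mat = (\<lambda>i a b.
       if b < rk F (Suc i) then if a < rk F i then mat F i a b else 0
       else if a < rk F i then if a = b - rk F (Suc i) then x else 0
       else - mat F (i - 1) (a - rk F i) (b - rk F (Suc i))),
     aug = aug F\<rparr>"

lemma rk_cone [simp]: "rk (cone x F) 0 = rk F 0" "rk (cone x F) (Suc i) = rk F (Suc i) + rk F i"
  by (simp_all add: cone_def)

lemma free_mod_cone_0 [simp]: "free_mod (cone x F) 0 = free_mod F 0"
  by (simp add: free_mod_def)

lemma aug_map_cone [simp]: "aug_map (cone x F) = aug_map F"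
  by (simp add: aug_map_def fun_eq_iff cone_def)

lemma join_in_cone:
  "u \<in> free_mod F (Suc i) \<Longrightarrow> w \<in> free_mod F i \<Longrightarrow>
    join (rk F (Suc i)) u w \<in> free_mod (cone x F) (Suc i)"
  by (auto simp: free_mod_def join_def)

lemma free_mod_coneE:
  assumes "f \<in> free_mod (cone x F) (Suc i)"
  obtains u w where "u \<in> free_mod F (Suc i)" "w \<in> free_mod F i" "f = join (rk F (Suc i)) u w"
proof
  show "(\<lambda>a. if a < rk F (Suc i) then f a else 0) \<in> free_mod F (Suc i)"
    by (simp add: free_mod_def)
  show "(\<lambda>a. f (a + rk F (Suc i))) \<in> free_mod F i"
    using assms by (simp add: free_mod_def)
  show "f = join (rk F (Suc i)) (\<lambda>a. if a < rk F (Suc i) then f a else 0) (\<lambda>a. f (a + rk F (Suc i)))"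
    by (rule ext) (simp add: join_def)
qed

lemma sum_lessThan_add: "(\<Sum>b<k + l. f b) = (\<Sum>b<k. f b) + (\<Sum>b<l. f (k + b))"
  for f :: "nat \<Rightarrow> 'a::comm_monoid_add"
  by (induction l) (simp_all add: add.assoc)

lemma diff_cone_0:
  assumes "w \<in> free_mod F 0"
  shows "diff (cone x F) 0 (join (rk F (Suc 0)) u w) = diff F 0 u + smul x w"
proof
  fix a
  show "diff (cone x F) 0 (join (rk F (Suc 0)) u w) a = (diff F 0 u + smul x w) a"
  proof (cases "a < rk F 0")
    case True
    then have "(\<Sum>b<rk F 0. (if a = b then x else 0) * w b) = x * w a"
      by (simp add: if_distrib[of "\<lambda>y. y * _"] cong: if_cong)
    with True show ?thesis
      by (simp add: diff_def sum_lessThan_add smul_apply) (simp add: cone_def join_def)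
  next
    case False
    with assms show ?thesis by (simp add: diff_def free_mod_def smul_apply)
  qed
qed

lemma diff_cone_Suc:
  assumes "w \<in> free_mod F (Suc i)"
  shows "diff (cone x F) (Suc i) (join (rk F (Suc (Suc i))) u w)
    = join (rk F (Suc i)) (diff F (Suc i) u + smul x w) (- diff F i w)"
proof
  fix a
  show "diff (cone x F) (Suc i) (join (rk F (Suc (Suc i))) u w) a
    = join (rk F (Suc i)) (diff F (Suc i) u + smul x w) (- diff F i w) a"
  proof (cases "a < rk F (Suc i)")
    case True
    then have "(\<Sum>b<rk F (Suc i). (if a = b then x else 0) * w b) = x * w a"
      by (simp add: if_distrib[of "\<lambda>y. y * _"] cong: if_cong)
    with True show ?thesis
      by (simp add: diff_def sum_lessThan_add smul_apply) (simp add: cone_def join_def smul_apply)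
  next
    case False
    then show ?thesis
      by (simp add: diff_def sum_lessThan_add) (auto simp: cone_def join_def sum_negf)
  qed
qed

lemma join_eq_iff:
  assumes "u \<in> free_mod F (Suc i)" "u' \<in> free_mod F (Suc i)" "w \<in> free_mod F i" "w' \<in> free_mod F i"
  shows "join (rk F (Suc i)) u w = join (rk F (Suc i)) u' w' \<longleftrightarrow> u = u' \<and> w = w'"
proof
  assume *: "join (rk F (Suc i)) u w = join (rk F (Suc i)) u' w'"
  have "u a = u' a" for a
    using fun_cong[OF *, of a] assms(1,2) by (cases "a < rk F (Suc i)") (auto simp: join_def free_mod_def)
  moreover have "w a = w' a" for a
    using fun_cong[OF *, of "a + rk F (Suc i)"] by (auto simp: join_def)
  ultimately show "u = u' \<and> w = w'" by (simp add: fun_eq_iff)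
qed simp

lemma join_0: "join k (0 :: nat \<Rightarrow> 'a::zero) 0 = 0"
  by (rule ext) (simp add: join_def)

context
  fixes S :: "'n::finite set" and F :: "('n, 'k::field) free_complex" and v :: 'n
  assumes F: "graded_free_resolution (ideal.span (var ` S)) F" and v: "v \<notin> S"
begin

lemmas free_mod_closed = vec_mod.subspace_add[OF free_mod_subspace] vec_mod.subspace_diff[OF free_mod_subspace]
  vec_mod.subspace_neg[OF free_mod_subspace] vec_mod.subspace_scale[OF free_mod_subspace]
  vec_mod.subspace_0[OF free_mod_subspace] diff_in_free_mod

text \<open>The three exactness statements are the usual diagram chases. This one is exactness in degree
  \<open>0\<close>: if the image of \<open>f\<close> is \<open>q x\<close> modulo the smaller ideal, correct \<open>f\<close> by \<open>x w\<close>, where \<open>w\<close> lifts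
  \<open>q\<close>.\<close>

lemma cone_exact_aug:
  assumes f: "f \<in> free_mod F 0"
  shows "aug_map F f \<in> ideal.span (var ` insert v S) \<longleftrightarrow>
    f \<in> diff (cone (var v) F) 0 ` free_mod (cone (var v) F) (Suc 0)"
proof
  assume "aug_map F f \<in> ideal.span (var ` insert v S)"
  then obtain q where q: "aug_map F f - q * var v \<in> ideal.span (var ` S)"
    by (auto simp: ideal.span_insert)
  obtain w where w: "w \<in> free_mod F 0" "q - aug_map F w \<in> ideal.span (var ` S)"
    using aug_surj[OF F] by blast
  have "aug_map F (f - smul (var v) w) = (aug_map F f - q * var v) + var v * (q - aug_map F w)"
    by (simp add: aug_map_diff aug_map_smul algebra_simps)
  then have "aug_map F (f - smul (var v) w) \<in> ideal.span (var ` S)"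
    using q w by (metis ideal.span_add ideal.span_scale)
  moreover have "f - smul (var v) w \<in> free_mod F 0"
    using f w(1) by (intro free_mod_closed)
  ultimately have "f - smul (var v) w \<in> diff F 0 ` free_mod F (Suc 0)"
    using aug_exact[OF F] by (metis (no_types))
  then obtain u where u: "u \<in> free_mod F (Suc 0)" "f - smul (var v) w = diff F 0 u"
    by (elim imageE)
  have "f = diff (cone (var v) F) 0 (join (rk F (Suc 0)) u w)"
    by (simp only: diff_cone_0[OF w(1)] u(2)[symmetric] diff_add_cancel)
  then show "f \<in> diff (cone (var v) F) 0 ` free_mod (cone (var v) F) (Suc 0)"
    using join_in_cone[OF u(1) w(1)] by (rule image_eqI)
next
  assume "f \<in> diff (cone (var v) F) 0 ` free_mod (cone (var v) F) (Suc 0)"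
  then obtain u w where uw: "u \<in> free_mod F (Suc 0)" "w \<in> free_mod F 0"
    "f = diff (cone (var v) F) 0 (join (rk F (Suc 0)) u w)"
    by (auto elim!: free_mod_coneE)
  have "aug_map F f - aug_map F w * var v = aug_map F (diff F 0 u)"
    by (simp add: uw(3) diff_cone_0[OF uw(2)] aug_map_add aug_map_smul mult.commute)
  then have "aug_map F f - aug_map F w * var v \<in> ideal.span (var ` S)"
    using aug_diff[OF F uw(1)] by simp
  then show "aug_map F f \<in> ideal.span (var ` insert v S)"
    unfolding image_insert ideal.span_insert by blast
qed

text \<open>In degree \<open>1\<close> the regularity of the variable enters: from \<open>d u + x w = 0\<close> one gets that \<open>x\<close>
  times the image of \<open>w\<close> lies in the ideal, so that the image of \<open>w\<close> does.\<close>

lemma cone_exact_0: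
  assumes u: "u \<in> free_mod F (Suc 0)" and w: "w \<in> free_mod F 0"
  shows "diff F 0 u + smul (var v) w = 0 \<longleftrightarrow>
    (\<exists>u'\<in>free_mod F (Suc (Suc 0)). \<exists>w'\<in>free_mod F (Suc 0).
      u = diff F (Suc 0) u' + smul (var v) w' \<and> w = - diff F 0 w')"
proof
  assume eq: "diff F 0 u + smul (var v) w = 0"
  have "var v * aug_map F w = - aug_map F (diff F 0 u)"
    using arg_cong[OF eq, of "aug_map F"]
    by (simp only: aug_map_add aug_map_smul aug_map_0 add_eq_0_iff)
  then have "var v * aug_map F w \<in> ideal.span (var ` S)"
    using aug_diff[OF F u] by (simp add: ideal.span_neg)
  then have "aug_map F w \<in> ideal.span (var ` S)"
    by (rule var_nonzerodivisor[OF v])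
  then have "w \<in> diff F 0 ` free_mod F (Suc 0)"
    by (rule iffD1[OF aug_exact[OF F w]])
  then obtain w1 where w1: "w1 \<in> free_mod F (Suc 0)" "w = diff F 0 w1"
    by (elim imageE)
  define w' where "w' = - w1"
  have w': "w' \<in> free_mod F (Suc 0)" "w = - diff F 0 w'"
    using w1 by (simp_all only: w'_def diff_uminus minus_minus free_mod_closed)
  have "diff F 0 (u - smul (var v) w') = diff F 0 u + smul (var v) w"
    by (simp only: diff_minus diff_smul w'(2) vec_mod.scale_minus_right add_uminus_conv_diff)
  then have "diff F 0 (u - smul (var v) w') = 0" using eq by (rule trans)
  moreover have "u - smul (var v) w' \<in> free_mod F (Suc 0)"
    using u w'(1) by (intro free_mod_closed)
  ultimately have "u - smul (var v) w' \<in> diff F (Suc 0) ` free_mod F (Suc (Suc 0))"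
    using diff_exact[OF F] by (metis (no_types))
  then obtain u' where "u' \<in> free_mod F (Suc (Suc 0))" "u - smul (var v) w' = diff F (Suc 0) u'"
    by (elim imageE)
  moreover from this have "u = diff F (Suc 0) u' + smul (var v) w'"
    by (simp only: diff_eq_eq)
  ultimately show "\<exists>u'\<in>free_mod F (Suc (Suc 0)). \<exists>w'\<in>free_mod F (Suc 0).
      u = diff F (Suc 0) u' + smul (var v) w' \<and> w = - diff F 0 w'"
    using w' by blast
next
  assume "\<exists>u'\<in>free_mod F (Suc (Suc 0)). \<exists>w'\<in>free_mod F (Suc 0).
      u = diff F (Suc 0) u' + smul (var v) w' \<and> w = - diff F 0 w'"
  then obtain u' w' where "u' \<in> free_mod F (Suc (Suc 0))" "w' \<in> free_mod F (Suc 0)"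
    and eq: "u = diff F (Suc 0) u' + smul (var v) w'" "w = - diff F 0 w'" by blast
  then show "diff F 0 u + smul (var v) w = 0"
    by (simp only: eq diff_add diff_smul diff_diff[OF F] vec_mod.scale_minus_right add_0 right_minus)
qed

lemma cone_exact_Suc:
  assumes u: "u \<in> free_mod F (Suc (Suc i))" and w: "w \<in> free_mod F (Suc i)"
  shows "diff F (Suc i) u + smul (var v) w = 0 \<and> diff F i w = 0 \<longleftrightarrow>
    (\<exists>u'\<in>free_mod F (Suc (Suc (Suc i))). \<exists>w'\<in>free_mod F (Suc (Suc i)).
      u = diff F (Suc (Suc i)) u' + smul (var v) w' \<and> w = - diff F (Suc i) w')"
proof
  assume "diff F (Suc i) u + smul (var v) w = 0 \<and> diff F i w = 0"
  then have eq: "diff F (Suc i) u + smul (var v) w = 0" and "diff F i w = 0" by auto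
  then have "w \<in> diff F (Suc i) ` free_mod F (Suc (Suc i))"
    using diff_exact[OF F w] by (metis (no_types))
  then obtain w1 where w1: "w1 \<in> free_mod F (Suc (Suc i))" "w = diff F (Suc i) w1"
    by (elim imageE)
  define w' where "w' = - w1"
  have w': "w' \<in> free_mod F (Suc (Suc i))" "w = - diff F (Suc i) w'"
    using w1 by (simp_all only: w'_def diff_uminus minus_minus free_mod_closed)
  have "diff F (Suc i) (u - smul (var v) w') = diff F (Suc i) u + smul (var v) w"
    by (simp only: diff_minus diff_smul w'(2) vec_mod.scale_minus_right add_uminus_conv_diff)
  then have "diff F (Suc i) (u - smul (var v) w') = 0" using eq by (rule trans)
  moreover have "u - smul (var v) w' \<in> free_mod F (Suc (Suc i))"
    using u w'(1) by (intro free_mod_closed)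
  ultimately have "u - smul (var v) w' \<in> diff F (Suc (Suc i)) ` free_mod F (Suc (Suc (Suc i)))"
    using diff_exact[OF F] by (metis (no_types))
  then obtain u' where "u' \<in> free_mod F (Suc (Suc (Suc i)))" "u - smul (var v) w' = diff F (Suc (Suc i)) u'"
    by (elim imageE)
  moreover from this have "u = diff F (Suc (Suc i)) u' + smul (var v) w'"
    by (simp only: diff_eq_eq)
  ultimately show "\<exists>u'\<in>free_mod F (Suc (Suc (Suc i))). \<exists>w'\<in>free_mod F (Suc (Suc i)).
      u = diff F (Suc (Suc i)) u' + smul (var v) w' \<and> w = - diff F (Suc i) w'"
    using w' by blast
next
  assume "\<exists>u'\<in>free_mod F (Suc (Suc (Suc i))). \<exists>w'\<in>free_mod F (Suc (Suc i)).
      u = diff F (Suc (Suc i)) u' + smul (var v) w' \<and> w = - diff F (Suc i) w'"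
  then obtain u' w' where "u' \<in> free_mod F (Suc (Suc (Suc i)))" "w' \<in> free_mod F (Suc (Suc i))"
    and eq: "u = diff F (Suc (Suc i)) u' + smul (var v) w'" "w = - diff F (Suc i) w'" by blast
  then show "diff F (Suc i) u + smul (var v) w = 0 \<and> diff F i w = 0"
    by (simp only: eq diff_add diff_smul diff_uminus diff_diff[OF F] vec_mod.scale_minus_right add_0
        right_minus minus_zero simp_thms)
qed

lemma cone_image_iff:
  assumes u: "u \<in> free_mod F (Suc i)" and w: "w \<in> free_mod F i"
  shows "join (rk F (Suc i)) u w \<in> diff (cone (var v) F) (Suc i) ` free_mod (cone (var v) F) (Suc (Suc i)) \<longleftrightarrow>
    (\<exists>u'\<in>free_mod F (Suc (Suc i)). \<exists>w'\<in>free_mod F (Suc i).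
      u = diff F (Suc i) u' + smul (var v) w' \<and> w = - diff F i w')"
proof
  assume "join (rk F (Suc i)) u w \<in> diff (cone (var v) F) (Suc i) ` free_mod (cone (var v) F) (Suc (Suc i))"
  then obtain u' w' where uw: "u' \<in> free_mod F (Suc (Suc i))" "w' \<in> free_mod F (Suc i)"
    and eq: "join (rk F (Suc i)) u w = diff (cone (var v) F) (Suc i) (join (rk F (Suc (Suc i))) u' w')"
    by (auto elim!: free_mod_coneE)
  from eq[unfolded diff_cone_Suc[OF uw(2)]] have "u = diff F (Suc i) u' + smul (var v) w' \<and> w = - diff F i w'"
    by (subst (asm) join_eq_iff) (intro u w free_mod_closed uw | assumption)+
  with uw show "\<exists>u'\<in>free_mod F (Suc (Suc i)). \<exists>w'\<in>free_mod F (Suc i).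
      u = diff F (Suc i) u' + smul (var v) w' \<and> w = - diff F i w'" by blast
next
  assume "\<exists>u'\<in>free_mod F (Suc (Suc i)). \<exists>w'\<in>free_mod F (Suc i).
      u = diff F (Suc i) u' + smul (var v) w' \<and> w = - diff F i w'"
  then obtain u' w' where uw: "u' \<in> free_mod F (Suc (Suc i))" "w' \<in> free_mod F (Suc i)"
    and eq: "u = diff F (Suc i) u' + smul (var v) w'" "w = - diff F i w'" by blast
  have "join (rk F (Suc i)) u w = diff (cone (var v) F) (Suc i) (join (rk F (Suc (Suc i))) u' w')"
    by (simp only: diff_cone_Suc[OF uw(2)] eq)
  then show "join (rk F (Suc i)) u w \<in> diff (cone (var v) F) (Suc i) ` free_mod (cone (var v) F) (Suc (Suc i))"
    using join_in_cone[OF uw] by (rule image_eqI)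
qed

lemma cone_exact:
  assumes f: "f \<in> free_mod (cone (var v) F) (Suc i)"
  shows "diff (cone (var v) F) i f = 0 \<longleftrightarrow>
    f \<in> diff (cone (var v) F) (Suc i) ` free_mod (cone (var v) F) (Suc (Suc i))"
proof -
  from f obtain u w where u: "u \<in> free_mod F (Suc i)" and w: "w \<in> free_mod F i"
    and f: "f = join (rk F (Suc i)) u w" by (rule free_mod_coneE)
  show ?thesis
  proof (cases i)
    case 0
    with u w show ?thesis
      using cone_exact_0 cone_image_iff[of u 0 w] by (simp only: f diff_cone_0)
  next
    case (Suc i')
    have e1: "diff (cone (var v) F) i f = join (rk F (Suc i')) (diff F (Suc i') u + smul (var v) w) (- diff F i' w)"
      using w Suc by (simp only: f diff_cone_Suc)
    have e2: "join (rk F (Suc i')) (diff F (Suc i') u + smul (var v) w) (- diff F i' w) = 0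
        \<longleftrightarrow> diff F (Suc i') u + smul (var v) w = 0 \<and> diff F i' w = 0"
      by (subst join_0[of "rk F (Suc i')", symmetric], subst join_eq_iff)
        (use w Suc in \<open>simp_all only: neg_equal_0_iff_equal free_mod_closed\<close>)
    have "join (rk F (Suc i)) u w \<in> diff (cone (var v) F) (Suc i) ` free_mod (cone (var v) F) (Suc (Suc i))
        \<longleftrightarrow> diff F (Suc i') u + smul (var v) w = 0 \<and> diff F i' w = 0"
      using cone_exact_Suc[of u i' w] cone_image_iff[of u "Suc i'" w] u w unfolding Suc by (simp only:)
    with e1 e2 show ?thesis by (simp only: f)
  qed
qed

lemma resolution_cone: "graded_free_resolution (ideal.span (var ` insert v S)) (cone (var v) F)"
  unfolding graded_free_resolution_def aug_map_cone free_mod_cone_0 One_nat_def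
proof (intro conjI allI impI ballI)
  fix a assume "a < rk (cone (var v) F) 0"
  then show "homogeneous (shift (cone (var v) F) 0 a) (aug (cone (var v) F) a)"
    using homogeneous_aug[OF F] by (simp add: cone_def)
next
  fix i a b
  assume ab: "a < rk (cone (var v) F) i" "b < rk (cone (var v) F) (Suc i)"
  show "homogeneous (shift (cone (var v) F) (Suc i) b - shift (cone (var v) F) i a) (mat (cone (var v) F) i a b)"
  proof (cases i)
    case 0
    with ab show ?thesis
      using homogeneous_mat[OF F, of a 0 b] by (auto simp: cone_def homogeneous_var)
  next
    case (Suc i')
    with ab show ?thesis
      using homogeneous_mat[OF F, of a i b]
        homogeneous_uminus[OF homogeneous_mat[OF F, of "a - rk F i" i' "b - rk F (Suc i)"]]
      by (auto simp: cone_def homogeneous_var)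
  qed
next
  fix h
  have "ideal.span (var ` S) \<subseteq> (ideal.span (var ` insert v S) :: ('n, 'k) mpoly set)"
    by (rule ideal.span_mono) auto
  then show "\<exists>f\<in>free_mod F 0. h - aug_map F f \<in> ideal.span (var ` insert v S)"
    using aug_surj[OF F] by (meson subsetD)
next
  fix f assume "f \<in> free_mod F 0"
  then show "aug_map F f \<in> ideal.span (var ` insert v S) \<longleftrightarrow>
      f \<in> diff (cone (var v) F) 0 ` free_mod (cone (var v) F) (Suc 0)"
    by (rule cone_exact_aug)
next
  fix i f assume "f \<in> free_mod (cone (var v) F) (Suc i)"
  then show "diff (cone (var v) F) i f = 0 \<longleftrightarrow>
      f \<in> diff (cone (var v) F) (Suc i) ` free_mod (cone (var v) F) (Suc (Suc i))"
    by (rule cone_exact)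
qed

end

text \<open>Adjoining the variables one at a time to the ideal, each step being a mapping cone,
  lengthens the resolution by one. For all variables this gives Hilbert's bound on the projective
  dimension of the residue field.\<close>

lemma koszul_resolution:
  fixes S :: "'n::finite set"
  shows "\<exists>F :: ('n, 'k::field) free_complex.
    graded_free_resolution (ideal.span (var ` S)) F \<and> (\<forall>i>card S. rk F i = 0)"
proof (induction S rule: finite_induct[OF finite])
  case 1
  define F :: "('n, 'k) free_complex" where
    "F = \<lparr>rk = (\<lambda>i. if i = 0 then 1 else 0), shift = (\<lambda>_ _. 0), mat = (\<lambda>_ _ _. 0), aug = (\<lambda>_. 1)\<rparr>"
  have F0: "f \<in> free_mod F 0 \<longleftrightarrow> (\<forall>a\<ge>1. f a = 0)" "aug_map F f = f 0" for f
    by (auto simp: F_def free_mod_def aug_map_def)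
  have FS: "free_mod F (Suc i) = {0}" for i
    by (auto simp: F_def free_mod_def fun_eq_iff)
  have D: "diff F i f = 0" for i f
    by (rule ext) (simp add: F_def diff_def)
  have "graded_free_resolution {0} F"
    unfolding graded_free_resolution_def One_nat_def FS
  proof (intro conjI allI impI ballI)
    fix h :: "('n, 'k) mpoly"
    show "\<exists>f\<in>free_mod F 0. h - aug_map F f \<in> {0}"
      by (rule bexI[of _ "\<lambda>a. if a = 0 then h else 0"]) (auto simp: F0)
  next
    fix f assume f: "f \<in> free_mod F 0"
    have "f = 0" if "f 0 = 0"
    proof
      fix a show "f a = 0 a" using f that by (cases a) (auto simp: F0)
    qed
    then show "aug_map F f \<in> {0} \<longleftrightarrow> f \<in> diff F 0 ` {0}"
      by (auto simp: D F0)
  qed (auto simp: D, auto simp: F_def)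
  then show ?case
    by (intro exI[of _ F]) (simp add: F_def)
next
  case (2 v S)
  then obtain F :: "('n, 'k) free_complex"
    where F: "graded_free_resolution (ideal.span (var ` S)) F" "\<forall>i>card S. rk F i = 0" by blast
  have "rk (cone (var v) F) i = 0" if "i > card (insert v S)" for i
    using that F(2) 2 by (cases i) auto
  then show ?case
    using resolution_cone[OF F(1) 2(2)] by blast
qed

section \<open>Comparison of resolutions\<close>

lemma unit_vec_in_free_mod: "a < rk F i \<Longrightarrow> unit_vec a \<in> free_mod F i"
  by (auto simp: unit_vec_def free_mod_def)

lemma free_mod_zero: "f \<in> free_mod F i \<Longrightarrow> rk F i \<le> a \<Longrightarrow> f a = 0"
  by (simp add: free_mod_def)

lemma rlin_sub_comp:
  assumes "rlin \<phi>" "rlin \<psi>" "rlin \<chi>"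
  shows "rlin (\<lambda>f. \<phi> f - \<psi> (\<chi> f))"
  by (rule rlinI) (simp_all only: module_hom.add[OF assms(1)] module_hom.add[OF assms(2)]
      module_hom.add[OF assms(3)] module_hom.scale[OF assms(1)] module_hom.scale[OF assms(2)]
      module_hom.scale[OF assms(3)] vec_mod.scale_right_diff_distrib add_diff_add)

lemma rlin_comp:
  assumes "rlin \<psi>" "rlin \<chi>"
  shows "rlin (\<lambda>f. \<psi> (\<chi> f))"
  by (rule rlinI) (simp_all only: module_hom.add[OF assms(1)]
      module_hom.add[OF assms(2)] module_hom.scale[OF assms(1)] module_hom.scale[OF assms(2)])

lemma rlin_id: "rlin (\<lambda>f. f)"
  by (rule rlinI) (rule refl)+

text \<open>The comparison theorem. The property carried through the recursion is that a component maps
  boundaries to boundaries, which is what is needed to lift the next one.\<close>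

lemma chain_map_exists:
  fixes F G :: "('n::finite, 'k::field) free_complex"
  assumes F: "graded_free_resolution L F" and G: "graded_free_resolution L G" and L: "ideal.subspace L"
  shows "\<exists>\<phi>. (\<forall>i. rlin (\<phi> i)) \<and> (\<forall>i f. \<phi> i f \<in> free_mod G i) \<and>
    (\<forall>f\<in>free_mod F 0. aug_map F f - aug_map G (\<phi> 0 f) \<in> L) \<and>
    (\<forall>i. \<forall>f\<in>free_mod F (Suc i). diff G i (\<phi> (Suc i) f) = \<phi> i (diff F i f))"
proof -
  define P where "P i \<phi> \<longleftrightarrow> rlin \<phi> \<and> (\<forall>f. \<phi> f \<in> free_mod G i) \<and>
      (\<forall>f\<in>free_mod F (Suc i). \<phi> (diff F i f) \<in> diff G i ` free_mod G (Suc i)) \<and>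
      (i = 0 \<longrightarrow> (\<forall>f\<in>free_mod F 0. aug_map F f - aug_map G (\<phi> f) \<in> L))"
    for i and \<phi> :: "(nat \<Rightarrow> ('n, 'k) mpoly) \<Rightarrow> nat \<Rightarrow> ('n, 'k) mpoly"
  define Q where "Q i \<phi> \<psi> \<longleftrightarrow> (\<forall>f\<in>free_mod F (Suc i). diff G i (\<psi> f) = \<phi> (diff F i f))"
    for i and \<phi> \<psi> :: "(nat \<Rightarrow> ('n, 'k) mpoly) \<Rightarrow> nat \<Rightarrow> ('n, 'k) mpoly"
  have base: "\<exists>\<phi>. P 0 \<phi>"
  proof -
    have "\<forall>a. \<exists>g. g \<in> free_mod G 0 \<and> aug_map F (unit_vec a) - aug_map G g \<in> L"
      using aug_surj[OF G] by (simp add: Bex_def)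
    from choice[OF this] obtain h where h: "\<And>a. h a \<in> free_mod G 0"
      "\<And>a. aug_map F (unit_vec a) - aug_map G (h a) \<in> L" by auto
    from h(1) have "\<forall>a<rk F 0. h a \<in> free_mod G 0" by simp
    from extend_linear_map[where h = h and r = "rk F 0" and S = "free_mod G 0", OF free_mod_subspace this] obtain H
      where H: "rlin H" "\<forall>f. H f \<in> free_mod G 0" "\<forall>a<rk F 0. H (unit_vec a) = h a"
      by (elim exE conjE)
    note HG = spec[OF H(2)]
    have "vec_mod.subspace {f. aug_map F f - aug_map G (H f) \<in> L}"
    proof (rule vec_mod.subspaceI; unfold mem_Collect_eq)
      show "aug_map F 0 - aug_map G (H 0) \<in> L"
        using ideal.subspace_0[OF L] by (simp only: module_hom.zero[OF H(1)] aug_map_0 diff_self)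
    next
      fix x y assume "aug_map F x - aug_map G (H x) \<in> L" "aug_map F y - aug_map G (H y) \<in> L"
      from ideal.subspace_add[OF L this]
      show "aug_map F (x + y) - aug_map G (H (x + y)) \<in> L"
        by (simp only: module_hom.add[OF H(1)] aug_map_add add_diff_add)
    next
      fix c x assume "aug_map F x - aug_map G (H x) \<in> L"
      from ideal.subspace_scale[OF L this, of c]
      show "aug_map F (smul c x) - aug_map G (H (smul c x)) \<in> L"
        by (simp only: module_hom.scale[OF H(1)] aug_map_smul right_diff_distrib)
    qed
    from subspace_contains_free[OF this, of "rk F 0"]
    have aug: "aug_map F f - aug_map G (H f) \<in> L" if "f \<in> free_mod F 0" for f
      using h(2) H(3) free_mod_zero[OF that] by (simp only: mem_Collect_eq)
    have "H (diff F 0 f) \<in> diff G 0 ` free_mod G (Suc 0)" if f: "f \<in> free_mod F (Suc 0)" for f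
    proof -
      have "aug_map F (diff F 0 f) - (aug_map F (diff F 0 f) - aug_map G (H (diff F 0 f))) \<in> L"
        by (intro ideal.subspace_diff[OF L] aug diff_in_free_mod aug_diff[OF F f])
      then show ?thesis
        using aug_exact[OF G HG] by simp
    qed
    with H aug show ?thesis unfolding P_def by blast
  qed
  have step: "\<exists>\<psi>. P (Suc i) \<psi> \<and> Q i \<phi> \<psi>" if P: "P i \<phi>" for i \<phi>
  proof -
    have \<phi>: "rlin \<phi>" using P by (simp add: P_def)
    have ex: "\<phi> (diff F i (unit_vec a)) \<in> diff G i ` free_mod G (Suc i)" if "a < rk F (Suc i)" for a
      using P unit_vec_in_free_mod[OF that] by (simp add: P_def)
    have ex': "\<forall>a<rk F (Suc i). \<phi> (diff F i (unit_vec a)) \<in> diff G i ` free_mod G (Suc i)" using ex by simp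
    from lift_linear_map[OF rlin_diff rlin_comp[OF \<phi> rlin_diff] free_mod_subspace ex'] obtain \<psi>
      where \<psi>: "rlin \<psi>" "\<forall>f. \<psi> f \<in> free_mod G (Suc i)"
      "\<forall>f. (\<forall>a\<ge>rk F (Suc i). f a = 0) \<longrightarrow> diff G i (\<psi> f) = \<phi> (diff F i f)"
      by (elim exE conjE)
    have Q: "diff G i (\<psi> f) = \<phi> (diff F i f)" if "f \<in> free_mod F (Suc i)" for f
      by (rule \<psi>(3)[rule_format]) (rule free_mod_zero[OF that])
    have "\<psi> (diff F (Suc i) f) \<in> diff G (Suc i) ` free_mod G (Suc (Suc i))"
      if f: "f \<in> free_mod F (Suc (Suc i))" for f
    proof -
      have "diff G i (\<psi> (diff F (Suc i) f)) = 0"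
        by (simp only: Q[OF diff_in_free_mod] diff_diff[OF F f] module_hom.zero[OF \<phi>])
      then show ?thesis using diff_exact[OF G spec[OF \<psi>(2)]] by (simp only:)
    qed
    with \<psi> Q show ?thesis unfolding P_def Q_def by blast
  qed
  from dependent_nat_choice[of P Q, OF base step] obtain \<phi>
    where \<phi>: "\<And>i. P i (\<phi> i)" "\<And>i. Q i (\<phi> i) (\<phi> (Suc i))" by auto
  show ?thesis
  proof (intro exI[of _ \<phi>] conjI allI ballI)
    show "rlin (\<phi> i)" "\<phi> i f \<in> free_mod G i" for i f
      using \<phi>(1)[of i] by (simp_all only: P_def)
    show "aug_map F f - aug_map G (\<phi> 0 f) \<in> L" if "f \<in> free_mod F 0" for f
      using \<phi>(1)[of 0] that by (simp only: P_def)
    show "diff G i (\<phi> (Suc i) f) = \<phi> i (diff F i f)" if "f \<in> free_mod F (Suc i)" for i f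
      using \<phi>(2)[of i] that by (simp only: Q_def)
  qed
qed

text \<open>A chain map from a resolution of \<open>R/L\<close> to itself that induces zero on \<open>R/L\<close>.\<close>

definition lifts_zero ::
    "('n::finite, 'k::field) mpoly set \<Rightarrow> ('n, 'k) free_complex \<Rightarrow>
      (nat \<Rightarrow> (nat \<Rightarrow> ('n, 'k) mpoly) \<Rightarrow> nat \<Rightarrow> ('n, 'k) mpoly) \<Rightarrow> bool" where
  "lifts_zero L F \<theta> \<longleftrightarrow> (\<forall>i. rlin (\<theta> i)) \<and> (\<forall>i. \<forall>f\<in>free_mod F i. \<theta> i f \<in> free_mod F i) \<and>
    (\<forall>i. \<forall>f\<in>free_mod F (Suc i). diff F i (\<theta> (Suc i) f) = \<theta> i (diff F i f)) \<and>
    (\<forall>f\<in>free_mod F 0. aug_map F (\<theta> 0 f) \<in> L)"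

text \<open>A chain map over zero is null-homotopic. Only the consequence \<open>d h = \<theta>\<close> on boundaries is
  recorded: there the other summand \<open>h d\<close> of the homotopy formula vanishes. In this form the
  component \<open>h\<close> in one degree suffices to construct the next one as a lift of \<open>\<theta> - h d\<close>, and the proof is
  a plain induction on the degree.\<close>

lemma homotopy_on_boundaries:
  assumes F: "graded_free_resolution L F" and "lifts_zero L F \<theta>"
  shows "\<exists>h. rlin h \<and> (\<forall>f. h f \<in> free_mod F (Suc i)) \<and>
    (\<forall>f\<in>free_mod F (Suc i). diff F i (h (diff F i f)) = \<theta> i (diff F i f))"
proof -
  have lin: "rlin (\<theta> i)" for i
    using assms(2) by (simp only: lifts_zero_def)
  have \<theta>: "\<theta> i f \<in> free_mod F i" if "f \<in> free_mod F i" for i f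
    using assms(2) that by (simp only: lifts_zero_def)
  have chain: "diff F i (\<theta> (Suc i) f) = \<theta> i (diff F i f)" if "f \<in> free_mod F (Suc i)" for i f
    using assms(2) that by (simp only: lifts_zero_def)
  have aug: "aug_map F (\<theta> 0 f) \<in> L" if "f \<in> free_mod F 0" for f
    using assms(2) that by (simp only: lifts_zero_def)
  show ?thesis
  proof (induction i)
    case 0
    have ex: "\<theta> 0 (unit_vec a) \<in> diff F 0 ` free_mod F (Suc 0)" if "a < rk F 0" for a
      using aug_exact[OF F \<theta>] aug unit_vec_in_free_mod[OF that] by (simp only:)
    have ex': "\<forall>a<rk F 0. \<theta> 0 (unit_vec a) \<in> diff F 0 ` free_mod F (Suc 0)" using ex by simp
    from lift_linear_map[OF rlin_diff lin free_mod_subspace ex'] obtain h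
      where h: "rlin h" "\<forall>f. h f \<in> free_mod F (Suc 0)"
      "\<forall>f. (\<forall>a\<ge>rk F 0. f a = 0) \<longrightarrow> diff F 0 (h f) = \<theta> 0 f"
      by (elim exE conjE)
    have "diff F 0 (h (diff F 0 f)) = \<theta> 0 (diff F 0 f)" for f
      by (rule h(3)[rule_format]) (rule free_mod_zero[OF diff_in_free_mod])
    with h(1,2) show ?case by blast
  next
    case (Suc i)
    then obtain h where h: "rlin h" "\<forall>f. h f \<in> free_mod F (Suc i)"
      "\<forall>f\<in>free_mod F (Suc i). diff F i (h (diff F i f)) = \<theta> i (diff F i f)"
      by (elim exE conjE)
    define \<theta>' where "\<theta>' f = \<theta> (Suc i) f - h (diff F i f)" for f
    have \<theta>': "rlin \<theta>'"
      unfolding \<theta>'_def by (rule rlin_sub_comp[OF lin h(1) rlin_diff])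
    have ex: "\<theta>' (unit_vec a) \<in> diff F (Suc i) ` free_mod F (Suc (Suc i))" if "a < rk F (Suc i)" for a
    proof -
      note u = unit_vec_in_free_mod[OF that]
      have "\<theta>' (unit_vec a) \<in> free_mod F (Suc i)"
        unfolding \<theta>'_def by (intro vec_mod.subspace_diff[OF free_mod_subspace] \<theta> u spec[OF h(2)])
      moreover have "diff F i (\<theta>' (unit_vec a)) = 0"
        by (simp only: \<theta>'_def diff_minus chain[OF u] bspec[OF h(3) u] diff_self)
      ultimately show ?thesis
        using diff_exact[OF F] by (metis (no_types))
    qed
    have ex': "\<forall>a<rk F (Suc i). \<theta>' (unit_vec a) \<in> diff F (Suc i) ` free_mod F (Suc (Suc i))" using ex by simp
    from lift_linear_map[OF rlin_diff \<theta>' free_mod_subspace ex'] obtain g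
      where g: "rlin g" "\<forall>f. g f \<in> free_mod F (Suc (Suc i))"
      "\<forall>f. (\<forall>a\<ge>rk F (Suc i). f a = 0) \<longrightarrow> diff F (Suc i) (g f) = \<theta>' f"
      by (elim exE conjE)
    have "diff F (Suc i) (g (diff F (Suc i) f)) = \<theta> (Suc i) (diff F (Suc i) f)"
      if f: "f \<in> free_mod F (Suc (Suc i))" for f
    proof -
      have "diff F (Suc i) (g (diff F (Suc i) f)) = \<theta>' (diff F (Suc i) f)"
        by (rule g(3)[rule_format]) (rule free_mod_zero[OF diff_in_free_mod])
      then show ?thesis
        by (simp only: \<theta>'_def diff_diff[OF F f] module_hom.zero[OF h(1)] diff_zero)
    qed
    with g(1,2) show ?case by blast
  qed
qed

text \<open>The submodule \<open>J F\<^sub>i\<close> of \<open>F\<^sub>i\<close>.\<close>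

definition ideal_mod :: "('n::finite, 'k::field) mpoly set \<Rightarrow> ('n, 'k) free_complex \<Rightarrow> nat \<Rightarrow> (nat \<Rightarrow> ('n, 'k) mpoly) set" where
  "ideal_mod J F i = {f \<in> free_mod F i. \<forall>a. f a \<in> J}"

lemma rlin_ideal:
  assumes J: "ideal.subspace J" and h: "rlin h" and f: "f \<in> ideal_mod J F i"
  shows "h f a \<in> J"
proof -
  have f0: "\<And>a. rk F i \<le> a \<Longrightarrow> f a = 0" and fJ: "\<And>a. f a \<in> J"
    using f by (auto simp: ideal_mod_def free_mod_def)
  have "h f = (\<Sum>b<rk F i. smul (f b) (h (unit_vec b)))"
    by (subst vec_expand[OF f0]) (simp_all only: module_hom.sum[OF h] module_hom.scale[OF h])
  then have "h f a = (\<Sum>b<rk F i. h (unit_vec b) a * f b)"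
    by (simp only: sum_fun_apply smul_apply mult.commute)
  then show ?thesis
    using fJ by (simp add: ideal.subspace_sum[OF J] ideal.subspace_scale[OF J])
qed

text \<open>Write \<open>B\<close> for the boundaries in \<open>F\<^sub>i\<close>. The homotopy is linear, so it maps \<open>J F\<^sub>i\<close> into
  \<open>J F\<^bsub>i+1\<^esub>\<close>; thus \<open>\<theta>\<close> maps \<open>B \<inter> J F\<^sub>i\<close> into \<open>J B\<close>. The quotient of these two modules is
  Tor of \<open>R/L\<close> and \<open>R/J\<close> in degree \<open>i + 1\<close>, so this says that \<open>\<theta>\<close> acts on Tor as zero.\<close>

lemma null_homotopic_on_boundaries:
  assumes F: "graded_free_resolution L F" and J: "ideal.subspace J"
    and \<theta>: "lifts_zero L F \<theta>"
    and b: "b \<in> diff F i ` free_mod F (Suc i)" "\<And>a. b a \<in> J"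
  shows "\<theta> i b \<in> diff F i ` ideal_mod J F (Suc i)"
proof -
  from homotopy_on_boundaries[OF F \<theta>, of i] obtain h
    where h: "rlin h" "\<forall>f. h f \<in> free_mod F (Suc i)"
    "\<forall>f\<in>free_mod F (Suc i). diff F i (h (diff F i f)) = \<theta> i (diff F i f)"
    by (elim exE conjE)
  from b(1) obtain f where f: "b = diff F i f" "f \<in> free_mod F (Suc i)" by (elim imageE)
  have "b \<in> ideal_mod J F i"
    using b(2) diff_in_free_mod by (simp add: ideal_mod_def f(1))
  from rlin_ideal[OF J h(1) this] have "h b \<in> ideal_mod J F (Suc i)"
    using h(2) by (simp add: ideal_mod_def)
  moreover have "\<theta> i b = diff F i (h b)"
    by (simp only: f(1) bspec[OF h(3) f(2)])
  ultimately show ?thesis by (intro image_eqI)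
qed

text \<open>Multiplication by an element of \<open>L\<close> lifts the zero map of \<open>R/L\<close>, hence \<open>L\<close> annihilates
  Tor.\<close>

lemma ideal_mult_boundary:
  assumes F: "graded_free_resolution L F" and J: "ideal.subspace J" and L: "ideal.subspace L" and x: "x \<in> L"
    and b: "b \<in> diff F i ` free_mod F (Suc i)" "\<And>a. b a \<in> J"
  shows "smul x b \<in> diff F i ` ideal_mod J F (Suc i)"
proof (rule null_homotopic_on_boundaries[OF F J, of "\<lambda>i. smul x"]; (unfold lifts_zero_def, intro conjI allI ballI)?)
  show "rlin (smul x)"
    by (rule rlinI) (simp_all only: vec_mod.scale_right_distrib smul_smul mult.commute)
  show "smul x f \<in> free_mod F i" if "f \<in> free_mod F i" for i f
    using that by (rule vec_mod.subspace_scale[OF free_mod_subspace])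
  show "diff F i (smul x f) = smul x (diff F i f)" for i f
    by (rule diff_smul)
  show "aug_map F (smul x f) \<in> L" for f
    using ideal.subspace_scale[OF L x, of "aug_map F f"] by (simp only: aug_map_smul mult.commute)
qed (fact b)+

text \<open>If \<open>\<phi>\<close> and \<open>\<psi>\<close> are chain maps between \<open>F\<close> and a resolution \<open>G\<close> that vanishes in degree
  \<open>i + 1\<close>, then \<open>1 - \<psi>\<phi>\<close> lifts zero, while on the boundaries of \<open>F\<^sub>i\<close> it is the identity because
  \<open>\<phi>\<close> kills them. Hence Tor in degree \<open>i + 1\<close>, computed from \<open>F\<close>, vanishes.\<close>

lemma boundary_past_length:
  assumes F: "graded_free_resolution L F" and G: "graded_free_resolution L G" and L: "ideal.subspace L"
    and J: "ideal.subspace J" and i: "rk G (Suc i) = 0"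
    and b: "b \<in> diff F i ` free_mod F (Suc i)" "\<And>a. b a \<in> J"
  shows "b \<in> diff F i ` ideal_mod J F (Suc i)"
proof -
  from chain_map_exists[OF F G L] obtain \<phi> where \<phi>': "\<forall>i. rlin (\<phi> i)" "\<forall>i f. \<phi> i f \<in> free_mod G i"
    "\<forall>f\<in>free_mod F 0. aug_map F f - aug_map G (\<phi> 0 f) \<in> L"
    "\<forall>i. \<forall>f\<in>free_mod F (Suc i). diff G i (\<phi> (Suc i) f) = \<phi> i (diff F i f)"
    by (elim exE conjE)
  note \<phi> = \<phi>'[rule_format]
  from chain_map_exists[OF G F L] obtain \<psi> where \<psi>': "\<forall>i. rlin (\<psi> i)" "\<forall>i f. \<psi> i f \<in> free_mod F i"
    "\<forall>f\<in>free_mod G 0. aug_map G f - aug_map F (\<psi> 0 f) \<in> L"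
    "\<forall>i. \<forall>f\<in>free_mod G (Suc i). diff F i (\<psi> (Suc i) f) = \<psi> i (diff G i f)"
    by (elim exE conjE)
  note \<psi> = \<psi>'[rule_format]
  define \<theta> where "\<theta> i f = f - \<psi> i (\<phi> i f)" for i f
  have "lifts_zero L F \<theta>"
    unfolding lifts_zero_def
  proof (intro conjI allI ballI)
    show "rlin (\<theta> i)" for i
      unfolding \<theta>_def by (rule rlin_sub_comp[OF rlin_id \<psi>(1) \<phi>(1)])
    show "\<theta> i f \<in> free_mod F i" if "f \<in> free_mod F i" for i f
      unfolding \<theta>_def using that \<psi>(2) by (rule vec_mod.subspace_diff[OF free_mod_subspace])
    show "diff F i (\<theta> (Suc i) f) = \<theta> i (diff F i f)" if "f \<in> free_mod F (Suc i)" for i f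
      by (simp only: \<theta>_def diff_minus \<psi>(4)[OF \<phi>(2)] \<phi>(4)[OF that])
    show "aug_map F (\<theta> 0 f) \<in> L" if "f \<in> free_mod F 0" for f
      using ideal.subspace_add[OF L \<phi>(3)[OF that] \<psi>(3)[OF \<phi>(2)], of f]
      by (simp add: \<theta>_def aug_map_diff)
  qed
  from null_homotopic_on_boundaries[OF F J this b]
  have "\<theta> i b \<in> diff F i ` ideal_mod J F (Suc i)" .
  moreover have "\<theta> i b = b"
  proof -
    from b(1) obtain f where f: "b = diff F i f" "f \<in> free_mod F (Suc i)" by (elim imageE)
    have "\<phi> (Suc i) f = 0"
      using \<phi>(2)[of "Suc i" f] i by (simp add: free_mod_def fun_eq_iff)
    then have "\<phi> i b = 0"
      using \<phi>(4)[OF f(2)] by (simp only: f(1) diff_0)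
    then show ?thesis
      by (simp only: \<theta>_def module_hom.zero[OF \<psi>(1)] diff_zero)
  qed
  ultimately show ?thesis by (simp only:)
qed

section \<open>Betti numbers as quotients of syzygies\<close>

lemma (in vector_space) dim_diff_eq_0_iff:
  assumes S: "subspace S" and T: "subspace T" and ST: "S \<subseteq> T" and W: "T \<subseteq> span W" "finite W"
  shows "dim T - dim S = 0 \<longleftrightarrow> S = T"
proof
  assume dim: "dim T - dim S = 0"
  show "S = T"
  proof (rule ccontr)
    assume "S \<noteq> T"
    then obtain x where x: "x \<in> T" "x \<notin> S" using ST by blast
    obtain B where B: "B \<subseteq> S" "independent B" "S \<subseteq> span B" "card B = dim S"
      using basis_exists by blast
    have "x \<notin> span B"
      using x(2) span_minimal[OF B(1) S] by blast
    then have ind: "independent (insert x B)"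
      using B(2) by (simp add: independent_insert)
    have "insert x B \<subseteq> T" using x(1) B(1) ST by blast
    from maximal_independent_subset_extend[OF this ind]
    obtain D where D: "insert x B \<subseteq> D" "D \<subseteq> T" "independent D" "T \<subseteq> span D" by blast
    have fin: "finite D"
      using independent_span_bound[OF W(2) D(3)] D(2) W(1) by blast
    have "dim T = card D"
      using D by (intro dim_unique) auto
    moreover have "card (insert x B) \<le> card D"
      using fin D(1) by (rule card_mono)
    moreover have "card (insert x B) = Suc (card B)"
      using \<open>x \<notin> span B\<close> span_superset[of B] finite_subset[OF D(1) fin] by (subst card_insert_disjoint) auto
    ultimately show False using dim B(4) by simp
  qed
qed simp

text \<open>The projection of \<open>F\<^sub>i\<close> onto its homogeneous part of degree \<open>j\<close>.\<close>

definition vcomp :: "('n::finite, 'k::field) free_complex \<Rightarrow> nat \<Rightarrow> int \<Rightarrow> (nat \<Rightarrow> ('n, 'k) mpoly) \<Rightarrow> nat \<Rightarrow> ('n, 'k) mpoly" where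
  "vcomp F i j f = (\<lambda>a. hcomp (j - shift F i a) (f a))"

lemma vcomp_in_free_mod: "f \<in> free_mod F i \<Longrightarrow> vcomp F i j f \<in> free_mod F i"
  by (simp add: vcomp_def free_mod_def)

lemma vcomp_in_free_mod_deg: "f \<in> free_mod F i \<Longrightarrow> vcomp F i j f \<in> free_mod_deg F i j"
  by (simp add: free_mod_deg_def vcomp_in_free_mod) (simp add: vcomp_def homogeneous_hcomp)

lemma vcomp_ident: "f \<in> free_mod_deg F i j \<Longrightarrow> vcomp F i j f = f"
proof
  fix a assume f: "f \<in> free_mod_deg F i j"
  show "vcomp F i j f a = f a"
  proof (cases "a < rk F i")
    case True
    with f have "homogeneous (j - shift F i a) (f a)" by (simp add: free_mod_deg_def)
    then show ?thesis by (simp add: vcomp_def homogeneous_iff_hcomp)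
  next
    case False
    with f show ?thesis by (simp add: vcomp_def free_mod_deg_def free_mod_def)
  qed
qed

lemma vcomp_ideal: "graded J \<Longrightarrow> \<forall>a. f a \<in> J \<Longrightarrow> vcomp F i j f a \<in> J"
  by (simp add: vcomp_def graded_def)

lemma diff_vcomp:
  assumes "graded_free_resolution L F"
  shows "diff F i (vcomp F (Suc i) j f) = vcomp F i j (diff F i f)"
proof
  fix a
  show "diff F i (vcomp F (Suc i) j f) a = vcomp F i j (diff F i f) a"
  proof (cases "a < rk F i")
    case True
    have "mat F i a b * hcomp (j - shift F (Suc i) b) (f b) = hcomp (j - shift F i a) (mat F i a b * f b)"
      if "b < rk F (Suc i)" for b
      using hcomp_mult[OF homogeneous_mat[OF assms True that], of "j - shift F i a" "f b"] by simp
    with True show ?thesis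
      by (simp add: diff_def vcomp_def hcomp_sum)
  next
    case False
    then show ?thesis by (simp add: diff_def vcomp_def)
  qed
qed

lemma free_mod_deg_subspace: "poly_vec.subspace (free_mod_deg F i j)"
proof (rule poly_vec.subspaceI)
  show "0 \<in> free_mod_deg F i j" by (simp add: free_mod_deg_def free_mod_def)
  show "x + y \<in> free_mod_deg F i j" if "x \<in> free_mod_deg F i j" "y \<in> free_mod_deg F i j" for x y
    using that by (simp add: free_mod_deg_def free_mod_def homogeneous_add)
  show "vec_scale c x \<in> free_mod_deg F i j" if "x \<in> free_mod_deg F i j" for c x
    using that homogeneous_mult[OF homogeneous_const]
    by (fastforce simp: free_mod_deg_def free_mod_def vec_scale_def)
qed

lemma finite_mon_deg: "finite {m :: 'n::finite \<Rightarrow>\<^sub>0 nat. mon_deg m \<le> d}"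
proof -
  have "finite {f. \<forall>x :: 'n. (x \<in> UNIV \<longrightarrow> f x \<in> {..d}) \<and> (x \<notin> UNIV \<longrightarrow> f x = 0)}"
    by (rule finite_set_of_finite_funs) auto
  moreover have "lookup ` {m :: 'n \<Rightarrow>\<^sub>0 nat. mon_deg m \<le> d} \<subseteq>
      {f. \<forall>x. (x \<in> UNIV \<longrightarrow> f x \<in> {..d}) \<and> (x \<notin> UNIV \<longrightarrow> f x = 0)}"
  proof safe
    fix m :: "'n \<Rightarrow>\<^sub>0 nat" and x assume "mon_deg m \<le> d"
    moreover have "lookup m x \<le> mon_deg m"
      unfolding mon_deg_def by (rule member_le_sum) auto
    ultimately show "lookup m x \<le> d" by simp
  qed auto
  ultimately have "finite (lookup ` {m :: 'n \<Rightarrow>\<^sub>0 nat. mon_deg m \<le> d})"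
    by (rule finite_subset[rotated])
  then show ?thesis
    by (rule finite_imageD) (auto intro: inj_onI poly_mapping_eqI)
qed

lemma free_mod_deg_finite_dim:
  fixes F :: "('n::finite, 'k::field) free_complex"
  obtains W where "finite W" "free_mod_deg F i j \<subseteq> poly_vec.span W"
proof
  define A where "A = (SIGMA a:{..<rk F i}. {m :: 'n \<Rightarrow>\<^sub>0 nat. mon_deg m \<le> nat (j - shift F i a)})"
  define W where "W = (\<lambda>(a, m). smul (single m (1::'k)) (unit_vec a)) ` A"
  show "finite W"
    unfolding W_def A_def by (intro finite_imageI finite_SigmaI finite_mon_deg) simp
  show "free_mod_deg F i j \<subseteq> poly_vec.span W"
  proof
    fix f assume f: "f \<in> free_mod_deg F i j"
    have monomial: "smul (single m c) (unit_vec a) \<in> poly_vec.span W"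
      if "a < rk F i" "m \<in> keys (f a)" for a m c
    proof -
      have "int (mon_deg m) = j - shift F i a"
        using f that by (simp add: free_mod_deg_def homogeneous_def)
      then have "(a, m) \<in> A"
        using that(1) by (simp add: A_def)
      then have "smul (single m 1) (unit_vec a) \<in> W"
        unfolding W_def by (rule rev_image_eqI) simp
      then have "vec_scale c (smul (single m 1) (unit_vec a)) \<in> poly_vec.span W"
        by (intro poly_vec.span_scale poly_vec.span_base)
      then show ?thesis
        by (simp add: vec_scale_eq_smul smul_smul mult_single)
    qed
    have "smul (f a) (unit_vec a) \<in> poly_vec.span W" if "a < rk F i" for a
    proof -
      have "smul (f a) (unit_vec a) = (\<Sum>m\<in>keys (f a).
          smul (single m (lookup (f a) m)) (unit_vec a))"
        by (simp only: vec_mod.scale_sum_left[symmetric] poly_mapping_sum_single[symmetric])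
      then show ?thesis
        using monomial[OF that] by (simp only: poly_vec.span_sum)
    qed
    then have "(\<Sum>a<rk F i. smul (f a) (unit_vec a)) \<in> poly_vec.span W"
      by (intro poly_vec.span_sum) simp
    moreover have "f \<in> free_mod F i" using f by (simp add: free_mod_deg_def)
    from vec_expand[OF free_mod_zero[OF this]]
    have "f = (\<Sum>a<rk F i. smul (f a) (unit_vec a))" .
    ultimately show "f \<in> poly_vec.span W" by (rule ssubst[rotated])
  qed
qed

lemma tor_cycles_subspace:
  assumes J: "ideal.subspace J"
  shows "poly_vec.subspace (tor_cycles F J i j)"
proof (cases i)
  case 0
  then show ?thesis using free_mod_deg_subspace by (simp add: tor_cycles_def)
next
  case (Suc i')
  have "poly_vec.subspace {f. \<forall>a. diff F i' f a \<in> J}"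
    by (rule poly_vec.subspaceI) (simp_all add: diff_0 diff_add vec_scale_eq_smul diff_smul smul_apply
        ideal.subspace_0[OF J] ideal.subspace_add[OF J] ideal.subspace_scale[OF J])
  from poly_vec.subspace_inter[OF free_mod_deg_subspace this] show ?thesis
    by (simp add: tor_cycles_def Suc Collect_conj_eq[symmetric] Int_def)
qed

lemma tor_boundaries_subspace:
  assumes J: "ideal.subspace J"
  shows "poly_vec.subspace (tor_boundaries F J i j)"
proof (rule poly_vec.subspaceI)
  show "0 \<in> tor_boundaries F J i j"
    using poly_vec.subspace_0[OF free_mod_deg_subspace]
    by (auto simp: tor_boundaries_def diff_0 ideal.subspace_0[OF J] intro!: bexI[of _ 0])
next
  fix x y assume "x \<in> tor_boundaries F J i j" "y \<in> tor_boundaries F J i j"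
  then obtain g h where xy: "x \<in> free_mod_deg F i j" "y \<in> free_mod_deg F i j"
    and gh: "g \<in> free_mod_deg F (Suc i) j" "h \<in> free_mod_deg F (Suc i) j"
    and *: "\<forall>a. x a - diff F i g a \<in> J" "\<forall>a. y a - diff F i h a \<in> J"
    unfolding tor_boundaries_def by (elim CollectE conjE bexE) simp
  have "(x + y) a - diff F i (g + h) a \<in> J" for a
    using ideal.subspace_add[OF J spec[OF *(1), of a] spec[OF *(2), of a]]
    by (simp only: diff_add plus_fun_apply add_diff_add)
  moreover note poly_vec.subspace_add[OF free_mod_deg_subspace xy] poly_vec.subspace_add[OF free_mod_deg_subspace gh]
  ultimately show "x + y \<in> tor_boundaries F J i j"
    unfolding tor_boundaries_def by blast
next
  fix c x assume "x \<in> tor_boundaries F J i j"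
  then obtain g where x: "x \<in> free_mod_deg F i j"
    and g: "g \<in> free_mod_deg F (Suc i) j" and *: "\<forall>a. x a - diff F i g a \<in> J"
    unfolding tor_boundaries_def by (elim CollectE conjE bexE) simp
  have "vec_scale c x a - diff F i (vec_scale c g) a \<in> J" for a
    using ideal.subspace_scale[OF J spec[OF *, of a], of "single 0 c"]
    by (simp only: vec_scale_eq_smul diff_smul smul_apply right_diff_distrib)
  moreover note poly_vec.subspace_scale[OF free_mod_deg_subspace x] poly_vec.subspace_scale[OF free_mod_deg_subspace g]
  ultimately show "vec_scale c x \<in> tor_boundaries F J i j"
    unfolding tor_boundaries_def by blast
qed

lemma tor_boundaries_subset_cycles:
  assumes F: "graded_free_resolution L F" and J: "ideal.subspace J"
  shows "tor_boundaries F J i j \<subseteq> tor_cycles F J i j"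
proof
  fix f assume f: "f \<in> tor_boundaries F J i j"
  then obtain g where fd: "f \<in> free_mod_deg F i j" and g: "g \<in> free_mod_deg F (Suc i) j"
    and *: "\<forall>a. f a - diff F i g a \<in> J"
    unfolding tor_boundaries_def by (elim CollectE conjE bexE) simp
  show "f \<in> tor_cycles F J i j"
  proof (cases i)
    case 0
    with fd show ?thesis by (simp add: tor_cycles_def)
  next
    case (Suc i')
    have ff: "f \<in> free_mod F i" and gg: "g \<in> free_mod F (Suc i)"
      using fd g by (simp_all add: free_mod_deg_def)
    have "f - diff F i g \<in> ideal_mod J F i"
      using * vec_mod.subspace_diff[OF free_mod_subspace ff diff_in_free_mod] by (simp add: ideal_mod_def)
    then have "diff F i' (f - diff F i g) a \<in> J" for a
      by (rule rlin_ideal[OF J rlin_diff])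
    moreover have "diff F i' (f - diff F i g) = diff F i' f"
      using diff_diff[OF F] gg unfolding Suc by (simp only: diff_minus diff_zero)
    ultimately show ?thesis
      using fd by (simp add: tor_cycles_def Suc)
  qed
qed

text \<open>The resolution of the residue field from which the Betti numbers are computed. Nothing is
  known about it except that it is a resolution; it can be infinite and far from minimal.\<close>

definition chosen_resolution :: "('n::finite, 'k::field) free_complex" where
  "chosen_resolution = (SOME F. graded_free_resolution irrelevant_ideal F)"

lemma resolution_exists:
  "\<exists>F :: ('n::finite, 'k::field) free_complex.
    graded_free_resolution irrelevant_ideal F \<and> (\<forall>i>card (UNIV :: 'n set). rk F i = 0)"
  using koszul_resolution[of UNIV] by (simp add: irrelevant_ideal_def)

lemma chosen_resolution: "graded_free_resolution irrelevant_ideal chosen_resolution"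
proof -
  from resolution_exists have "\<exists>F :: ('a, 'b) free_complex. graded_free_resolution irrelevant_ideal F" by blast
  then show ?thesis unfolding chosen_resolution_def by (rule someI_ex)
qed

lemma betti_nonzero_iff:
  fixes J :: "('n::finite, 'k::field) mpoly set"
  assumes J: "ideal.subspace J"
  shows "betti i j J \<noteq> 0 \<longleftrightarrow> (\<exists>f\<in>tor_cycles chosen_resolution J i j. f \<notin> tor_boundaries chosen_resolution J i j)"
proof -
  obtain W :: "(nat \<Rightarrow> ('n, 'k) mpoly) set"
    where W: "finite W" "free_mod_deg chosen_resolution i j \<subseteq> poly_vec.span W"
    by (rule free_mod_deg_finite_dim)
  have "tor_cycles chosen_resolution J i j \<subseteq> poly_vec.span W"
    using W(2) by (auto simp: tor_cycles_def)
  note * = poly_vec.dim_diff_eq_0_iff[OF tor_boundaries_subspace[OF J] tor_cycles_subspace[OF J]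
      tor_boundaries_subset_cycles[OF chosen_resolution J] this W(1)]
  have "betti i j J = poly_vec.dim (tor_cycles chosen_resolution J i j) - poly_vec.dim (tor_boundaries chosen_resolution J i j)"
    by (simp add: betti_def tor_dim_def chosen_resolution_def Let_def)
  then show ?thesis
    using * tor_boundaries_subset_cycles[OF chosen_resolution J, of i j] by (simp only:) (rule iffI; blast)
qed

lemma irrelevant_subspace: "ideal.subspace irrelevant_ideal"
  by (simp add: irrelevant_ideal_def)

text \<open>Applying the differential to a cycle modulo \<open>J\<close> identifies Tor in degree \<open>i + 1\<close> with the
  quotient of \<open>B \<inter> J F\<^sub>i\<close> by \<open>J B\<close>, where \<open>B\<close> is the image of \<open>F\<^bsub>i+1\<^esub>\<close> in \<open>F\<^sub>i\<close>. As \<open>J\<close> runs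
  through the powers of an ideal, the modules \<open>B \<inter> J F\<^sub>i\<close> form a graded module over the Rees
  algebra. This is the reason for the reformulation.\<close>

lemma betti_Suc_iff:
  assumes J: "graded J"
  shows "betti (Suc i) j J \<noteq> 0 \<longleftrightarrow>
    (\<exists>b\<in>free_mod_deg chosen_resolution i j. b \<in> diff chosen_resolution i ` free_mod chosen_resolution (Suc i) \<and> (\<forall>a. b a \<in> J) \<and>
      b \<notin> diff chosen_resolution i ` ideal_mod J chosen_resolution (Suc i))"
proof -
  have Js: "ideal.subspace J" using J by (simp add: graded_def)
  let ?F = "chosen_resolution :: ('a, 'b) free_complex"
  show ?thesis unfolding betti_nonzero_iff[OF Js]
  proof (intro iffI; elim bexE conjE)
    fix f assume f: "f \<in> tor_cycles ?F J (Suc i) j" "f \<notin> tor_boundaries ?F J (Suc i) j"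
    then have fd: "f \<in> free_mod_deg ?F (Suc i) j" and fJ: "\<forall>a. diff ?F i f a \<in> J"
      by (simp_all add: tor_cycles_def)
    have ff: "f \<in> free_mod ?F (Suc i)" using fd by (simp add: free_mod_deg_def)
    have eq: "diff ?F i f = vcomp ?F i j (diff ?F i f)"
      using diff_vcomp[OF chosen_resolution, of i j f] by (simp only: vcomp_ident[OF fd])
    then have "diff ?F i f \<in> free_mod_deg ?F i j"
      using vcomp_in_free_mod_deg[OF diff_in_free_mod[of ?F i f], of j] by (simp only: eq[symmetric])
    moreover have "diff ?F i f \<notin> diff ?F i ` ideal_mod J ?F (Suc i)"
    proof
      assume "diff ?F i f \<in> diff ?F i ` ideal_mod J ?F (Suc i)"
      then obtain u where u: "diff ?F i f = diff ?F i u" "u \<in> ideal_mod J ?F (Suc i)" by (elim imageE)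
      define u' where "u' = vcomp ?F (Suc i) j u"
      have uf: "u \<in> free_mod ?F (Suc i)" and uJ: "\<forall>a. u a \<in> J" using u(2) by (simp_all add: ideal_mod_def)
      have u'f: "u' \<in> free_mod ?F (Suc i)" unfolding u'_def by (rule vcomp_in_free_mod[OF uf])
      have u'J: "u' a \<in> J" for a unfolding u'_def by (rule vcomp_ideal[OF J uJ])
      have "diff ?F i u' = diff ?F i f"
        by (simp only: u'_def diff_vcomp[OF chosen_resolution] u(1)[symmetric] eq[symmetric])
      then have "diff ?F i (f - u') = 0" by (simp only: diff_minus diff_self)
      moreover have "f - u' \<in> free_mod ?F (Suc i)"
        by (rule vec_mod.subspace_diff[OF free_mod_subspace ff u'f])
      ultimately have "f - u' \<in> diff ?F (Suc i) ` free_mod ?F (Suc (Suc i))"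
        using diff_exact[OF chosen_resolution] by (metis (no_types))
      then obtain g where g: "f - u' = diff ?F (Suc i) g" "g \<in> free_mod ?F (Suc (Suc i))" by (elim imageE)
      define g' where "g' = vcomp ?F (Suc (Suc i)) j g"
      have g': "g' \<in> free_mod_deg ?F (Suc (Suc i)) j"
        unfolding g'_def by (rule vcomp_in_free_mod_deg[OF g(2)])
      have "f - u' \<in> free_mod_deg ?F (Suc i) j"
        using fd vcomp_in_free_mod_deg[OF uf] unfolding u'_def
        by (rule poly_vec.subspace_diff[OF free_mod_deg_subspace])
      then have "diff ?F (Suc i) g' = f - u'"
        by (simp only: g'_def diff_vcomp[OF chosen_resolution] g(1)[symmetric] vcomp_ident)
      then have "f a - diff ?F (Suc i) g' a = u' a" for a
        by simp
      with u'J have "\<forall>a. f a - diff ?F (Suc i) g' a \<in> J" by (simp only: simp_thms)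
      with fd g' have "f \<in> tor_boundaries ?F J (Suc i) j"
        unfolding tor_boundaries_def by (intro CollectI conjI bexI)
      with f(2) show False by contradiction
    qed
    moreover have "diff ?F i f \<in> diff ?F i ` free_mod ?F (Suc i)" using ff by (rule imageI)
    ultimately show "\<exists>b\<in>free_mod_deg ?F i j. b \<in> diff ?F i ` free_mod ?F (Suc i) \<and> (\<forall>a. b a \<in> J) \<and>
        b \<notin> diff ?F i ` ideal_mod J ?F (Suc i)"
      using fJ by (intro bexI[of _ "diff ?F i f"] conjI)
  next
    fix b assume bd: "b \<in> free_mod_deg ?F i j" and "b \<in> diff ?F i ` free_mod ?F (Suc i)"
      and bJ: "\<forall>a. b a \<in> J" and nb: "b \<notin> diff ?F i ` ideal_mod J ?F (Suc i)"
    then obtain f where f: "b = diff ?F i f" "f \<in> free_mod ?F (Suc i)" by (elim imageE)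
    define f' where "f' = vcomp ?F (Suc i) j f"
    have f'd: "f' \<in> free_mod_deg ?F (Suc i) j"
      unfolding f'_def by (rule vcomp_in_free_mod_deg[OF f(2)])
    have f'b: "diff ?F i f' = b"
      by (simp only: f'_def diff_vcomp[OF chosen_resolution] f(1)[symmetric] vcomp_ident[OF bd])
    have "f' \<in> tor_cycles ?F J (Suc i) j"
      using f'd bJ by (simp add: tor_cycles_def f'b)
    moreover have "f' \<notin> tor_boundaries ?F J (Suc i) j"
    proof
      assume "f' \<in> tor_boundaries ?F J (Suc i) j"
      then obtain g where g: "g \<in> free_mod_deg ?F (Suc (Suc i)) j" "\<forall>a. f' a - diff ?F (Suc i) g a \<in> J"
        unfolding tor_boundaries_def by (elim CollectE conjE bexE) simp
      define u where "u = f' - diff ?F (Suc i) g"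
      have gf: "g \<in> free_mod ?F (Suc (Suc i))" and f'f: "f' \<in> free_mod ?F (Suc i)"
        using g(1) f'd by (simp_all add: free_mod_deg_def)
      have "u \<in> ideal_mod J ?F (Suc i)"
        using g(2) vec_mod.subspace_diff[OF free_mod_subspace f'f diff_in_free_mod]
        by (simp add: ideal_mod_def u_def)
      moreover have "b = diff ?F i u"
        by (simp only: u_def diff_minus diff_diff[OF chosen_resolution gf] diff_zero f'b)
      ultimately have "b \<in> diff ?F i ` ideal_mod J ?F (Suc i)" by (intro image_eqI)
      with nb show False by contradiction
    qed
    ultimately show "\<exists>f\<in>tor_cycles ?F J (Suc i) j. f \<notin> tor_boundaries ?F J (Suc i) j" by (intro bexI[of _ f'])
  qed
qed

lemma betti_past_length:
  fixes J :: "('n::finite, 'k::field) mpoly set"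
  assumes J: "graded J" and i: "i > card (UNIV :: 'n set)"
  shows "betti i j J = 0"
proof (rule ccontr)
  assume nz: "betti i j J \<noteq> 0"
  obtain i' where i': "i = Suc i'" using i by (cases i) auto
  from resolution_exists obtain G :: "('n, 'k) free_complex"
    where G: "graded_free_resolution irrelevant_ideal G" "\<forall>i>card (UNIV :: 'n set). rk G i = 0" by (elim exE conjE)
  have rk: "rk G (Suc i') = 0" using G(2) i i' by simp
  have Js: "ideal.subspace J" using J by (simp add: graded_def)
  from nz[unfolded i' betti_Suc_iff[OF J]] obtain b where
    b: "b \<in> diff chosen_resolution i' ` free_mod chosen_resolution (Suc i')" "\<forall>a. b a \<in> J"
    and nb: "b \<notin> diff chosen_resolution i' ` ideal_mod J chosen_resolution (Suc i')" by (elim bexE conjE)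
  from boundary_past_length[OF chosen_resolution G(1) irrelevant_subspace Js rk b(1) spec[OF b(2)]] nb
  show False by contradiction
qed

text \<open>In homological degree \<open>0\<close>, Tor is the residue field itself, because \<open>J\<close> lies in the irrelevant
  ideal.\<close>

lemma betti_0_iff:
  fixes J :: "('n::finite, 'k::field) mpoly set"
  assumes J: "graded J" "J \<noteq> UNIV"
  shows "betti 0 j J \<noteq> 0 \<longleftrightarrow> j = 0"
proof -
  let ?F = "chosen_resolution :: ('n, 'k) free_complex"
  let ?m = "irrelevant_ideal :: ('n, 'k) mpoly set"
  have Js: "ideal.subspace J" using J by (simp add: graded_def)
  have Jm: "J \<subseteq> ?m" by (rule graded_proper_le_irrelevant[OF J])
  have m: "ideal.subspace ?m" by (rule irrelevant_subspace)
  have aug_homog: "homogeneous d (aug_map ?F f)" if "f \<in> free_mod_deg ?F 0 d" for f d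
  proof -
    have "homogeneous d (aug ?F a * f a)" if "a < rk ?F 0" for a
      using homogeneous_mult[OF homogeneous_aug[OF chosen_resolution that], of "d - shift ?F 0 a" "f a"]
        \<open>f \<in> free_mod_deg ?F 0 d\<close> that by (simp add: free_mod_deg_def)
    then show ?thesis
      unfolding aug_map_def homogeneous_iff_hcomp hcomp_sum by (intro sum.cong) simp_all
  qed
  show ?thesis unfolding betti_nonzero_iff[OF Js]
  proof
    assume "\<exists>f\<in>tor_cycles ?F J 0 j. f \<notin> tor_boundaries ?F J 0 j"
    then obtain f where f: "f \<in> free_mod_deg ?F 0 j" "f \<notin> tor_boundaries ?F J 0 j"
      by (auto simp: tor_cycles_def)
    show "j = 0"
    proof (rule ccontr)
      assume "j \<noteq> 0"
      then have "aug_map ?F f \<in> ?m"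
        using aug_homog[OF f(1)] homogeneous_mem_irrelevant by blast
      moreover have "f \<in> free_mod ?F 0" using f(1) by (simp add: free_mod_deg_def)
      ultimately have "f \<in> diff ?F 0 ` free_mod ?F (Suc 0)"
        using aug_exact[OF chosen_resolution] by (metis (no_types))
      then obtain g where g: "f = diff ?F 0 g" "g \<in> free_mod ?F (Suc 0)" by (elim imageE)
      have "f = diff ?F 0 (vcomp ?F (Suc 0) j g)"
        by (simp only: diff_vcomp[OF chosen_resolution] g(1)[symmetric] vcomp_ident[OF f(1)])
      then have "\<forall>a. f a - diff ?F 0 (vcomp ?F (Suc 0) j g) a \<in> J"
        using ideal.subspace_0[OF Js] by simp
      with f(1) vcomp_in_free_mod_deg[OF g(2)] have "f \<in> tor_boundaries ?F J 0 j"
        unfolding tor_boundaries_def by (intro CollectI conjI bexI)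
      with f(2) show False by contradiction
    qed
  next
    assume j: "j = 0"
    obtain f where f: "f \<in> free_mod ?F 0" "1 - aug_map ?F f \<in> ?m"
      using aug_surj[OF chosen_resolution, of 1] by (elim bexE)
    define f' where "f' = vcomp ?F 0 0 f"
    have f'd: "f' \<in> free_mod_deg ?F 0 0" unfolding f'_def by (rule vcomp_in_free_mod_deg[OF f(1)])
    have "aug_map ?F f' = hcomp 0 (aug_map ?F f)"
      unfolding aug_map_def f'_def vcomp_def hcomp_sum
      by (rule sum.cong) (auto simp: hcomp_mult[OF homogeneous_aug[OF chosen_resolution]])
    then have nm: "aug_map ?F f' \<notin> ?m"
      using f(2) by (simp add: mem_irrelevant_iff lookup_hcomp lookup_minus)
    have "f' \<notin> tor_boundaries ?F J 0 0"
    proof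
      assume "f' \<in> tor_boundaries ?F J 0 0"
      then obtain g where g: "g \<in> free_mod_deg ?F (Suc 0) 0" "\<forall>a. f' a - diff ?F 0 g a \<in> J"
        unfolding tor_boundaries_def by (elim CollectE conjE bexE) simp
      have "g \<in> free_mod ?F (Suc 0)" using g(1) by (simp add: free_mod_deg_def)
      from aug_diff[OF chosen_resolution this] have "aug_map ?F (diff ?F 0 g) \<in> ?m" .
      moreover have "aug_map ?F (f' - diff ?F 0 g) \<in> ?m"
        unfolding aug_map_def
      proof (intro ideal.subspace_sum[OF m] ideal.subspace_scale[OF m])
        fix a show "(f' - diff ?F 0 g) a \<in> ?m" using g(2) Jm by auto
      qed
      ultimately have "aug_map ?F (diff ?F 0 g) + aug_map ?F (f' - diff ?F 0 g) \<in> ?m"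
        by (rule ideal.subspace_add[OF m])
      with nm show False by (simp add: aug_map_diff)
    qed
    with f'd j show "\<exists>f\<in>tor_cycles ?F J 0 j. f \<notin> tor_boundaries ?F J 0 j"
      by (intro bexI[of _ f']) (simp_all add: tor_cycles_def)
  qed
qed

lemma free_mod_deg_below:
  "\<exists>j0. \<forall>j<j0. free_mod_deg F i j \<subseteq> {0}"
proof (intro exI allI impI subsetI)
  fix j f assume j: "j < - (\<Sum>a<rk F i. \<bar>shift F i a\<bar>)" and f: "f \<in> free_mod_deg F i j"
  have "f a = 0" for a
  proof (cases "a < rk F i")
    case True
    have "\<bar>shift F i a\<bar> \<le> (\<Sum>a<rk F i. \<bar>shift F i a\<bar>)"
      using True by (intro member_le_sum) auto
    with j have neg: "j - shift F i a < 0" by linarith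
    have "homogeneous (j - shift F i a) (f a)" using f True by (simp add: free_mod_deg_def)
    with neg have "keys (f a) = {}" by (auto simp: homogeneous_def)
    then show ?thesis by simp
  next
    case False
    with f show ?thesis by (simp add: free_mod_deg_def free_mod_def)
  qed
  then show "f \<in> {0}" by (simp add: fun_eq_iff)
qed

section \<open>Exponent vectors and eventually linear functions\<close>

text \<open>Dickson's lemma. Stated for functions compared on \<open>V\<close> only, it admits an induction on \<open>V\<close>
  without projections: vectors of \<open>S\<close> that exceed \<open>K\<close> at the new index \<open>v\<close> are dominated by those
  found for the smaller set, and for each of the finitely many values below \<open>K\<close> the vectors with that
  value at \<open>v\<close> are treated separately.\<close>

lemma dickson:
  fixes S :: "('a \<Rightarrow> nat) set"
  assumes "finite V"
  shows "\<exists>T\<subseteq>S. finite T \<and> (\<forall>s\<in>S. \<exists>t\<in>T. \<forall>v\<in>V. t v \<le> s v)"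
  using assms
proof (induction V arbitrary: S rule: finite_induct)
  case empty
  show ?case
  proof (cases "S = {}")
    case False
    then obtain s where "s \<in> S" by blast
    then show ?thesis by (intro exI[of _ "{s}"]) auto
  qed auto
next
  case (insert v V)
  obtain T0 where T0: "T0 \<subseteq> S" "finite T0" "\<forall>s\<in>S. \<exists>t\<in>T0. \<forall>v\<in>V. t v \<le> s v"
    using insert.IH[of S] by (elim exE conjE)
  define K where "K = (\<Sum>t\<in>T0. t v)"
  have "\<forall>k. \<exists>T. T \<subseteq> {s \<in> S. s v = k} \<and> finite T \<and> (\<forall>s\<in>{s \<in> S. s v = k}. \<exists>t\<in>T. \<forall>v\<in>V. t v \<le> s v)"
    using insert.IH by (intro allI)
  from choice[OF this] obtain T where T: "\<forall>k. T k \<subseteq> {s \<in> S. s v = k} \<and> finite (T k) \<and>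
      (\<forall>s\<in>{s \<in> S. s v = k}. \<exists>t\<in>T k. \<forall>v\<in>V. t v \<le> s v)" by (elim exE)
  show ?case
  proof (intro exI[of _ "T0 \<union> (\<Union>k<K. T k)"] conjI ballI)
    show "T0 \<union> (\<Union>k<K. T k) \<subseteq> S" using T0 T by blast
    show "finite (T0 \<union> (\<Union>k<K. T k))" using T0 T by simp
    fix s assume s: "s \<in> S"
    show "\<exists>t\<in>T0 \<union> (\<Union>k<K. T k). \<forall>w\<in>insert v V. t w \<le> s w"
    proof (cases "s v < K")
      case True
      obtain t where "t \<in> T (s v)" "\<forall>w\<in>V. t w \<le> s w" using T s by blast
      moreover from this have "t v = s v" using T by blast
      ultimately show ?thesis using True by (intro bexI[of _ t]) auto
    next
      case False
      obtain t where t: "t \<in> T0" "\<forall>w\<in>V. t w \<le> s w" using T0 s by blast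
      have "t v \<le> K" unfolding K_def using t(1) T0(2) by (intro member_le_sum) auto
      with False t show ?thesis by (intro bexI[of _ t]) auto
    qed
  qed
qed

definition weight :: "nat set \<Rightarrow> (nat \<Rightarrow> 'a::comm_semiring_1) \<Rightarrow> (nat \<Rightarrow>\<^sub>0 nat) \<Rightarrow> 'a" where
  "weight V w \<gamma> = (\<Sum>v\<in>V. of_nat (lookup \<gamma> v) * w v)"

lemma weight_add: "weight V w (\<gamma> + \<beta>) = weight V w \<gamma> + weight V w \<beta>"
  by (simp add: weight_def lookup_add distrib_right sum.distrib)

lemma weight_single: "finite V \<Longrightarrow> v \<in> V \<Longrightarrow> weight V w (single v k) = of_nat k * w v"
  by (simp add: weight_def lookup_single when_def if_distrib[of of_nat] if_distrib[of "\<lambda>x. x * _"] cong: if_cong)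

lemma keys_add_nat: "keys (\<gamma> + \<beta>) = keys \<gamma> \<union> keys \<beta>"
  for \<gamma> \<beta> :: "'a \<Rightarrow>\<^sub>0 nat"
  by (auto simp: in_keys_iff lookup_add)

lemma poly_mapping_le_add:
  fixes \<tau> \<gamma> :: "'a \<Rightarrow>\<^sub>0 nat"
  assumes "\<And>v. lookup \<tau> v \<le> lookup \<gamma> v"
  shows "\<gamma> = \<tau> + (\<gamma> - \<tau>)"
  using assms by (intro poly_mapping_eqI) (simp add: lookup_add lookup_minus)

definition eventually_linear_top :: "(nat \<Rightarrow> int \<Rightarrow> bool) \<Rightarrow> bool" where
  "eventually_linear_top Q \<longleftrightarrow> (\<exists>s0. \<forall>s\<ge>s0. \<forall>j. \<not> Q s j) \<or>
    (\<exists>a b s0. \<forall>s\<ge>s0. Q s (a * int s + b) \<and> (\<forall>j. Q s j \<longrightarrow> j \<le> a * int s + b))"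

lemma eventually_linear_topI:
  "(\<And>s. s \<ge> s0 \<Longrightarrow> Q s (a * int s + b)) \<Longrightarrow> (\<And>s j. s \<ge> s0 \<Longrightarrow> Q s j \<Longrightarrow> j \<le> a * int s + b) \<Longrightarrow>
    eventually_linear_top Q"
  unfolding eventually_linear_top_def by blast

lemma eventually_linear_top_empty: "(\<And>s j. s \<ge> s0 \<Longrightarrow> \<not> Q s j) \<Longrightarrow> eventually_linear_top Q"
  unfolding eventually_linear_top_def by blast

lemma eventually_linear_top_cases:
  assumes "eventually_linear_top Q"
  obtains (empty) s0 where "\<And>s j. s \<ge> s0 \<Longrightarrow> \<not> Q s j"
  | (linear) a b s0 where "\<And>s. s \<ge> s0 \<Longrightarrow> Q s (a * int s + b)" "\<And>s j. s \<ge> s0 \<Longrightarrow> Q s j \<Longrightarrow> j \<le> a * int s + b"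
  using assms unfolding eventually_linear_top_def by blast

lemma eventually_linear_top_cong:
  assumes "eventually_linear_top Q" and "\<And>s j. s \<ge> s1 \<Longrightarrow> Q s j \<longleftrightarrow> Q' s j"
  shows "eventually_linear_top Q'"
  using assms(1)
proof (cases rule: eventually_linear_top_cases)
  case (empty s0)
  then show ?thesis using assms(2) by (intro eventually_linear_top_empty[of "max s0 s1"]) auto
next
  case (linear a b s0)
  show ?thesis
  proof (rule eventually_linear_topI[of "max s0 s1" Q' a b])
    show "Q' s (a * int s + b)" if "s \<ge> max s0 s1" for s
      using linear(1)[of s] assms(2)[of s] that by simp
    show "j \<le> a * int s + b" if "s \<ge> max s0 s1" "Q' s j" for s j
      using linear(2)[of s j] assms(2)[of s j] that by simp
  qed
qed

lemma affine_compare: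
  fixes a1 a2 b1 b2 :: int
  assumes "a1 < a2 \<or> a1 = a2 \<and> b1 \<le> b2" "s \<ge> nat \<bar>b1 - b2\<bar>"
  shows "a1 * int s + b1 \<le> a2 * int s + b2"
proof (cases "a1 = a2")
  case True
  then show ?thesis using assms(1) by simp
next
  case False
  then have "1 * int s \<le> (a2 - a1) * int s"
    using assms(1) by (intro mult_right_mono) auto
  then show ?thesis using assms(2) by (simp add: left_diff_distrib)
qed

lemma eventually_linear_top_disj:
  assumes "eventually_linear_top P" "eventually_linear_top Q"
  shows "eventually_linear_top (\<lambda>s j. P s j \<or> Q s j)"
  using assms(1)
proof (cases rule: eventually_linear_top_cases)
  case (empty s0)
  then show ?thesis by (intro eventually_linear_top_cong[OF assms(2), of s0]) auto
next
  case P: (linear a1 b1 s1)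
  show ?thesis
    using assms(2)
  proof (cases rule: eventually_linear_top_cases)
    case (empty s0)
    then show ?thesis by (intro eventually_linear_top_cong[OF assms(1), of s0]) auto
  next
    case Q: (linear a2 b2 s2)
    let ?s = "max (max s1 s2) (nat \<bar>b1 - b2\<bar>)"
    show ?thesis
    proof (cases "a1 < a2 \<or> a1 = a2 \<and> b1 \<le> b2")
      case True
      show ?thesis
      proof (rule eventually_linear_topI[of ?s])
        show "P s (a2 * int s + b2) \<or> Q s (a2 * int s + b2)" if "s \<ge> ?s" for s
          using Q(1) that by simp
        show "j \<le> a2 * int s + b2" if "s \<ge> ?s" "P s j \<or> Q s j" for s j
          using Q(2)[of s j] P(2)[of s j] that affine_compare[OF True, of s] by fastforce
      qed
    next
      case False
      then have *: "a2 < a1 \<or> a2 = a1 \<and> b2 \<le> b1" by auto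
      show ?thesis
      proof (rule eventually_linear_topI[of ?s])
        show "P s (a1 * int s + b1) \<or> Q s (a1 * int s + b1)" if "s \<ge> ?s" for s
          using P(1) that by simp
        show "j \<le> a1 * int s + b1" if "s \<ge> ?s" "P s j \<or> Q s j" for s j
          using Q(2)[of s j] P(2)[of s j] that affine_compare[OF *, of s] by (fastforce simp: abs_minus_commute)
      qed
    qed
  qed
qed

lemma eventually_linear_top_Bex:
  assumes "finite A" "\<And>c. c \<in> A \<Longrightarrow> eventually_linear_top (Q c)"
  shows "eventually_linear_top (\<lambda>s j. \<exists>c\<in>A. Q c s j)"
  using assms
proof (induction A rule: finite_induct)
  case empty
  show ?case by (rule eventually_linear_top_empty[of 0]) simp
next
  case (insert c A)
  then show ?case
    using eventually_linear_top_disj[of "Q c" "\<lambda>s j. \<exists>c\<in>A. Q c s j"] by simp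
qed

lemma eventually_linear_top_shift:
  assumes "eventually_linear_top Q"
  shows "eventually_linear_top (\<lambda>s j. s \<ge> s1 \<and> Q (s - s1) (j - j1))"
  using assms
proof (cases rule: eventually_linear_top_cases)
  case (empty s0)
  then show ?thesis by (intro eventually_linear_top_empty[of "s0 + s1"]) auto
next
  case (linear a b s0)
  show ?thesis
  proof (rule eventually_linear_topI[of "s0 + s1" _ a "b + j1 - a * int s1"])
    fix s assume s: "s \<ge> s0 + s1"
    then have eq: "a * int s + (b + j1 - a * int s1) = a * int (s - s1) + b + j1"
      by (simp add: of_nat_diff right_diff_distrib)
    show "s \<ge> s1 \<and> Q (s - s1) (a * int s + (b + j1 - a * int s1) - j1)"
      using s linear(1)[of "s - s1"] unfolding eq by simp
    show "j \<le> a * int s + (b + j1 - a * int s1)" if "s \<ge> s1 \<and> Q (s - s1) (j - j1)" for j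
    proof -
      have "j - j1 \<le> a * int (s - s1) + b" using s that by (intro linear(2)) auto
      then show ?thesis unfolding eq by linarith
    qed
  qed
qed

text \<open>The combinatorial heart of the theorem. Let \<open>v\<close> be an index of maximal weight. If \<open>D\<close> contains
  all multiples of the unit vector at \<open>v\<close>, then these attain the largest weight \<open>d v * s\<close> that is
  possible in size \<open>s\<close>. Otherwise \<open>D\<close> is bounded in direction \<open>v\<close> and is therefore a finite union of
  translates of downward closed sets in one dimension less. Choosing \<open>v\<close> of maximal weight is
  essential; it is provided by the induction rule, which adds the indices in order of increasing
  weight.\<close>

lemma eventually_linear_top_monomials:
  fixes D :: "(nat \<Rightarrow>\<^sub>0 nat) set" and d :: "nat \<Rightarrow> int"
  assumes "finite V" "\<forall>\<gamma>\<in>D. keys \<gamma> \<subseteq> V" "\<forall>\<gamma> \<beta>. \<gamma> + \<beta> \<in> D \<longrightarrow> \<gamma> \<in> D"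
  shows "eventually_linear_top (\<lambda>s j. \<exists>\<gamma>\<in>D. weight V (\<lambda>_. 1) \<gamma> = s \<and> weight V d \<gamma> = j)"
  using assms
proof (induction V arbitrary: D rule: finite_ranking_induct[where f = d])
  case empty
  show ?case by (rule eventually_linear_top_empty[of 1]) (simp add: weight_def)
next
  case (insert v V)
  show ?case
  proof (cases "v \<in> V")
    case True
    then show ?thesis using insert.IH insert.prems by (simp add: insert_absorb)
  next
    case v: False
    show ?thesis
    proof (cases "\<forall>k. single v k \<in> D")
      case True
      show ?thesis
      proof (rule eventually_linear_topI[of 0 _ "d v" 0])
        fix s :: nat
        show "\<exists>\<gamma>\<in>D. weight (insert v V) (\<lambda>_. 1) \<gamma> = s \<and> weight (insert v V) d \<gamma> = d v * int s + 0"
          using True insert.hyps(1) by (intro bexI[of _ "single v s"]) (auto simp: weight_single)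
        fix j assume "\<exists>\<gamma>\<in>D. weight (insert v V) (\<lambda>_. 1) \<gamma> = s \<and> weight (insert v V) d \<gamma> = j"
        then obtain \<gamma> where \<gamma>: "weight (insert v V) (\<lambda>_. 1) \<gamma> = s" "weight (insert v V) d \<gamma> = j" by blast
        have "j \<le> (\<Sum>u\<in>insert v V. int (lookup \<gamma> u) * d v)"
          unfolding \<gamma>(2)[symmetric] weight_def using insert.hyps by (intro sum_mono mult_left_mono) auto
        also have "\<dots> = d v * int s"
          by (simp add: \<gamma>(1)[symmetric] weight_def sum_distrib_left mult.commute)
        finally show "j \<le> d v * int s + 0" by simp
      qed
    next
      case False
      then obtain k0 where k0: "single v k0 \<notin> D" by blast
      have bound: "lookup \<gamma> v < k0" if "\<gamma> \<in> D" for \<gamma>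
      proof (rule ccontr)
        assume "\<not> lookup \<gamma> v < k0"
        then have "\<gamma> = single v k0 + (\<gamma> - single v k0)"
          by (intro poly_mapping_le_add) (auto simp: lookup_single when_def)
        then show False using insert.prems(2) that k0 by metis
      qed
      define D' where "D' k = {\<gamma>. keys \<gamma> \<subseteq> V \<and> \<gamma> + single v k \<in> D}" for k
      define Q where "Q k s j \<longleftrightarrow> (\<exists>\<gamma>\<in>D' k. weight V (\<lambda>_. 1) \<gamma> = s \<and> weight V d \<gamma> = j)" for k and s :: nat and j
      have w: "weight (insert v V) w (\<gamma> + single v k) = weight V w \<gamma> + of_nat k * w v"
        if "keys \<gamma> \<subseteq> V" for w :: "nat \<Rightarrow> 'b::comm_semiring_1" and \<gamma> k
      proof -
        have "lookup \<gamma> v = 0" using that v by (metis in_keys_iff subsetD)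
        then have "weight (insert v V) w \<gamma> = weight V w \<gamma>"
          using insert.hyps(1) v by (simp add: weight_def)
        then show ?thesis using insert.hyps(1) by (simp add: weight_add weight_single)
      qed
      have "eventually_linear_top (Q k)" for k
        unfolding Q_def
      proof (rule insert.IH)
        show "\<forall>\<gamma>\<in>D' k. keys \<gamma> \<subseteq> V" by (simp add: D'_def)
        show "\<forall>\<gamma> \<beta>. \<gamma> + \<beta> \<in> D' k \<longrightarrow> \<gamma> \<in> D' k"
        proof (intro allI impI)
          fix \<gamma> \<beta> assume "\<gamma> + \<beta> \<in> D' k"
          then have "keys \<gamma> \<subseteq> V" "(\<gamma> + single v k) + \<beta> \<in> D"
            by (simp_all add: D'_def keys_add_nat ac_simps)
          then show "\<gamma> \<in> D' k" using insert.prems(2) unfolding D'_def by blast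
        qed
      qed
      from eventually_linear_top_shift[OF this]
      have "eventually_linear_top (\<lambda>s j. \<exists>k\<in>{..<k0}. s \<ge> k \<and> Q k (s - k) (j - int k * d v))"
        by (intro eventually_linear_top_Bex finite_lessThan)
      then show ?thesis
      proof (rule eventually_linear_top_cong[of _ 0])
        fix s :: nat and j
        show "(\<exists>k\<in>{..<k0}. s \<ge> k \<and> Q k (s - k) (j - int k * d v)) \<longleftrightarrow>
          (\<exists>\<gamma>\<in>D. weight (insert v V) (\<lambda>_. 1) \<gamma> = s \<and> weight (insert v V) d \<gamma> = j)"
        proof
          assume "\<exists>k\<in>{..<k0}. s \<ge> k \<and> Q k (s - k) (j - int k * d v)"
          then obtain k \<gamma> where "s \<ge> k" "\<gamma> \<in> D' k" "weight V (\<lambda>_. 1) \<gamma> = s - k" "weight V d \<gamma> = j - int k * d v"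
            unfolding Q_def by blast
          then show "\<exists>\<gamma>\<in>D. weight (insert v V) (\<lambda>_. 1) \<gamma> = s \<and> weight (insert v V) d \<gamma> = j"
            by (intro bexI[of _ "\<gamma> + single v k"]) (auto simp: D'_def w)
        next
          assume "\<exists>\<gamma>\<in>D. weight (insert v V) (\<lambda>_. 1) \<gamma> = s \<and> weight (insert v V) d \<gamma> = j"
          then obtain \<gamma> where \<gamma>: "\<gamma> \<in> D" "weight (insert v V) (\<lambda>_. 1) \<gamma> = s" "weight (insert v V) d \<gamma> = j" by blast
          define k where "k = lookup \<gamma> v"
          define \<beta> where "\<beta> = \<gamma> - single v k"
          have eq: "\<gamma> = \<beta> + single v k"
            unfolding \<beta>_def k_def by (rule poly_mapping_eqI) (simp add: lookup_add lookup_minus lookup_single when_def)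
          have "keys \<beta> \<subseteq> V"
          proof
            fix u assume u: "u \<in> keys \<beta>"
            have "u \<noteq> v" using u by (auto simp: \<beta>_def k_def in_keys_iff lookup_minus)
            moreover have "u \<in> keys \<gamma>" using u by (simp add: eq keys_add_nat)
            ultimately show "u \<in> V" using insert.prems(1) \<gamma>(1) by blast
          qed
          then have \<beta>: "keys \<beta> \<subseteq> V" "\<beta> \<in> D' k"
            using \<gamma>(1) by (simp_all add: D'_def eq)
          have "s = weight V (\<lambda>_. 1) \<beta> + k" "j = weight V d \<beta> + int k * d v"
            using \<gamma>(2,3) w[OF \<beta>(1), of "\<lambda>_. 1 :: nat"] w[OF \<beta>(1), of d] by (simp_all add: eq)
          moreover have "k < k0" using bound[OF \<gamma>(1)] by (simp add: k_def)
          ultimately show "\<exists>k\<in>{..<k0}. s \<ge> k \<and> Q k (s - k) (j - int k * d v)"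
            using \<beta>(2) by (intro bexI[of _ k]) (auto simp: Q_def)
        qed
      qed
    qed
  qed
qed

section \<open>Noetherianity and standard monomials\<close>

definition pprod :: "nat set \<Rightarrow> (nat \<Rightarrow> ('n::finite, 'k::field) mpoly) \<Rightarrow> (nat \<Rightarrow>\<^sub>0 nat) \<Rightarrow> ('n, 'k) mpoly" where
  "pprod V h \<gamma> = (\<Prod>v\<in>V. h v ^ lookup \<gamma> v)"

lemma pprod_add: "pprod V h (\<gamma> + \<beta>) = pprod V h \<gamma> * pprod V h \<beta>"
  by (simp add: pprod_def lookup_add power_add prod.distrib)

lemma pprod_0 [simp]: "pprod V h 0 = 1"
  by (simp add: pprod_def)

text \<open>Finitely many vectors \<open>e c\<close>, to which the bidegrees \<open>(ed c, es c)\<close> are assigned, are multiplied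
  by power products of polynomials \<open>h v\<close>, to which the bidegrees \<open>(\<delta> v, \<sigma> v)\<close> are assigned. The vectors that arise are indexed by pairs
  \<open>\<kappa> = (c, \<gamma>)\<close>, ordered lexicographically. They may well be linearly dependent; everything below
  works with the filtration of a graded piece by the spans of initial segments of the index set,
  which replaces the leading monomials of the theory of Groebner bases. Each graded piece involves
  finitely many indices only, so inductions along the order terminate.\<close>

locale weighted_terms =
  fixes V :: "nat set" and h :: "nat \<Rightarrow> ('n::finite, 'k::field) mpoly"
    and \<delta> :: "nat \<Rightarrow> int" and \<sigma> :: "nat \<Rightarrow> nat"
    and r :: nat and e :: "nat \<Rightarrow> nat \<Rightarrow> ('n, 'k) mpoly" and ed :: "nat \<Rightarrow> int" and es :: "nat \<Rightarrow> nat"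
  assumes finite_V: "finite V"
    and finite_weights: "\<And>j s. finite {\<gamma>. keys \<gamma> \<subseteq> V \<and> weight V \<delta> \<gamma> = j \<and> weight V \<sigma> \<gamma> = s}"
begin

definition jdeg :: "nat \<times> (nat \<Rightarrow>\<^sub>0 nat) \<Rightarrow> int" where
  "jdeg \<kappa> = weight V \<delta> (snd \<kappa>) + ed (fst \<kappa>)"

definition sdeg :: "nat \<times> (nat \<Rightarrow>\<^sub>0 nat) \<Rightarrow> nat" where
  "sdeg \<kappa> = weight V \<sigma> (snd \<kappa>) + es (fst \<kappa>)"

definition idx :: "int \<Rightarrow> nat \<Rightarrow> (nat \<times> (nat \<Rightarrow>\<^sub>0 nat)) set" where
  "idx j s = {\<kappa>. fst \<kappa> < r \<and> keys (snd \<kappa>) \<subseteq> V \<and> jdeg \<kappa> = j \<and> sdeg \<kappa> = s}"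

definition trm :: "nat \<times> (nat \<Rightarrow>\<^sub>0 nat) \<Rightarrow> nat \<Rightarrow> ('n, 'k) mpoly" where
  "trm \<kappa> = smul (pprod V h (snd \<kappa>)) (e (fst \<kappa>))"

definition translate :: "(nat \<Rightarrow>\<^sub>0 nat) \<Rightarrow> nat \<times> (nat \<Rightarrow>\<^sub>0 nat) \<Rightarrow> nat \<times> (nat \<Rightarrow>\<^sub>0 nat)" where
  "translate \<beta> \<kappa> = (fst \<kappa>, snd \<kappa> + \<beta>)"

definition below :: "nat \<times> (nat \<Rightarrow>\<^sub>0 nat) \<Rightarrow> (nat \<times> (nat \<Rightarrow>\<^sub>0 nat)) set" where
  "below \<kappa> = {\<kappa>' \<in> idx (jdeg \<kappa>) (sdeg \<kappa>). \<kappa>' < \<kappa>}"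

lemma finite_idx: "finite (idx j s)"
proof -
  have "idx j s \<subseteq> (\<Union>c<r. Pair c ` {\<gamma>. keys \<gamma> \<subseteq> V \<and> weight V \<delta> \<gamma> = j - ed c \<and> weight V \<sigma> \<gamma> = s - es c})"
    by (auto simp: idx_def jdeg_def sdeg_def)
  then show ?thesis
    by (rule finite_subset) (intro finite_UN_I finite_imageI finite_weights; simp)
qed

lemma jdeg_translate: "jdeg (translate \<beta> \<kappa>) = weight V \<delta> \<beta> + jdeg \<kappa>"
  by (simp add: jdeg_def translate_def weight_add)

lemma sdeg_translate: "sdeg (translate \<beta> \<kappa>) = weight V \<sigma> \<beta> + sdeg \<kappa>"
  by (simp add: sdeg_def translate_def weight_add)

lemma translate_idx:
  "keys \<beta> \<subseteq> V \<Longrightarrow> \<kappa> \<in> idx j s \<Longrightarrow> translate \<beta> \<kappa> \<in> idx (weight V \<delta> \<beta> + j) (weight V \<sigma> \<beta> + s)"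
  by (simp add: idx_def jdeg_translate sdeg_translate) (simp add: translate_def keys_add_nat)

lemma translate_less: "\<kappa> < \<kappa>' \<Longrightarrow> translate \<beta> \<kappa> < translate \<beta> \<kappa>'"
  by (auto simp: translate_def less_prod_def' intro: add_strict_right_mono)

lemma translate_below:
  "keys \<beta> \<subseteq> V \<Longrightarrow> \<kappa>' \<in> below \<kappa> \<Longrightarrow> translate \<beta> \<kappa>' \<in> below (translate \<beta> \<kappa>)"
  by (simp add: below_def translate_idx translate_less jdeg_translate sdeg_translate)

lemma trm_translate: "trm (translate \<beta> \<kappa>) = smul (pprod V h \<beta>) (trm \<kappa>)"
  by (simp add: trm_def translate_def pprod_add smul_smul mult.commute)

lemma span_translate:
  assumes "keys \<beta> \<subseteq> V" "f \<in> poly_vec.span (trm ` below \<kappa>)"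
  shows "smul (pprod V h \<beta>) f \<in> poly_vec.span (trm ` below (translate \<beta> \<kappa>))"
  using assms(2)
proof (rule smul_span)
  fix g assume "g \<in> trm ` below \<kappa>"
  then obtain \<kappa>' where "g = trm \<kappa>'" "\<kappa>' \<in> below \<kappa>" by (elim imageE)
  then have "smul (pprod V h \<beta>) g = trm (translate \<beta> \<kappa>')" "translate \<beta> \<kappa>' \<in> below (translate \<beta> \<kappa>)"
    using translate_below[OF assms(1)] by (simp_all only: trm_translate)
  then show "smul (pprod V h \<beta>) g \<in> poly_vec.span (trm ` below (translate \<beta> \<kappa>))"
    by (simp only: poly_vec.span_base imageI)
qed

definition generated :: "nat \<Rightarrow> (nat \<Rightarrow> nat \<Rightarrow> ('n, 'k) mpoly) \<Rightarrow> (nat \<Rightarrow> int) \<Rightarrow> (nat \<Rightarrow> nat) \<Rightarrow> int \<Rightarrow> nat \<Rightarrow>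
    (nat \<Rightarrow> ('n, 'k) mpoly) set" where
  "generated q g gd gs j s = poly_vec.span {smul (pprod V h \<gamma>) (g c) | c \<gamma>.
    c < q \<and> keys \<gamma> \<subseteq> V \<and> weight V \<delta> \<gamma> + gd c = j \<and> weight V \<sigma> \<gamma> + gs c = s}"

text \<open>Hilbert's basis theorem for graded submodules. Call \<open>\<kappa>\<close> a leading index (the set \<open>L\<close>) if \<open>M\<close>
  contains an element that is congruent to \<open>trm \<kappa>\<close> modulo smaller terms. By
  Dickson's lemma every leading index is a translate of one in a finite set \<open>B\<close> of leading indices.
  The corresponding elements \<open>F \<kappa>\<close> of \<open>M\<close> generate: in an element of \<open>M\<close> the highest
  term can be cancelled by a multiple of some \<open>F \<tau>\<close>, and this terminates because the graded piece
  has finitely many indices.\<close>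

lemma graded_noetherian:
  fixes M :: "int \<Rightarrow> nat \<Rightarrow> (nat \<Rightarrow> ('n, 'k) mpoly) set"
  assumes sub: "\<And>j s. poly_vec.subspace (M j s)"
    and act: "\<And>\<gamma> j s f. keys \<gamma> \<subseteq> V \<Longrightarrow> f \<in> M j s \<Longrightarrow>
      smul (pprod V h \<gamma>) f \<in> M (weight V \<delta> \<gamma> + j) (weight V \<sigma> \<gamma> + s)"
    and spanned: "\<And>j s. M j s \<subseteq> poly_vec.span (trm ` idx j s)"
  shows "\<exists>q g gd gs. (\<forall>c<q. g c \<in> M (gd c) (gs c)) \<and> (\<forall>j s. M j s \<subseteq> generated q g gd gs j s)"
proof -
  define L where "L = {\<kappa>. \<kappa> \<in> idx (jdeg \<kappa>) (sdeg \<kappa>) \<and>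
    (\<exists>f. f \<in> M (jdeg \<kappa>) (sdeg \<kappa>) \<and> f - trm \<kappa> \<in> poly_vec.span (trm ` below \<kappa>))}"
  have "\<forall>\<kappa>\<in>L. \<exists>f. f \<in> M (jdeg \<kappa>) (sdeg \<kappa>) \<and> f - trm \<kappa> \<in> poly_vec.span (trm ` below \<kappa>)"
    by (simp add: L_def)
  from bchoice[OF this] obtain F where F: "\<And>\<kappa>. \<kappa> \<in> L \<Longrightarrow> F \<kappa> \<in> M (jdeg \<kappa>) (sdeg \<kappa>)"
    "\<And>\<kappa>. \<kappa> \<in> L \<Longrightarrow> F \<kappa> - trm \<kappa> \<in> poly_vec.span (trm ` below \<kappa>)" by auto
  have "\<forall>c. \<exists>T. T \<subseteq> {lookup \<gamma> |\<gamma>. (c, \<gamma>) \<in> L} \<and> finite T \<and>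
      (\<forall>s\<in>{lookup \<gamma> |\<gamma>. (c, \<gamma>) \<in> L}. \<exists>t\<in>T. \<forall>v\<in>V. t v \<le> s v)"
    using dickson[OF finite_V] by (intro allI)
  from choice[OF this] obtain T where T: "\<forall>c. T c \<subseteq> {lookup \<gamma> |\<gamma>. (c, \<gamma>) \<in> L} \<and> finite (T c) \<and>
      (\<forall>s\<in>{lookup \<gamma> |\<gamma>. (c, \<gamma>) \<in> L}. \<exists>t\<in>T c. \<forall>v\<in>V. t v \<le> s v)" by (elim exE)
  define B where "B = {(c, \<gamma>). c < r \<and> (c, \<gamma>) \<in> L \<and> lookup \<gamma> \<in> T c}"
  have "finite B"
  proof -
    have "(\<lambda>(c, \<gamma>). (c, lookup \<gamma>)) ` B \<subseteq> (SIGMA c:{..<r}. T c)"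
      by (auto simp: B_def)
    moreover have "finite (SIGMA c:{..<r}. T c)" using T by auto
    ultimately have "finite ((\<lambda>(c, \<gamma>). (c, lookup \<gamma>)) ` B)" by (rule finite_subset)
    then show ?thesis
      by (rule finite_imageD) (auto intro!: inj_onI poly_mapping_eqI)
  qed
  have BL: "\<kappa> \<in> L" if "\<kappa> \<in> B" for \<kappa> using that by (auto simp: B_def)
  have dom: "\<exists>\<tau>\<in>B. \<exists>\<beta>. keys \<beta> \<subseteq> V \<and> \<kappa> = translate \<beta> \<tau>" if \<kappa>: "\<kappa> \<in> L" for \<kappa>
  proof -
    obtain c \<gamma> where c: "\<kappa> = (c, \<gamma>)" by (cases \<kappa>)
    have cr: "c < r" "keys \<gamma> \<subseteq> V" using \<kappa> by (simp_all add: L_def idx_def c)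
    have "lookup \<gamma> \<in> {lookup \<gamma> |\<gamma>. (c, \<gamma>) \<in> L}" using \<kappa> c by blast
    then obtain t where t: "t \<in> T c" "\<forall>v\<in>V. t v \<le> lookup \<gamma> v" using T by blast
    then obtain \<tau> where \<tau>: "t = lookup \<tau>" "(c, \<tau>) \<in> L" using T by blast
    have "keys \<tau> \<subseteq> V" using \<tau>(2) by (simp add: L_def idx_def)
    then have "lookup \<tau> v \<le> lookup \<gamma> v" for v
      using t(2) \<tau>(1) by (cases "v \<in> V") (simp_all, metis in_keys_iff subsetD zero_le)
    then have eq: "\<gamma> = \<tau> + (\<gamma> - \<tau>)" by (rule poly_mapping_le_add)
    have "keys (\<gamma> - \<tau>) \<subseteq> V" using cr(2) eq keys_add_nat[of \<tau> "\<gamma> - \<tau>"] by auto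
    moreover have "(c, \<tau>) \<in> B" using cr \<tau> t by (simp add: B_def)
    moreover have "\<kappa> = translate (\<gamma> - \<tau>) (c, \<tau>)" using eq by (simp add: translate_def c)
    ultimately show ?thesis by blast
  qed
  obtain E where E: "bij_betw E {0..<card B} B"
    using ex_bij_betw_nat_finite[OF \<open>finite B\<close>] by blast
  define q where "q = card B"
  define g gd gs where "g c = F (E c)" and "gd c = jdeg (E c)" and "gs c = sdeg (E c)" for c
  have EB: "E c \<in> B" if "c < q" for c
    using bij_betw_apply[OF E] that by (simp add: q_def)
  have gen: "smul (pprod V h \<beta>) (F \<tau>) \<in> generated q g gd gs (weight V \<delta> \<beta> + jdeg \<tau>) (weight V \<sigma> \<beta> + sdeg \<tau>)"
    if \<tau>: "\<tau> \<in> B" and \<beta>: "keys \<beta> \<subseteq> V" for \<tau> \<beta>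
  proof -
    have "\<tau> \<in> E ` {0..<card B}"
      using \<tau> by (simp only: bij_betw_imp_surj_on[OF E])
    then obtain c where c: "c < q" "\<tau> = E c" by (auto simp: q_def)
    show ?thesis
      unfolding generated_def c(2)
      by (rule poly_vec.span_base, unfold mem_Collect_eq, intro exI[of _ c] exI[of _ \<beta>] conjI)
        (simp_all only: g_def gd_def gs_def c \<beta>)
  qed
  have main: "f \<in> generated q g gd gs j s"
    if "finite S" "S \<subseteq> idx j s" "\<forall>\<kappa>\<in>S. below \<kappa> \<subseteq> S" "f \<in> M j s" "f \<in> poly_vec.span (trm ` S)" for f j s S
    using that
  proof (induction S arbitrary: f rule: finite_linorder_max_induct)
    case empty
    then have "f = 0" by simp
    then show ?case by (simp only: generated_def poly_vec.span_zero)
  next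
    case (insert \<kappa> S)
    have \<kappa>: "\<kappa> \<in> idx j s" "jdeg \<kappa> = j" "sdeg \<kappa> = s" using insert.prems(1) by (auto simp: idx_def)
    have below_S: "below \<kappa> \<subseteq> S"
      using insert.prems(2) by (auto simp: below_def)
    have S_below: "S \<subseteq> below \<kappa>"
      using insert.prems(1) insert.hyps(2) \<kappa> by (auto simp: below_def)
    have S: "S = below \<kappa>" using S_below below_S by (rule equalityI)
    have down: "\<forall>\<kappa>'\<in>S. below \<kappa>' \<subseteq> S"
    proof (intro ballI subsetI)
      fix \<kappa>' \<kappa>'' assume "\<kappa>' \<in> S" "\<kappa>'' \<in> below \<kappa>'"
      then have "\<kappa>'' \<in> insert \<kappa> S" "\<kappa>'' < \<kappa>'" "\<kappa>' < \<kappa>"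
        using insert.prems(2) insert.hyps(2) by (auto simp: below_def)
      then show "\<kappa>'' \<in> S" by auto
    qed
    have Sidx: "S \<subseteq> idx j s" using insert.prems(1) by simp
    note IH = insert.IH[OF Sidx down]
    from insert.prems(4) obtain k where k: "f - vec_scale k (trm \<kappa>) \<in> poly_vec.span (trm ` S)"
      unfolding image_insert poly_vec.span_breakdown_eq by (elim exE)
    show ?case
    proof (cases "k = 0")
      case True
      with k have "f \<in> poly_vec.span (trm ` S)" by (simp add: poly_vec.scale_zero_left)
      then show ?thesis by (rule IH[OF insert.prems(3)])
    next
      case False
      have "vec_scale (inverse k) (f - vec_scale k (trm \<kappa>)) \<in> poly_vec.span (trm ` S)"
        using k by (rule poly_vec.span_scale)
      moreover have "vec_scale (inverse k) (f - vec_scale k (trm \<kappa>)) = vec_scale (inverse k) f - trm \<kappa>"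
        by (simp only: poly_vec.scale_right_diff_distrib poly_vec.scale_scale left_inverse[OF False] poly_vec.scale_one)
      moreover have "vec_scale (inverse k) f \<in> M j s"
        using sub insert.prems(3) by (rule poly_vec.subspace_scale)
      ultimately have "\<kappa> \<in> L"
        using \<kappa> unfolding L_def S by (intro CollectI conjI exI[of _ "vec_scale (inverse k) f"]) simp_all
      from dom[OF this] obtain \<tau> \<beta> where \<tau>: "\<tau> \<in> B" and \<beta>: "keys \<beta> \<subseteq> V" and eq: "\<kappa> = translate \<beta> \<tau>"
        by (elim bexE exE conjE)
      define m where "m = smul (pprod V h \<beta>) (F \<tau>)"
      have deg: "weight V \<delta> \<beta> + jdeg \<tau> = j" "weight V \<sigma> \<beta> + sdeg \<tau> = s"
        using \<kappa>(2,3) by (simp_all only: eq jdeg_translate sdeg_translate)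
      have mM: "m \<in> M j s" using act[OF \<beta> F(1)[OF BL[OF \<tau>]]] by (simp only: deg m_def)
      have mG: "m \<in> generated q g gd gs j s" using gen[OF \<tau> \<beta>] by (simp only: deg m_def)
      have "m - trm \<kappa> \<in> poly_vec.span (trm ` S)"
        using span_translate[OF \<beta> F(2)[OF BL[OF \<tau>]]]
        by (simp only: S eq m_def trm_translate vec_mod.scale_right_diff_distrib)
      then have "vec_scale k (m - trm \<kappa>) \<in> poly_vec.span (trm ` S)"
        by (rule poly_vec.span_scale)
      from poly_vec.span_diff[OF k this] have "f - vec_scale k m \<in> poly_vec.span (trm ` S)"
        by (simp add: poly_vec.scale_right_diff_distrib)
      moreover have "f - vec_scale k m \<in> M j s"
        by (intro poly_vec.subspace_diff[OF sub] insert.prems(3) poly_vec.subspace_scale[OF sub] mM)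
      ultimately have "f - vec_scale k m \<in> generated q g gd gs j s"
        by (intro IH)
      moreover have "vec_scale k m \<in> generated q g gd gs j s"
        using mG unfolding generated_def by (rule poly_vec.span_scale)
      ultimately have "(f - vec_scale k m) + vec_scale k m \<in> generated q g gd gs j s"
        unfolding generated_def by (rule poly_vec.span_add)
      then show ?thesis by simp
    qed
  qed
  show ?thesis
  proof (intro exI[of _ q] exI[of _ g] exI[of _ gd] exI[of _ gs] conjI allI impI subsetI)
    fix c assume "c < q"
    then show "g c \<in> M (gd c) (gs c)"
      unfolding g_def gd_def gs_def by (intro F(1) BL EB)
  next
    fix j s f assume f: "f \<in> M j s"
    have "\<forall>\<kappa>\<in>idx j s. below \<kappa> \<subseteq> idx j s" by (auto simp: below_def idx_def)
    with f spanned[of j s] show "f \<in> generated q g gd gs j s"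
      by (intro main[OF finite_idx[of j s]]) auto
  qed
qed

text \<open>Call \<open>\<kappa>\<close> standard if \<open>trm \<kappa>\<close> is not congruent modulo \<open>Z\<close> to a combination of smaller terms. A
  graded piece of \<open>M\<close> is contained in \<open>Z\<close> if and only if it has no standard index, since the least
  term outside \<open>Z\<close> is standard. If \<open>\<kappa>\<close> is not standard, then neither is any translate of it, so for
  each generator the standard exponents form a downward closed set, to which the combinatorial lemma
  applies.\<close>

lemma eventually_linear_top_quotient:
  fixes M Z :: "int \<Rightarrow> nat \<Rightarrow> (nat \<Rightarrow> ('n, 'k) mpoly) set"
  assumes Z: "\<And>j s. poly_vec.subspace (Z j s)"
    and act: "\<And>\<gamma> j s f. keys \<gamma> \<subseteq> V \<Longrightarrow> f \<in> Z j s \<Longrightarrow>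
      smul (pprod V h \<gamma>) f \<in> Z (weight V \<delta> \<gamma> + j) (weight V \<sigma> \<gamma> + s)"
    and terms: "\<And>j s. trm ` idx j s \<subseteq> M j s"
    and spanned: "\<And>j s. M j s \<subseteq> poly_vec.span (Z j s \<union> trm ` idx j s)"
    and \<sigma>: "\<And>v. v \<in> V \<Longrightarrow> \<sigma> v = 1"
  shows "eventually_linear_top (\<lambda>s j. \<exists>f\<in>M j s. f \<notin> Z j s)"
proof -
  define std where "std \<kappa> \<longleftrightarrow> trm \<kappa> \<notin> poly_vec.span (Z (jdeg \<kappa>) (sdeg \<kappa>) \<union> trm ` below \<kappa>)" for \<kappa>
  define D where "D c = {\<gamma>. keys \<gamma> \<subseteq> V \<and> std (c, \<gamma>)}" for c
  have down: "\<gamma> \<in> D c" if "\<gamma> + \<beta> \<in> D c" for \<gamma> \<beta> c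
  proof -
    have keys: "keys \<gamma> \<subseteq> V" "keys \<beta> \<subseteq> V" and "std (c, \<gamma> + \<beta>)"
      using that by (simp_all add: D_def keys_add_nat)
    then have s: "std (translate \<beta> (c, \<gamma>))" by (simp add: translate_def)
    have "std (c, \<gamma>)"
    proof (rule ccontr)
      assume "\<not> std (c, \<gamma>)"
      then have "trm (c, \<gamma>) \<in> poly_vec.span (Z (jdeg (c, \<gamma>)) (sdeg (c, \<gamma>)) \<union> trm ` below (c, \<gamma>))"
        by (simp add: std_def)
      then have "smul (pprod V h \<beta>) (trm (c, \<gamma>)) \<in>
        poly_vec.span (Z (jdeg (translate \<beta> (c, \<gamma>))) (sdeg (translate \<beta> (c, \<gamma>))) \<union> trm ` below (translate \<beta> (c, \<gamma>)))"
      proof (rule smul_span)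
        fix f assume "f \<in> Z (jdeg (c, \<gamma>)) (sdeg (c, \<gamma>)) \<union> trm ` below (c, \<gamma>)"
        then show "smul (pprod V h \<beta>) f \<in>
          poly_vec.span (Z (jdeg (translate \<beta> (c, \<gamma>))) (sdeg (translate \<beta> (c, \<gamma>))) \<union> trm ` below (translate \<beta> (c, \<gamma>)))"
        proof
          assume "f \<in> Z (jdeg (c, \<gamma>)) (sdeg (c, \<gamma>))"
          from act[OF keys(2) this] show ?thesis
            by (intro poly_vec.span_base UnI1) (simp only: jdeg_translate sdeg_translate)
        next
          assume "f \<in> trm ` below (c, \<gamma>)"
          then obtain \<kappa> where "f = trm \<kappa>" "\<kappa> \<in> below (c, \<gamma>)" by (elim imageE)
          then show ?thesis
            using translate_below[OF keys(2)] trm_translate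
            by (intro poly_vec.span_base UnI2) (metis imageI)
        qed
      qed
      with s show False by (simp only: std_def trm_translate not_True_eq_False)
    qed
    with keys show ?thesis by (simp add: D_def)
  qed
  have char: "(\<exists>f\<in>M j s. f \<notin> Z j s) \<longleftrightarrow> (\<exists>\<kappa>\<in>idx j s. std \<kappa>)" for j s
  proof
    assume "\<exists>f\<in>M j s. f \<notin> Z j s"
    then obtain f where f: "f \<in> M j s" "f \<notin> Z j s" by (elim bexE)
    show "\<exists>\<kappa>\<in>idx j s. std \<kappa>"
    proof (rule ccontr)
      assume nostd: "\<not> (\<exists>\<kappa>\<in>idx j s. std \<kappa>)"
      have trmZ: "trm \<kappa> \<in> Z j s" if "finite S" "S \<subseteq> idx j s" "\<forall>\<kappa>\<in>S. below \<kappa> \<subseteq> S" "\<kappa> \<in> S" for \<kappa> S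
        using that
      proof (induction S arbitrary: \<kappa> rule: finite_linorder_max_induct)
        case empty
        then show ?case by simp
      next
        case (insert \<kappa>0 S)
        have down: "\<forall>\<kappa>'\<in>S. below \<kappa>' \<subseteq> S"
        proof (intro ballI subsetI)
          fix \<kappa>' \<kappa>'' assume "\<kappa>' \<in> S" "\<kappa>'' \<in> below \<kappa>'"
          then have "\<kappa>'' \<in> insert \<kappa>0 S" "\<kappa>'' < \<kappa>'" "\<kappa>' < \<kappa>0"
            using insert.prems(2) insert.hyps(2) by (auto simp: below_def)
          then show "\<kappa>'' \<in> S" by auto
        qed
        have Sidx: "S \<subseteq> idx j s" using insert.prems(1) by simp
        note IH = insert.IH[OF Sidx down]
        show ?case
        proof (cases "\<kappa> \<in> S")
          case True
          then show ?thesis by (rule IH)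
        next
          case False
          then have eq: "\<kappa> = \<kappa>0" using insert.prems(3) by simp
          have \<kappa>: "\<kappa> \<in> idx j s" "jdeg \<kappa> = j" "sdeg \<kappa> = s"
            using insert.prems(1) by (auto simp: idx_def eq)
          have "below \<kappa> \<subseteq> S" using insert.prems(2) by (auto simp: below_def eq)
          then have "Z j s \<union> trm ` below \<kappa> \<subseteq> Z j s" using IH by auto
          from poly_vec.span_minimal[OF this Z]
          have "poly_vec.span (Z j s \<union> trm ` below \<kappa>) \<subseteq> Z j s" .
          moreover have "trm \<kappa> \<in> poly_vec.span (Z j s \<union> trm ` below \<kappa>)"
            using nostd \<kappa> by (metis std_def)
          ultimately show ?thesis by (rule subsetD)
        qed
      qed
      have "\<forall>\<kappa>\<in>idx j s. below \<kappa> \<subseteq> idx j s" by (auto simp: below_def idx_def)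
      from trmZ[OF finite_idx subset_refl this] have "Z j s \<union> trm ` idx j s \<subseteq> Z j s" by auto
      from poly_vec.span_minimal[OF this Z] spanned[of j s] f show False by auto
    qed
  next
    assume "\<exists>\<kappa>\<in>idx j s. std \<kappa>"
    then obtain \<kappa> where \<kappa>: "\<kappa> \<in> idx j s" "std \<kappa>" by (elim bexE)
    then have deg: "jdeg \<kappa> = j" "sdeg \<kappa> = s" by (simp_all add: idx_def)
    have "trm \<kappa> \<notin> Z j s"
    proof
      assume "trm \<kappa> \<in> Z j s"
      then have "trm \<kappa> \<in> poly_vec.span (Z j s \<union> trm ` below \<kappa>)"
        by (intro poly_vec.span_base UnI1)
      with \<kappa>(2) show False by (simp add: std_def deg)
    qed
    moreover have "trm \<kappa> \<in> M j s" using terms[of j s] \<kappa>(1) by auto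
    ultimately show "\<exists>f\<in>M j s. f \<notin> Z j s" by (rule bexI)
  qed
  have w1: "weight V \<sigma> \<gamma> = weight V (\<lambda>_. 1) \<gamma>" for \<gamma>
    unfolding weight_def by (rule sum.cong) (simp_all add: \<sigma>)
  have "eventually_linear_top (\<lambda>s j. \<exists>\<gamma>\<in>D c. weight V (\<lambda>_. 1) \<gamma> = s \<and> weight V \<delta> \<gamma> = j)" for c
  proof (rule eventually_linear_top_monomials[OF finite_V])
    show "\<forall>\<gamma>\<in>D c. keys \<gamma> \<subseteq> V" by (simp add: D_def)
    show "\<forall>\<gamma> \<beta>. \<gamma> + \<beta> \<in> D c \<longrightarrow> \<gamma> \<in> D c" by (intro allI impI) (rule down)
  qed
  from eventually_linear_top_shift[OF this]
  have "eventually_linear_top (\<lambda>s j. \<exists>c\<in>{..<r}. s \<ge> es c \<and>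
      (\<exists>\<gamma>\<in>D c. weight V (\<lambda>_. 1) \<gamma> = s - es c \<and> weight V \<delta> \<gamma> = j - ed c))"
    by (rule eventually_linear_top_Bex[OF finite_lessThan])
  then show ?thesis
  proof (rule eventually_linear_top_cong[of _ 0])
    fix s :: nat and j
    have "(\<exists>c\<in>{..<r}. s \<ge> es c \<and> (\<exists>\<gamma>\<in>D c. weight V (\<lambda>_. 1) \<gamma> = s - es c \<and> weight V \<delta> \<gamma> = j - ed c)) \<longleftrightarrow>
      (\<exists>\<kappa>\<in>idx j s. std \<kappa>)"
    proof
      assume "\<exists>c\<in>{..<r}. s \<ge> es c \<and> (\<exists>\<gamma>\<in>D c. weight V (\<lambda>_. 1) \<gamma> = s - es c \<and> weight V \<delta> \<gamma> = j - ed c)"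
      then obtain c \<gamma> where "c < r" "s \<ge> es c" "\<gamma> \<in> D c" "weight V (\<lambda>_. 1) \<gamma> = s - es c" "weight V \<delta> \<gamma> = j - ed c"
        by blast
      then show "\<exists>\<kappa>\<in>idx j s. std \<kappa>"
        by (intro bexI[of _ "(c, \<gamma>)"]) (auto simp: D_def idx_def jdeg_def sdeg_def w1)
    next
      assume "\<exists>\<kappa>\<in>idx j s. std \<kappa>"
      then obtain c \<gamma> where "(c, \<gamma>) \<in> idx j s" "std (c, \<gamma>)" by auto
      then show "\<exists>c\<in>{..<r}. s \<ge> es c \<and> (\<exists>\<gamma>\<in>D c. weight V (\<lambda>_. 1) \<gamma> = s - es c \<and> weight V \<delta> \<gamma> = j - ed c)"
        by (intro bexI[of _ c] conjI bexI[of _ \<gamma>]) (auto simp: D_def idx_def jdeg_def sdeg_def w1)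
    qed
    then show "(\<exists>c\<in>{..<r}. s \<ge> es c \<and> (\<exists>\<gamma>\<in>D c. weight V (\<lambda>_. 1) \<gamma> = s - es c \<and> weight V \<delta> \<gamma> = j - ed c)) \<longleftrightarrow>
      (\<exists>f\<in>M j s. f \<notin> Z j s)"
      by (simp only: char)
  qed
qed

end

section \<open>Powers of ideals\<close>

lemma ideal_power_subspace: "ideal.subspace (ideal_power I s)"
  by (simp add: ideal_power_def)

lemma prod_lessThan_add: "(\<Prod>b<k + l. f b) = (\<Prod>b<k. f b) * (\<Prod>b<l. f (k + b))"
  for f :: "nat \<Rightarrow> 'a::comm_monoid_mult"
  by (induction l) (simp_all add: mult.assoc)

lemma prod_in_ideal_power: "\<forall>t<s. f t \<in> I \<Longrightarrow> (\<Prod>t<s. f t) \<in> ideal_power I s"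
  unfolding ideal_power_def by (rule ideal.span_base) blast

lemma ideal_power_mult:
  assumes "p \<in> ideal_power I s" "q \<in> ideal_power I t"
  shows "p * q \<in> ideal_power I (s + t)"
proof -
  have *: "(\<Prod>b<s. f b) * q \<in> ideal_power I (s + t)" if f: "\<forall>b<s. f b \<in> I" for f
    using assms(2) unfolding ideal_power_def[of I t]
  proof (induction rule: ideal.span_induct_alt)
    case base
    show ?case by (simp add: ideal.subspace_0[OF ideal_power_subspace])
  next
    case (step c x y)
    then obtain f' where x: "x = (\<Prod>b<t. f' b)" and f': "\<forall>b<t. f' b \<in> I" by blast
    have "(\<Prod>b<s. f b) * x = (\<Prod>b<s + t. if b < s then f b else f' (b - s))"
      by (simp add: prod_lessThan_add x)
    moreover have "\<dots> \<in> ideal_power I (s + t)"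
      using f f' by (intro prod_in_ideal_power) auto
    ultimately have "(\<Prod>b<s. f b) * x \<in> ideal_power I (s + t)" by simp
    from ideal.subspace_add[OF ideal_power_subspace ideal.subspace_scale[OF ideal_power_subspace this] step.IH]
    have "c * ((\<Prod>b<s. f b) * x) + (\<Prod>b<s. f b) * y \<in> ideal_power I (s + t)" .
    then show ?case by (simp add: distrib_left mult.left_commute)
  qed
  show ?thesis
    using assms(1) unfolding ideal_power_def[of I s]
  proof (induction rule: ideal.span_induct_alt)
    case base
    show ?case by (simp add: ideal.subspace_0[OF ideal_power_subspace])
  next
    case (step c x y)
    then obtain f where "x = (\<Prod>b<s. f b)" "\<forall>b<s. f b \<in> I" by blast
    with * have "x * q \<in> ideal_power I (s + t)" by simp
    from ideal.subspace_add[OF ideal_power_subspace ideal.subspace_scale[OF ideal_power_subspace this] step.IH]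
    have "c * (x * q) + y * q \<in> ideal_power I (s + t)" .
    then show ?case by (simp add: distrib_right mult.assoc)
  qed
qed

lemma ideal_power_0: "p \<in> ideal_power I 0"
  using ideal.subspace_scale[OF ideal_power_subspace prod_in_ideal_power[of 0 "\<lambda>_. 0" I], of p] by simp

lemma ideal_power_1: "p \<in> I \<Longrightarrow> p \<in> ideal_power I 1"
  using prod_in_ideal_power[of 1 "\<lambda>_. p" I] by simp

lemma ideal_power_le:
  assumes I: "ideal.subspace I" and s: "s \<ge> 1"
  shows "ideal_power I s \<subseteq> I"
  unfolding ideal_power_def
proof (rule ideal.span_minimal[OF _ I]; safe)
  fix f assume f: "\<forall>t<s. f t \<in> I"
  obtain s' where s': "s = Suc s'" using s by (cases s) auto
  have "(\<Prod>t<s'. f t) * f s' \<in> I"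
    using f by (intro ideal.subspace_scale[OF I]) (simp add: s')
  then show "(\<Prod>t<s. f t) \<in> I" by (simp add: s')
qed

lemma ideal_power_power: "p \<in> ideal_power I s \<Longrightarrow> p ^ k \<in> ideal_power I (k * s)"
proof (induction k)
  case 0
  show ?case by (simp add: ideal_power_0)
next
  case (Suc k)
  then show ?case by (simp add: ideal_power_mult)
qed

section \<open>The Rees algebra\<close>

text \<open>The variables are numbered so that they and the generators of the ideal can together be
  indexed by natural numbers, which are linearly ordered.\<close>

definition enum_var :: "nat \<Rightarrow> 'n::finite" where
  "enum_var = (SOME f. bij_betw f {0..<card (UNIV :: 'n set)} UNIV)"

lemma bij_enum_var: "bij_betw (enum_var :: nat \<Rightarrow> 'n::finite) {0..<card (UNIV :: 'n set)} UNIV"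
  unfolding enum_var_def by (rule someI_ex[OF ex_bij_betw_nat_finite]) simp

lemma finite_bounded_exponents:
  assumes "finite V"
  shows "finite {\<gamma> :: nat \<Rightarrow>\<^sub>0 nat. keys \<gamma> \<subseteq> V \<and> (\<forall>v\<in>V. lookup \<gamma> v \<le> K)}" (is "finite ?S")
proof -
  have "finite {f. \<forall>x. (x \<in> V \<longrightarrow> f x \<in> {..K}) \<and> (x \<notin> V \<longrightarrow> f x = 0)}"
    by (rule finite_set_of_finite_funs) (use assms in auto)
  moreover have "lookup ` ?S \<subseteq> {f. \<forall>x. (x \<in> V \<longrightarrow> f x \<in> {..K}) \<and> (x \<notin> V \<longrightarrow> f x = 0)}"
    by (auto simp: in_keys_iff)
  ultimately have "finite (lookup ` ?S)" by (rule finite_subset[rotated])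
  then show ?thesis
    by (rule finite_imageD) (auto intro: inj_onI poly_mapping_eqI)
qed

text \<open>Bihomogeneous power products in the variables, of bidegree \<open>(1, 0)\<close>, and in given homogeneous
  polynomials \<open>g k\<close>, of bidegree \<open>(d k, 1)\<close>. The indices below \<open>N\<close> stand for the variables. These
  power products are the images of the monomials under the presentation of the Rees algebra of the
  ideal generated by the \<open>g k\<close> as a quotient of a polynomial ring. For \<open>q = 0\<close> only the
  variables are left, and this case serves to find the generators of an ideal.\<close>

locale rees =
  fixes q :: nat and g :: "nat \<Rightarrow> ('n::finite, 'k::field) mpoly" and d :: "nat \<Rightarrow> int"
  assumes homog: "\<And>k. k < q \<Longrightarrow> homogeneous (d k) (g k)"
begin

definition N :: nat where "N = card (UNIV :: 'n set)"
definition V :: "nat set" where "V = {..<N + q}"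
definition h :: "nat \<Rightarrow> ('n, 'k) mpoly" where "h v = (if v < N then var (enum_var v) else g (v - N))"
definition \<delta> :: "nat \<Rightarrow> int" where "\<delta> v = (if v < N then 1 else d (v - N))"
definition \<sigma> :: "nat \<Rightarrow> nat" where "\<sigma> v = (if v < N then 0 else 1)"

lemma finite_V: "finite V" by (simp add: V_def)

lemma weight_\<delta>: "weight V \<delta> \<gamma> = (\<Sum>v<N. int (lookup \<gamma> v)) +
    (\<Sum>k<q. int (lookup \<gamma> (N + k)) * d k)"
  by (simp add: weight_def V_def sum_lessThan_add \<delta>_def)

lemma weight_\<sigma>: "weight V \<sigma> \<gamma> = (\<Sum>k<q. lookup \<gamma> (N + k))"
  by (simp add: weight_def V_def sum_lessThan_add \<sigma>_def)

text \<open>The exponents of the \<open>g k\<close> are bounded by \<open>s\<close>; hence their contribution to the first degree is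
  bounded, and so are the exponents of the variables. The degrees \<open>d k\<close> may be negative, for
  \<open>g k = 0\<close>.\<close>

lemma finite_weights:
  "finite {\<gamma>. keys \<gamma> \<subseteq> V \<and> weight V \<delta> \<gamma> = j \<and> weight V \<sigma> \<gamma> = s}"
proof (rule finite_subset[OF _ finite_bounded_exponents[OF finite_V]]; intro subsetI CollectI conjI ballI)
  fix \<gamma> :: "nat \<Rightarrow>\<^sub>0 nat" and v
  assume "\<gamma> \<in> {\<gamma>. keys \<gamma> \<subseteq> V \<and> weight V \<delta> \<gamma> = j \<and> weight V \<sigma> \<gamma> = s}" and v: "v \<in> V"
  then have w: "weight V \<delta> \<gamma> = j" "weight V \<sigma> \<gamma> = s" by simp_all
  have T: "lookup \<gamma> (N + k) \<le> s" if "k < q" for k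
    unfolding w(2)[symmetric] weight_\<sigma> using that by (intro member_le_sum) auto
  show "lookup \<gamma> v \<le> s + nat (\<bar>j\<bar> + (\<Sum>k<q. int s * \<bar>d k\<bar>))"
  proof (cases "v < N")
    case True
    have "int (lookup \<gamma> v) \<le> (\<Sum>v<N. int (lookup \<gamma> v))"
      using True by (intro member_le_sum) auto
    also have "\<dots> = j - (\<Sum>k<q. int (lookup \<gamma> (N + k)) * d k)"
      by (simp add: w(1)[symmetric] weight_\<delta>)
    also have "\<dots> \<le> \<bar>j\<bar> + (\<Sum>k<q. int s * \<bar>d k\<bar>)"
    proof -
      have "- (\<Sum>k<q. int (lookup \<gamma> (N + k)) * d k) \<le> (\<Sum>k<q. int s * \<bar>d k\<bar>)"
        unfolding sum_negf[symmetric]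
      proof (rule sum_mono)
        fix k assume "k \<in> {..<q}"
        then have "int (lookup \<gamma> (N + k)) * \<bar>d k\<bar> \<le> int s * \<bar>d k\<bar>"
          using T by (intro mult_right_mono) auto
        moreover have "- (int (lookup \<gamma> (N + k)) * d k) \<le> int (lookup \<gamma> (N + k)) * \<bar>d k\<bar>"
          by (metis abs_ge_minus_self abs_mult abs_of_nat)
        ultimately show "- (int (lookup \<gamma> (N + k)) * d k) \<le> int s * \<bar>d k\<bar>" by linarith
      qed
      then show ?thesis by linarith
    qed
    finally show ?thesis by linarith
  next
    case False
    then have "v = N + (v - N)" "v - N < q" using v by (auto simp: V_def)
    then show ?thesis using T by (metis trans_le_add1)
  qed
qed blast

lemma homogeneous_pprod: "homogeneous (weight V \<delta> \<gamma>) (pprod V h \<gamma>)"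
  unfolding weight_def pprod_def of_nat_id
proof (rule homogeneous_prod)
  fix v assume "v \<in> V"
  then have "homogeneous (\<delta> v) (h v)"
    by (auto simp: \<delta>_def h_def homogeneous_var V_def intro: homog)
  then show "homogeneous (int (lookup \<gamma> v) * \<delta> v) (h v ^ lookup \<gamma> v)"
    by (rule homogeneous_power)
qed

lemma pprod_single: "v \<in> V \<Longrightarrow> pprod V h (single v k) = h v ^ k"
proof -
  assume v: "v \<in> V"
  have "pprod V h (single v k) = (\<Prod>u\<in>V. if u = v then h v ^ k else 1)"
    unfolding pprod_def by (rule prod.cong) (auto simp: lookup_single when_def)
  then show ?thesis using v finite_V by simp
qed

lemma monomial_pprod:
  "\<exists>\<gamma>. keys \<gamma> \<subseteq> V \<and> weight V \<sigma> \<gamma> = 0 \<and> pprod V h \<gamma> = single m 1"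
proof (induction "mon_deg m" arbitrary: m)
  case 0
  then have "m = 0" by (simp add: mon_deg_eq_0_iff)
  then show ?case
    by (intro exI[of _ 0]) (simp add: weight_def)
next
  case (Suc n)
  have "\<exists>w. lookup m w \<noteq> 0"
  proof (rule ccontr)
    assume "\<nexists>w. lookup m w \<noteq> 0"
    then have "mon_deg m = 0" by (simp add: mon_deg_def)
    with Suc.hyps(2) show False by simp
  qed
  then obtain w where w: "lookup m w \<noteq> 0" by (elim exE)
  have m: "m - single w 1 + single w 1 = m"
    using w by (intro poly_mapping_eqI) (auto simp: lookup_add lookup_minus lookup_single when_def)
  have "mon_deg (m - single w 1) + 1 = mon_deg m"
    using arg_cong[OF m, of mon_deg] by (simp only: mon_deg_add mon_deg_single)
  with Suc.hyps(2) have "n = mon_deg (m - single w 1)" by simp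
  from Suc.hyps(1)[OF this] obtain \<gamma> where \<gamma>: "keys \<gamma> \<subseteq> V" "weight V \<sigma> \<gamma> = 0"
    "pprod V h \<gamma> = single (m - single w 1) 1" by (elim exE conjE)
  have "w \<in> enum_var ` {0..<N}"
    unfolding N_def bij_betw_imp_surj_on[OF bij_enum_var] by (rule UNIV_I)
  then obtain v where v: "v < N" "enum_var v = w" by auto
  have vV: "v \<in> V" using v by (simp add: V_def)
  have "pprod V h (\<gamma> + single v 1) = single m 1"
    using v by (simp only: pprod_add \<gamma> pprod_single[OF vV] single_split_var[OF w]) (simp add: h_def)
  moreover have "weight V \<sigma> (\<gamma> + single v 1) = 0"
    using v(1) \<gamma>(2) by (simp add: weight_add weight_single[OF finite_V vV] \<sigma>_def)
  moreover have "keys (\<gamma> + single v 1) \<subseteq> V"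
    using \<gamma>(1) vV by (simp add: keys_add_nat)
  ultimately show ?case by blast
qed

text \<open>Multiples of a basis vector, because spans over the field are available for vectors.\<close>

definition terms_s :: "nat \<Rightarrow> nat \<Rightarrow> (nat \<Rightarrow> ('n, 'k) mpoly) set" where
  "terms_s a s = {smul (pprod V h \<gamma>) (unit_vec a) |\<gamma>. keys \<gamma> \<subseteq> V \<and> weight V \<sigma> \<gamma> = s}"

definition terms_js :: "nat \<Rightarrow> int \<Rightarrow> nat \<Rightarrow> (nat \<Rightarrow> ('n, 'k) mpoly) set" where
  "terms_js a j s = {smul (pprod V h \<gamma>) (unit_vec a) |\<gamma>.
    keys \<gamma> \<subseteq> V \<and> weight V \<delta> \<gamma> = j \<and> weight V \<sigma> \<gamma> = s}"

lemma span_terms_pprod: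
  assumes "keys \<beta> \<subseteq> V" "f \<in> poly_vec.span (terms_s a s)"
  shows "smul (pprod V h \<beta>) f \<in> poly_vec.span (terms_s a (weight V \<sigma> \<beta> + s))"
  using assms(2)
proof (rule smul_span)
  fix f assume "f \<in> terms_s a s"
  then obtain \<gamma> where \<gamma>: "f = smul (pprod V h \<gamma>) (unit_vec a)" "keys \<gamma> \<subseteq> V" "weight V \<sigma> \<gamma> = s"
    unfolding terms_s_def by blast
  have "smul (pprod V h \<beta>) f = smul (pprod V h (\<beta> + \<gamma>)) (unit_vec a)"
    by (simp only: \<gamma>(1) smul_smul pprod_add)
  moreover have "keys (\<beta> + \<gamma>) \<subseteq> V" "weight V \<sigma> (\<beta> + \<gamma>) = weight V \<sigma> \<beta> + s"
    using \<gamma> assms(1) by (simp_all add: keys_add_nat weight_add)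
  ultimately have "smul (pprod V h \<beta>) f \<in> terms_s a (weight V \<sigma> \<beta> + s)"
    unfolding terms_s_def by blast
  then show "smul (pprod V h \<beta>) f \<in> poly_vec.span (terms_s a (weight V \<sigma> \<beta> + s))"
    by (rule poly_vec.span_base)
qed

lemma span_terms_smul:
  assumes f: "f \<in> poly_vec.span (terms_s a s)"
  shows "smul p f \<in> poly_vec.span (terms_s a s)"
proof -
  have "smul (single m c) f \<in> poly_vec.span (terms_s a s)" for m c
  proof -
    obtain \<gamma> where \<gamma>: "keys \<gamma> \<subseteq> V" "weight V \<sigma> \<gamma> = 0"
      "pprod V h \<gamma> = single m 1" using monomial_pprod by blast
    have "vec_scale c (smul (single m 1) f) \<in> poly_vec.span (terms_s a s)"
      using span_terms_pprod[OF \<gamma>(1) f] by (intro poly_vec.span_scale) (simp only: \<gamma> add_0)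
    then show ?thesis by (simp add: vec_scale_eq_smul smul_smul mult_single)
  qed
  then have "(\<Sum>m\<in>keys p. smul (single m (lookup p m)) f)
      \<in> poly_vec.span (terms_s a s)"
    by (intro poly_vec.span_sum)
  then show ?thesis
    by (simp only: vec_mod.scale_sum_left[symmetric] poly_mapping_sum_single[symmetric])
qed

definition I :: "('n, 'k) mpoly set" where "I = ideal.span (g ` {..<q})"

lemma span_terms_I:
  assumes p: "p \<in> I" and f: "f \<in> poly_vec.span (terms_s a s)"
  shows "smul p f \<in> poly_vec.span (terms_s a (Suc s))"
  using p unfolding I_def
proof (induction rule: ideal.span_induct_alt)
  case base
  show ?case by (simp only: vec_mod.scale_zero_left poly_vec.span_zero)
next
  case (step c x y)
  then obtain k where k: "k < q" "x = g k" by auto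
  have v: "N + k \<in> V" using k by (simp add: V_def)
  have "smul (pprod V h (single (N + k) 1)) f \<in>
      poly_vec.span (terms_s a (weight V \<sigma> (single (N + k) 1) + s))"
    using v by (intro span_terms_pprod f) simp
  then have "smul x f \<in> poly_vec.span (terms_s a (Suc s))"
    by (simp add: pprod_single[OF v] weight_single[OF finite_V v] h_def \<sigma>_def k(2))
  from poly_vec.span_add[OF span_terms_smul[OF this] step.IH]
  have "smul c (smul x f) + smul y f \<in> poly_vec.span (terms_s a (Suc s))" .
  then show ?case by (simp only: vec_mod.scale_left_distrib smul_smul)
qed

lemma ideal_power_span_terms:
  assumes p: "p \<in> ideal_power I s"
  shows "smul p (unit_vec a) \<in> poly_vec.span (terms_s a s)"
proof -
  have prod: "smul (\<Prod>t<s. f t) (unit_vec a) \<in> poly_vec.span (terms_s a s)" if "\<forall>t<s. f t \<in> I" for f s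
    using that
  proof (induction s)
    case 0
    have "smul (pprod V h 0) (unit_vec a) \<in> terms_s a 0"
      unfolding terms_s_def by (intro CollectI exI[of _ 0]) (simp add: weight_def)
    then show ?case by (intro poly_vec.span_base) simp
  next
    case (Suc s)
    then have "smul (f s) (smul (\<Prod>t<s. f t) (unit_vec a)) \<in> poly_vec.span (terms_s a (Suc s))"
      by (intro span_terms_I) auto
    then show ?case by (simp add: smul_smul mult.commute)
  qed
  show ?thesis
    using p unfolding ideal_power_def
  proof (induction rule: ideal.span_induct_alt)
    case base
    show ?case by (simp only: vec_mod.scale_zero_left poly_vec.span_zero)
  next
    case (step c x y)
    then obtain f where "x = (\<Prod>t<s. f t)" "\<forall>t<s. f t \<in> I" by blast
    with prod have "smul x (unit_vec a) \<in> poly_vec.span (terms_s a s)" by simp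
    from poly_vec.span_add[OF span_terms_smul[OF this] step.IH]
    have "smul c (smul x (unit_vec a)) + smul y (unit_vec a) \<in> poly_vec.span (terms_s a s)" .
    then show ?case by (simp only: vec_mod.scale_left_distrib smul_smul)
  qed
qed

lemma span_terms_hcomp:
  assumes "f \<in> poly_vec.span (terms_s a s)"
  shows "(\<lambda>b. hcomp j (f b)) \<in> poly_vec.span (terms_js a j s)"
  using assms
proof (induction rule: poly_vec.span_induct_alt)
  case base
  have "(\<lambda>b. hcomp j ((0 :: nat \<Rightarrow> ('n, 'k) mpoly) b)) = 0" by (rule ext) simp
  then show ?case by (simp only: poly_vec.span_zero)
next
  case (step c x y)
  then obtain \<gamma> where \<gamma>: "x = smul (pprod V h \<gamma>) (unit_vec a)" "keys \<gamma> \<subseteq> V" "weight V \<sigma> \<gamma> = s"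
    unfolding terms_s_def by blast
  have "(\<lambda>b. hcomp j ((vec_scale c x + y) b)) = vec_scale c (\<lambda>b. hcomp j (x b)) + (\<lambda>b. hcomp j (y b))"
    by (rule ext) (simp add: hcomp_add vec_scale_def hcomp_mult[OF homogeneous_const])
  moreover have "(\<lambda>b. hcomp j (x b)) \<in> poly_vec.span (terms_js a j s)"
  proof (cases "weight V \<delta> \<gamma> = j")
    case True
    have "(\<lambda>b. hcomp j (x b)) = x"
      by (rule ext) (simp add: \<gamma>(1) smul_apply unit_vec_def hcomp_homogeneous[OF homogeneous_pprod] True)
    moreover have "x \<in> terms_js a j s"
      using \<gamma> True unfolding terms_js_def by blast
    ultimately show ?thesis by (simp only: poly_vec.span_base)
  next
    case False
    have "(\<lambda>b. hcomp j (x b)) = 0"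
      using False by (intro ext) (simp add: \<gamma>(1) smul_apply unit_vec_def hcomp_homogeneous[OF homogeneous_pprod])
    then show ?thesis by (simp only: poly_vec.span_zero)
  qed
  ultimately show ?case
    using step.IH by (simp only: poly_vec.span_add poly_vec.span_scale)
qed

text \<open>The \<open>s\<close>-th power of the ideal is the piece of weight \<open>s\<close> of the Rees algebra. The passage from
  \<open>terms_s\<close> to \<open>terms_js\<close> takes homogeneous components on both sides.\<close>

lemma homogeneous_power_span_terms:
  assumes "p \<in> ideal_power I s" "homogeneous j p"
  shows "smul p (unit_vec a) \<in> poly_vec.span (terms_js a j s)"
proof -
  have "(\<lambda>b. hcomp j (smul p (unit_vec a) b)) = smul p (unit_vec a)"
    by (rule ext) (simp add: smul_apply unit_vec_def hcomp_homogeneous[OF assms(2)])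
  then show ?thesis
    using span_terms_hcomp[OF ideal_power_span_terms[OF assms(1)], of j a] by (simp only:)
qed

lemma pprod_in_power: "pprod V h \<gamma> \<in> ideal_power I (weight V \<sigma> \<gamma>)"
proof -
  have hv: "h v \<in> ideal_power I (\<sigma> v)" if "v \<in> V" for v
  proof (cases "v < N")
    case True
    then show ?thesis by (simp add: \<sigma>_def ideal_power_0)
  next
    case False
    then have "g (v - N) \<in> I"
      using that unfolding I_def by (intro ideal.span_base imageI) (auto simp: V_def)
    then show ?thesis using False ideal_power_1 by (simp add: \<sigma>_def h_def)
  qed
  have "(\<Prod>v\<in>A. h v ^ lookup \<gamma> v) \<in> ideal_power I (\<Sum>v\<in>A. lookup \<gamma> v * \<sigma> v)"
    if "finite A" "A \<subseteq> V" for A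
    using that
  proof (induction A rule: finite_induct)
    case empty
    show ?case by (simp add: ideal_power_0)
  next
    case (insert v A)
    then show ?case
      by (simp add: ideal_power_mult ideal_power_power hv)
  qed
  from this[OF finite_V subset_refl] show ?thesis by (simp add: pprod_def weight_def)
qed

lemma graded_power: "graded (ideal_power I s)"
  unfolding graded_def
proof (intro conjI ballI allI)
  show "ideal.subspace (ideal_power I s)" by (rule ideal_power_subspace)
next
  fix p j assume p: "p \<in> ideal_power I s"
  have span0: "f 0 \<in> ideal_power I s" if "f \<in> poly_vec.span (terms_js 0 j s)" for f
    using that
  proof (induction rule: poly_vec.span_induct_alt)
    case base
    show ?case by (simp add: ideal.subspace_0[OF ideal_power_subspace])
  next
    case (step c x y)
    then obtain \<gamma> where "x = smul (pprod V h \<gamma>) (unit_vec 0)" "weight V \<sigma> \<gamma> = s"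
      unfolding terms_js_def by blast
    then have "x 0 \<in> ideal_power I s"
      using pprod_in_power[of \<gamma>] by (simp add: smul_apply unit_vec_def)
    from ideal.subspace_add[OF ideal_power_subspace ideal.subspace_scale[OF ideal_power_subspace this] step.IH]
    have "single 0 c * x 0 + y 0 \<in> ideal_power I s" .
    then show ?case by (simp add: vec_scale_def)
  qed
  from span0[OF span_terms_hcomp[OF ideal_power_span_terms[OF p]]]
  show "hcomp j p \<in> ideal_power I s" by (simp add: smul_apply unit_vec_def)
qed

end

text \<open>The graded basis theorem for a module of rank one, multiplied by variables only. Their second
  degree is \<open>0\<close>, so \<open>M\<close> is set to zero in all other second degrees.\<close>

lemma finite_homogeneous_generators:
  fixes J :: "('n::finite, 'k::field) mpoly set"
  assumes J: "graded J"
  shows "\<exists>q (g :: nat \<Rightarrow> ('n, 'k) mpoly) d. rees q g d \<and> J = ideal.span (g ` {..<q})"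
proof -
  interpret X: rees 0 "\<lambda>_. 0 :: ('n, 'k) mpoly" "\<lambda>_. 0" by unfold_locales simp
  interpret W: weighted_terms X.V X.h X.\<delta> X.\<sigma> "Suc 0" unit_vec "\<lambda>_. 0" "\<lambda>_. 0"
    by unfold_locales (rule X.finite_V, rule X.finite_weights)
  have Js: "ideal.subspace J" using J by (simp add: graded_def)
  define M where "M j s = {f. \<exists>p. f = smul p (unit_vec 0) \<and> p \<in> J \<and> homogeneous j p \<and> (s = 0 \<or> p = 0)}"
    for j :: int and s :: nat
  have w0: "weight X.V X.\<sigma> \<gamma> = 0" for \<gamma> by (simp add: X.weight_\<sigma>)
  have sub: "poly_vec.subspace (M j s)" for j s
  proof (rule poly_vec.subspaceI)
    show "0 \<in> M j s"
      unfolding M_def by (intro CollectI exI[of _ 0]) (simp add: ideal.subspace_0[OF Js])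
  next
    fix x y assume "x \<in> M j s" "y \<in> M j s"
    then obtain a b where "x = smul a (unit_vec 0)" "a \<in> J" "homogeneous j a" "s = 0 \<or> a = 0"
      "y = smul b (unit_vec 0)" "b \<in> J" "homogeneous j b" "s = 0 \<or> b = 0" unfolding M_def by blast
    then show "x + y \<in> M j s"
      unfolding M_def by (intro CollectI exI[of _ "a + b"])
        (auto simp: vec_mod.scale_left_distrib intro: ideal.subspace_add[OF Js] homogeneous_add)
  next
    fix c x assume "x \<in> M j s"
    then obtain a where "x = smul a (unit_vec 0)" "a \<in> J" "homogeneous j a" "s = 0 \<or> a = 0"
      unfolding M_def by blast
    then show "vec_scale c x \<in> M j s"
      using homogeneous_mult[OF homogeneous_const[of c], of j a]
      unfolding M_def by (intro CollectI exI[of _ "single 0 c * a"])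
        (auto simp: vec_scale_eq_smul smul_smul intro: ideal.subspace_scale[OF Js])
  qed
  have act: "smul (pprod X.V X.h \<gamma>) f \<in> M (weight X.V X.\<delta> \<gamma> + j) (weight X.V X.\<sigma> \<gamma> + s)"
    if f: "f \<in> M j s" for \<gamma> f j s
  proof -
    obtain a where "f = smul a (unit_vec 0)" "a \<in> J" "homogeneous j a" "s = 0 \<or> a = 0"
      using f unfolding M_def by blast
    then show ?thesis
      unfolding M_def w0 by (intro CollectI exI[of _ "pprod X.V X.h \<gamma> * a"])
        (auto simp: smul_smul intro: ideal.subspace_scale[OF Js] homogeneous_mult X.homogeneous_pprod)
  qed
  have spanned: "M j s \<subseteq> poly_vec.span (W.trm ` W.idx j s)" for j s
  proof
    fix f assume "f \<in> M j s"
    then obtain p where p: "f = smul p (unit_vec 0)" "p \<in> J" "homogeneous j p" "s = 0 \<or> p = 0"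
      unfolding M_def by blast
    show "f \<in> poly_vec.span (W.trm ` W.idx j s)"
    proof (cases "p = 0")
      case True
      then show ?thesis by (simp only: p(1) vec_mod.scale_zero_left poly_vec.span_zero)
    next
      case False
      then have s: "s = 0" using p(4) by simp
      have "f \<in> poly_vec.span (X.terms_js 0 j s)"
        unfolding p(1) s using p(3) by (intro X.homogeneous_power_span_terms ideal_power_0)
      moreover have "X.terms_js 0 j s \<subseteq> W.trm ` W.idx j s"
      proof
        fix x assume "x \<in> X.terms_js 0 j s"
        then obtain \<gamma> where \<gamma>: "x = smul (pprod X.V X.h \<gamma>) (unit_vec 0)" "keys \<gamma> \<subseteq> X.V"
          "weight X.V X.\<delta> \<gamma> = j" "weight X.V X.\<sigma> \<gamma> = s" unfolding X.terms_js_def by blast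
        show "x \<in> W.trm ` W.idx j s"
          by (rule image_eqI[of _ _ "(0, \<gamma>)"])
            (simp_all add: W.trm_def W.idx_def W.jdeg_def W.sdeg_def \<gamma>)
      qed
      ultimately show ?thesis using poly_vec.span_mono by blast
    qed
  qed
  have "\<exists>q g gd gs. (\<forall>c<q. g c \<in> M (gd c) (gs c)) \<and> (\<forall>j s. M j s \<subseteq> W.generated q g gd gs j s)"
    by (rule W.graded_noetherian[OF sub act spanned])
  then obtain q g gd gs where g: "\<forall>c<q. g c \<in> M (gd c) (gs c)"
    and gen: "\<forall>j s. M j s \<subseteq> W.generated q g gd gs j s" by (elim exE conjE)
  define g' where "g' c = g c 0" for c
  have g': "g' c \<in> J" "homogeneous (gd c) (g' c)" if "c < q" for c
    using g[rule_format, OF that] by (auto simp: M_def g'_def smul_apply unit_vec_def)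
  have "rees q g' gd" by unfold_locales (rule g')
  moreover have "J = ideal.span (g' ` {..<q})"
  proof
    show "ideal.span (g' ` {..<q}) \<subseteq> J"
      using g'(1) by (intro ideal.span_minimal[OF _ Js]) auto
    show "J \<subseteq> ideal.span (g' ` {..<q})"
    proof
      fix p assume p: "p \<in> J"
      have "hcomp j p \<in> ideal.span (g' ` {..<q})" for j
      proof -
        have "smul (hcomp j p) (unit_vec 0) \<in> M j 0"
          using J p unfolding M_def graded_def by (auto intro: homogeneous_hcomp)
        then have "smul (hcomp j p) (unit_vec 0) \<in> W.generated q g gd gs j 0" using gen by blast
        then have "smul (hcomp j p) (unit_vec 0) 0 \<in> ideal.span (g' ` {..<q})"
          unfolding W.generated_def
        proof (induction rule: poly_vec.span_induct_alt)
          case base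
          show ?case by (simp add: ideal.span_zero)
        next
          case (step c x y)
          then obtain c' \<gamma> where c': "x = smul (pprod X.V X.h \<gamma>) (g c')" "c' < q" by blast
          have "x 0 = pprod X.V X.h \<gamma> * g' c'" by (simp add: c'(1) smul_apply g'_def)
          then have "x 0 \<in> ideal.span (g' ` {..<q})"
            using c'(2) by (simp add: ideal.span_scale ideal.span_base)
          then show ?case
            using step.IH by (simp add: vec_scale_def ideal.span_scale ideal.span_add)
        qed
        then show ?thesis by (simp add: smul_apply unit_vec_def)
      qed
      then have "(\<Sum>j\<in>(int \<circ> mon_deg) ` keys p. hcomp j p) \<in> ideal.span (g' ` {..<q})"
        by (intro ideal.span_sum)
      then show "p \<in> ideal.span (g' ` {..<q})" by (simp only: sum_hcomp[symmetric])
    qed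
  qed
  ultimately show ?thesis by blast
qed

section \<open>Asymptotic Betti numbers\<close>

lemma pprod_mono:
  assumes "finite V" "U \<subseteq> V" "keys \<gamma> \<subseteq> U"
  shows "pprod V h \<gamma> = pprod U h \<gamma>" "weight V w \<gamma> = weight U w \<gamma>"
proof -
  have 0: "lookup \<gamma> v = 0" if "v \<in> V - U" for v
    using that assms(3) by (metis DiffD2 in_keys_iff subsetD)
  show "pprod V h \<gamma> = pprod U h \<gamma>"
    unfolding pprod_def by (rule prod.mono_neutral_right) (use assms 0 in auto)
  show "weight V w \<gamma> = weight U w \<gamma>"
    unfolding weight_def by (rule sum.mono_neutral_right) (use assms 0 in auto)
qed

lemma boundaries_ideal_subspace:
  assumes J: "ideal.subspace J"
  shows "vec_mod.subspace (diff F i ` ideal_mod J F (Suc i))"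
proof -
  have "vec_mod.subspace (ideal_mod J F (Suc i))"
    by (rule vec_mod.subspaceI) (simp_all add: ideal_mod_def free_mod_def smul_apply
        ideal.subspace_0[OF J] ideal.subspace_add[OF J] ideal.subspace_scale[OF J])
  then show ?thesis by (rule module_hom.subspace_image[OF rlin_diff])
qed

text \<open>The modules \<open>M\<close>, that is \<open>B \<inter> I\<^sup>s F\<^sub>i\<close> in all degrees, form a bigraded submodule of the Rees
  module of \<open>F\<^sub>i\<close>, so they are generated over the variables and the \<open>g k\<close> by finitely many \<open>e c\<close>.
  Modulo \<open>Z\<close>, that is \<open>I\<^sup>s B\<close>, a power product that involves a variable acts as zero, because the
  irrelevant ideal annihilates Tor. Hence the quotient is spanned over the field by products of the
  \<open>g k\<close> (the index set \<open>U\<close>) with the \<open>e c\<close>, and these raise \<open>s\<close> by one with each factor.\<close>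

lemma (in rees) eventually_linear_top_betti_Suc:
  "eventually_linear_top (\<lambda>s j. betti (Suc i) j (ideal_power I s) \<noteq> 0)"
proof -
  let ?F = "chosen_resolution :: ('n, 'k) free_complex"
  let ?P = "ideal_power I"
  note P_add = ideal.subspace_add[OF ideal_power_subspace] and P_scale = ideal.subspace_scale[OF ideal_power_subspace]
    and P_0 = ideal.subspace_0[OF ideal_power_subspace]
  interpret W: weighted_terms V h \<delta> \<sigma> "rk ?F i" unit_vec "shift ?F i" "\<lambda>_. 0"
    by unfold_locales (rule finite_V, rule finite_weights)
  define B where "B = diff ?F i ` free_mod ?F (Suc i)"
  have B: "vec_mod.subspace B" unfolding B_def by (rule diff_image_subspace)
  define M where "M j s = {b. b \<in> free_mod_deg ?F i j \<and> b \<in> B \<and> (\<forall>a. b a \<in> ?P s)}" for j s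
  define Z where "Z s = diff ?F i ` ideal_mod (?P s) ?F (Suc i)" for s
  have Z_sub: "vec_mod.subspace (Z s)" for s
    unfolding Z_def by (rule boundaries_ideal_subspace[OF ideal_power_subspace])
  have betti: "betti (Suc i) j (?P s) \<noteq> 0 \<longleftrightarrow> (\<exists>b\<in>M j s. b \<notin> Z s)" for j s
    unfolding betti_Suc_iff[OF graded_power] M_def Z_def B_def by blast
  have M_sub: "poly_vec.subspace (M j s)" for j s
  proof -
    have "poly_vec.subspace {b. \<forall>a. b a \<in> ?P s}"
      by (rule poly_vec.subspaceI) (simp_all add: vec_scale_def P_0 P_add P_scale)
    from poly_vec.subspace_inter[OF free_mod_deg_subspace poly_vec.subspace_inter[OF smul_subspace[OF B] this]]
    show ?thesis unfolding M_def Int_def mem_Collect_eq .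
  qed
  have M_act: "smul (pprod V h \<gamma>) f \<in> M (weight V \<delta> \<gamma> + j) (weight V \<sigma> \<gamma> + s)"
    if f: "f \<in> M j s" for \<gamma> f j s
  proof -
    have fd: "f \<in> free_mod ?F i" "\<forall>a<rk ?F i. homogeneous (j - shift ?F i a) (f a)" "f \<in> B" "\<And>a. f a \<in> ?P s"
      using f by (simp_all add: M_def free_mod_deg_def)
    have "homogeneous (weight V \<delta> \<gamma> + j - shift ?F i a) (pprod V h \<gamma> * f a)" if "a < rk ?F i" for a
      using homogeneous_mult[OF homogeneous_pprod, of "j - shift ?F i a" "f a"] fd(2) that
      by (simp add: add_diff_eq)
    moreover have "pprod V h \<gamma> * f a \<in> ?P (weight V \<sigma> \<gamma> + s)" for a
      using pprod_in_power fd(4) by (rule ideal_power_mult)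
    moreover have "smul (pprod V h \<gamma>) f \<in> free_mod ?F i"
      using fd(1) by (rule vec_mod.subspace_scale[OF free_mod_subspace])
    moreover have "smul (pprod V h \<gamma>) f \<in> B"
      using fd(3) by (rule vec_mod.subspace_scale[OF B])
    ultimately show ?thesis by (simp add: M_def free_mod_deg_def smul_apply)
  qed
  have M_spanned: "M j s \<subseteq> poly_vec.span (W.trm ` W.idx j s)" for j s
  proof
    fix f assume f: "f \<in> M j s"
    then have fd: "f \<in> free_mod ?F i" "\<And>a. a < rk ?F i \<Longrightarrow> homogeneous (j - shift ?F i a) (f a)" "\<And>a. f a \<in> ?P s"
      by (simp_all add: M_def free_mod_deg_def)
    have "smul (f a) (unit_vec a) \<in> poly_vec.span (W.trm ` W.idx j s)" if a: "a < rk ?F i" for a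
    proof -
      have "smul (f a) (unit_vec a) \<in> poly_vec.span (terms_js a (j - shift ?F i a) s)"
        using fd(3) fd(2)[OF a] by (rule homogeneous_power_span_terms)
      moreover have "terms_js a (j - shift ?F i a) s \<subseteq> W.trm ` W.idx j s"
      proof
        fix x assume "x \<in> terms_js a (j - shift ?F i a) s"
        then obtain \<gamma> where \<gamma>: "x = smul (pprod V h \<gamma>) (unit_vec a)" "keys \<gamma> \<subseteq> V"
          "weight V \<delta> \<gamma> = j - shift ?F i a" "weight V \<sigma> \<gamma> = s" unfolding terms_js_def by blast
        show "x \<in> W.trm ` W.idx j s"
          by (rule image_eqI[of _ _ "(a, \<gamma>)"])
            (simp_all add: W.trm_def W.idx_def W.jdeg_def W.sdeg_def \<gamma> a)
      qed
      ultimately show ?thesis using poly_vec.span_mono by blast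
    qed
    then have "(\<Sum>a<rk ?F i. smul (f a) (unit_vec a)) \<in> poly_vec.span (W.trm ` W.idx j s)"
      by (intro poly_vec.span_sum) simp
    moreover from vec_expand[OF free_mod_zero[OF fd(1)]]
    have "f = (\<Sum>a<rk ?F i. smul (f a) (unit_vec a))" .
    ultimately show "f \<in> poly_vec.span (W.trm ` W.idx j s)" by (rule ssubst[rotated])
  qed
  have "\<exists>q g gd gs. (\<forall>c<q. g c \<in> M (gd c) (gs c)) \<and> (\<forall>j s. M j s \<subseteq> W.generated q g gd gs j s)"
    by (rule W.graded_noetherian[OF M_sub M_act M_spanned])
  then obtain r e ed es where e: "\<forall>c<r. e c \<in> M (ed c) (es c)"
    and gen: "\<forall>j s. M j s \<subseteq> W.generated r e ed es j s" by (elim exE conjE)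
  define U where "U = {N..<N + q}"
  have UV: "U \<subseteq> V" by (auto simp: U_def V_def)
  note mono = pprod_mono[OF finite_V UV]
  interpret T: weighted_terms U h \<delta> \<sigma> r e ed es
  proof
    show "finite U" by (simp add: U_def)
    show "finite {\<gamma>. keys \<gamma> \<subseteq> U \<and> weight U \<delta> \<gamma> = j \<and> weight U \<sigma> \<gamma> = s}" for j s
    proof (rule finite_subset[OF _ finite_weights[of j s]], safe)
      fix \<gamma> :: "nat \<Rightarrow>\<^sub>0 nat" assume k: "keys \<gamma> \<subseteq> U"
      show "weight V \<delta> \<gamma> = weight U \<delta> \<gamma>" "weight V \<sigma> \<gamma> = weight U \<sigma> \<gamma>"
        by (rule mono(2)[OF k])+
      show "v \<in> V" if "v \<in> keys \<gamma>" for v using that k UV by blast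
    qed
  qed
  have Z_act: "smul (pprod U h \<gamma>) f \<in> Z (weight U \<sigma> \<gamma> + s)"
    if k: "keys \<gamma> \<subseteq> U" and f: "f \<in> Z s" for \<gamma> f s
  proof -
    obtain u where u: "f = diff ?F i u" "u \<in> free_mod ?F (Suc i)" "\<And>a. u a \<in> ?P s"
      using f unfolding Z_def ideal_mod_def by blast
    have "smul (pprod V h \<gamma>) u \<in> free_mod ?F (Suc i)"
      using u(2) by (rule vec_mod.subspace_scale[OF free_mod_subspace])
    moreover have "pprod V h \<gamma> * u a \<in> ?P (weight V \<sigma> \<gamma> + s)" for a
      using pprod_in_power u(3) by (rule ideal_power_mult)
    ultimately have "smul (pprod V h \<gamma>) u \<in> ideal_mod (?P (weight V \<sigma> \<gamma> + s)) ?F (Suc i)"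
      by (simp add: ideal_mod_def smul_apply)
    moreover have "smul (pprod V h \<gamma>) f = diff ?F i (smul (pprod V h \<gamma>) u)"
      by (simp only: u(1) diff_smul)
    ultimately have "smul (pprod V h \<gamma>) f \<in> Z (weight V \<sigma> \<gamma> + s)"
      unfolding Z_def by (intro image_eqI)
    then show ?thesis by (simp only: mono[OF k])
  qed
  have T_terms: "T.trm ` T.idx j s \<subseteq> M j s" for j s
  proof
    fix x assume "x \<in> T.trm ` T.idx j s"
    then obtain c \<gamma> where c: "x = smul (pprod U h \<gamma>) (e c)" "c < r" "keys \<gamma> \<subseteq> U"
      "weight U \<delta> \<gamma> + ed c = j" "weight U \<sigma> \<gamma> + es c = s"
      by (auto simp: T.trm_def T.idx_def T.jdeg_def T.sdeg_def)
    from M_act[OF e[rule_format, OF c(2)], of \<gamma>] show "x \<in> M j s"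
      by (simp only: mono[OF c(3)] c)
  qed
  have T_spanned: "M j s \<subseteq> poly_vec.span (Z s \<union> T.trm ` T.idx j s)" for j s
  proof -
    have "smul (pprod V h \<gamma>) (e c) \<in> Z s \<union> T.trm ` T.idx j s"
      if c: "c < r" "keys \<gamma> \<subseteq> V" "weight V \<delta> \<gamma> + ed c = j" "weight V \<sigma> \<gamma> + es c = s" for c \<gamma>
    proof (cases "keys \<gamma> \<subseteq> U")
      case True
      have "smul (pprod V h \<gamma>) (e c) = T.trm (c, \<gamma>)" "(c, \<gamma>) \<in> T.idx j s"
        using c by (simp_all add: T.trm_def T.idx_def T.jdeg_def T.sdeg_def mono[OF True] True)
      then show ?thesis by blast
    next
      case False
      then obtain v where k: "v \<in> keys \<gamma>" "v \<notin> U" by blast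
      then have "v \<in> V" using c(2) by blast
      with k have v: "v < N" "v \<in> V" "lookup \<gamma> v \<noteq> 0"
        by (auto simp: U_def V_def) (simp add: in_keys_iff)
      define \<beta> where "\<beta> = \<gamma> - single v 1"
      have eq: "\<gamma> = single v 1 + \<beta>"
        unfolding \<beta>_def using v(3) by (intro poly_mapping_le_add) (auto simp: lookup_single when_def)
      have w: "weight V \<sigma> \<beta> = weight V \<sigma> \<gamma>"
        using v(1) by (simp add: eq weight_add weight_single[OF finite_V v(2)] \<sigma>_def)
      have "smul (pprod V h \<beta>) (e c) \<in> M (weight V \<delta> \<beta> + ed c) (weight V \<sigma> \<beta> + es c)"
        by (rule M_act[OF e[rule_format, OF c(1)]])
      then have b: "smul (pprod V h \<beta>) (e c) \<in> diff ?F i ` free_mod ?F (Suc i)"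
        "\<forall>a. smul (pprod V h \<beta>) (e c) a \<in> ?P s"
        unfolding w c(4) M_def B_def by blast+
      have "var (enum_var v) \<in> irrelevant_ideal"
        unfolding irrelevant_ideal_def by (rule ideal.span_base) simp
      from ideal_mult_boundary[OF chosen_resolution ideal_power_subspace irrelevant_subspace this b(1) spec[OF b(2)]]
      have "smul (var (enum_var v)) (smul (pprod V h \<beta>) (e c)) \<in> Z s"
        unfolding Z_def .
      moreover have "smul (pprod V h \<gamma>) (e c) = smul (var (enum_var v)) (smul (pprod V h \<beta>) (e c))"
        using v by (simp add: eq pprod_add pprod_single[OF v(2)] h_def smul_smul)
      ultimately show ?thesis by simp
    qed
    then have "W.generated r e ed es j s \<subseteq> poly_vec.span (Z s \<union> T.trm ` T.idx j s)"
      unfolding W.generated_def by (intro poly_vec.span_mono) blast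
    then show ?thesis using gen by blast
  qed
  have "eventually_linear_top (\<lambda>s j. \<exists>f\<in>M j s. f \<notin> Z s)"
  proof (rule T.eventually_linear_top_quotient[of "\<lambda>_. Z" M, OF _ _ T_terms T_spanned])
    show "poly_vec.subspace (Z s)" for s by (rule smul_subspace[OF Z_sub])
    show "smul (pprod U h \<gamma>) f \<in> Z (weight U \<sigma> \<gamma> + s)"
      if "keys \<gamma> \<subseteq> U" "f \<in> Z s" for \<gamma> f s
      using that by (rule Z_act)
    show "\<sigma> v = 1" if "v \<in> U" for v using that by (simp add: \<sigma>_def U_def)
  qed
  then show ?thesis by (simp only: betti)
qed

text \<open>A finitely generated graded free module vanishes in small degrees, so an upper bound suffices.
  Finiteness is needed because \<open>reg\<close> is defined as a maximum.\<close>

lemma finite_betti_Suc: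
  fixes J :: "('n::finite, 'k::field) mpoly set"
  assumes J: "graded J" and ub: "\<And>j. betti (Suc i) j J \<noteq> 0 \<Longrightarrow> j \<le> b"
  shows "finite {j. betti (Suc i) j J \<noteq> 0}"
proof -
  let ?F = "chosen_resolution :: ('n, 'k) free_complex"
  have Js: "ideal.subspace J" using J by (simp add: graded_def)
  obtain j0 where j0: "\<forall>j<j0. free_mod_deg ?F i j \<subseteq> {0}" using free_mod_deg_below by blast
  have "j \<ge> j0" if nz: "betti (Suc i) j J \<noteq> 0" for j
  proof (rule ccontr)
    assume "\<not> j \<ge> j0"
    from nz[unfolded betti_Suc_iff[OF J]] obtain b where
      b: "b \<in> free_mod_deg ?F i j" "b \<notin> diff ?F i ` ideal_mod J ?F (Suc i)" by (elim bexE conjE)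
    have "free_mod_deg ?F i j \<subseteq> {0}" using j0 \<open>\<not> j \<ge> j0\<close> by simp
    from subsetD[OF this b(1)] have "b = 0" by (rule singletonD)
    with b(2) vec_mod.subspace_0[OF boundaries_ideal_subspace[OF Js, of ?F i]] show False by simp
  qed
  with ub have "{j. betti (Suc i) j J \<noteq> 0} \<subseteq> {j0..b}" by auto
  then show ?thesis by (rule finite_subset) simp
qed

text \<open>In column \<open>k\<close> the lowest entry lies in row \<open>a\<^sub>k s + (b\<^sub>k - k)\<close> for large \<open>s\<close>. The column wanted
  maximizes, among the columns that survive, the triple \<open>(a\<^sub>k, b\<^sub>k - k, k)\<close>
  lexicographically. For large \<open>s\<close> its lowest entry lies in the last row of the table, and every
  column to the right of it ends strictly above.\<close>

theorem theorem2p16: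
  fixes I :: "('n::finite, 'k::field) mpoly set"
  assumes "homogeneous_ideal I" and "I \<noteq> UNIV"
  shows "\<exists>i. \<exists>s0. \<forall>s\<ge>s0.
    extremal_betti i (int i + reg (ideal_power I s)) (ideal_power I s)"
proof -
  have gI: "graded I" using assms(1) graded_span by (auto simp: homogeneous_ideal_def)
  have Is: "ideal.subspace I" using gI by (simp add: graded_def)
  from finite_homogeneous_generators[OF gI] obtain q d and g :: "nat \<Rightarrow> ('n, 'k) mpoly"
    where rees: "rees q g d" and I: "I = ideal.span (g ` {..<q})" by (elim exE conjE)
  interpret R: rees q g d by (rule rees)
  have IR: "R.I = I" by (simp add: R.I_def I)
  have graded: "graded (ideal_power I s)" for s using R.graded_power by (simp only: IR)
  have proper: "ideal_power I s \<noteq> UNIV" if "s \<ge> 1" for s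
    using ideal_power_le[OF Is that] assms(2) by auto
  define n where "n = card (UNIV :: 'n set)"
  define Q where "Q i s j \<longleftrightarrow> betti i j (ideal_power I s) \<noteq> 0" for i s j
  have Q0: "Q 0 s j \<longleftrightarrow> j = 0" if "s \<ge> 1" for s j
    unfolding Q_def by (rule betti_0_iff[OF graded proper[OF that]])
  have Q_lin: "eventually_linear_top (Q i)" for i
  proof (cases i)
    case 0
    show ?thesis unfolding 0 using Q0 by (intro eventually_linear_topI[of 1 _ 0 0]) auto
  next
    case (Suc i')
    have "Q (Suc i') = (\<lambda>s j. betti (Suc i') j (ideal_power I s) \<noteq> 0)"
      by (intro ext) (simp add: Q_def)
    then show ?thesis using R.eventually_linear_top_betti_Suc[of i'] by (simp only: Suc IR)
  qed
  have Q_n: "i \<le> n" if "Q i s j" for i s j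
    using that betti_past_length[OF graded] unfolding Q_def n_def by (metis not_le)
  \<comment> \<open>The columns that survive for large \<open>s\<close>, with the affine functions of their lowest entries.\<close>
  define A where "A = {i. i \<le> n \<and> (\<exists>a b s0. \<forall>s\<ge>s0. Q i s (a * int s + b) \<and> (\<forall>j. Q i s j \<longrightarrow> j \<le> a * int s + b))}"
  have "\<forall>i\<in>A. \<exists>ab. \<exists>s0. \<forall>s\<ge>s0. Q i s (fst ab * int s + snd ab) \<and> (\<forall>j. Q i s j \<longrightarrow> j \<le> fst ab * int s + snd ab)"
    by (simp add: A_def)
  from bchoice[OF this] obtain ab where ab: "\<And>i. i \<in> A \<Longrightarrow>
      \<exists>s0. \<forall>s\<ge>s0. Q i s (fst (ab i) * int s + snd (ab i)) \<and> (\<forall>j. Q i s j \<longrightarrow> j \<le> fst (ab i) * int s + snd (ab i))"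
    by auto
  define top where "top i s = fst (ab i) * int s + snd (ab i)" for i s
  define good where "good i s \<longleftrightarrow> (if i \<in> A then Q i s (top i s) \<and> (\<forall>j. Q i s j \<longrightarrow> j \<le> top i s) else \<forall>j. \<not> Q i s j)" for i s
  have "eventually (good i) sequentially" if "i \<le> n" for i
  proof (cases "i \<in> A")
    case True
    then show ?thesis using ab[OF True] by (simp add: good_def top_def eventually_sequentially)
  next
    case False
    with Q_lin[of i] that have "\<exists>s0. \<forall>s\<ge>s0. \<forall>j. \<not> Q i s j"
      unfolding eventually_linear_top_def A_def by blast
    with False show ?thesis
      unfolding good_def eventually_sequentially by simp
  qed
  then have ev1: "eventually (\<lambda>s. \<forall>i\<in>{..n}. good i s) sequentially"
    by (intro eventually_ball_finite) auto
  have "finite A" by (rule finite_subset[of _ "{..n}"]) (auto simp: A_def)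
  have "0 \<in> A"
    unfolding A_def using Q0 by (intro CollectI conjI exI[of _ 0] exI[of _ 1]) auto
  \<comment> \<open>Equal first two entries mean equal affine functions; the third entry then selects the
    rightmost column.\<close>
  define key where "key i = (fst (ab i), snd (ab i) - int i, i)" for i
  have "Max (key ` A) \<in> key ` A"
    using \<open>finite A\<close> \<open>0 \<in> A\<close> by (intro Max_in) auto
  then obtain i where i: "i \<in> A" "key i = Max (key ` A)" by auto
  have i_max: "key k \<le> key i" if "k \<in> A" for k
    using \<open>finite A\<close> that by (simp add: i(2))
  have "eventually (\<lambda>s. top k s - int k \<le> top i s - int i \<and> (k > i \<longrightarrow> top k s - int k < top i s - int i)) sequentially"
    if "k \<in> A" for k
  proof -
    have le: "fst (ab k) < fst (ab i) \<or> fst (ab k) = fst (ab i) \<and> snd (ab k) - int k \<le> snd (ab i) - int i"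
      using i_max[OF that] by (auto simp: key_def)
    have less: "fst (ab k) < fst (ab i) \<or> fst (ab k) = fst (ab i) \<and> snd (ab k) - int k + 1 \<le> snd (ab i) - int i"
      if "k > i"
      using i_max[OF \<open>k \<in> A\<close>] that by (auto simp: key_def)
    show ?thesis
      unfolding eventually_sequentially
    proof (intro exI allI impI conjI)
      fix s assume s: "s \<ge> max (nat \<bar>(snd (ab k) - int k) - (snd (ab i) - int i)\<bar>)
        (nat \<bar>(snd (ab k) - int k + 1) - (snd (ab i) - int i)\<bar>)"
      show "top k s - int k \<le> top i s - int i"
        using affine_compare[OF le, of s] s by (simp add: top_def)
      show "top k s - int k < top i s - int i" if "k > i"
        using affine_compare[OF less[OF that], of s] s by (simp add: top_def)
    qed
  qed
  then have ev2: "eventually (\<lambda>s. \<forall>k\<in>A. top k s - int k \<le> top i s - int i \<and>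
      (k > i \<longrightarrow> top k s - int k < top i s - int i)) sequentially"
    using \<open>finite A\<close> by (intro eventually_ball_finite) auto
  have "eventually (\<lambda>s. extremal_betti i (int i + reg (ideal_power I s)) (ideal_power I s)) sequentially"
    using ev1 ev2 eventually_ge_at_top[of "1 :: nat"]
  proof eventually_elim
    fix s
    assume good: "\<forall>i\<in>{..n}. good i s" and cmp: "\<forall>k\<in>A. top k s - int k \<le> top i s - int i \<and>
      (k > i \<longrightarrow> top k s - int k < top i s - int i)" and s: "1 \<le> s"
    let ?J = "ideal_power I s"
    have bound: "k \<in> A \<and> j \<le> top k s" if "Q k s j" for k j
      using good Q_n[OF that] that unfolding good_def by (metis atMost_iff)
    have Qi: "Q i s (top i s)" using good i(1) unfolding good_def A_def by auto
    have fin: "finite {j. Q k s j}" for k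
    proof (cases k)
      case 0
      then show ?thesis using Q0[OF s] by simp
    next
      case (Suc k')
      show ?thesis
        unfolding Suc Q_def
        by (rule finite_betti_Suc[OF graded, of _ _ "top k s"]) (use bound Suc in \<open>auto simp: Q_def\<close>)
    qed
    have "{j - int k |k j. Q k s j} \<subseteq> (\<Union>k\<in>{..n}. (\<lambda>j. j - int k) ` {j. Q k s j})"
      using Q_n by fastforce
    then have fin_reg: "finite {j - int k |k j. Q k s j}"
      by (rule finite_subset) (intro finite_UN_I finite_imageI fin finite_atMost)
    have "reg ?J = Max {j - int k |k j. Q k s j}"
      by (simp add: reg_def Q_def)
    also have "\<dots> = top i s - int i"
    proof (rule Max_eqI[OF fin_reg])
      show "top i s - int i \<in> {j - int k |k j. Q k s j}" using Qi by blast
      fix y assume "y \<in> {j - int k |k j. Q k s j}"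
      then obtain k j where "y = j - int k" "Q k s j" by blast
      then show "y \<le> top i s - int i" using bound[of k j] cmp by fastforce
    qed
    finally have reg: "int i + reg ?J = top i s" by simp
    show "extremal_betti i (int i + reg ?J) ?J"
      unfolding extremal_betti_def reg
    proof (intro conjI allI impI)
      show "betti i (top i s) ?J \<noteq> 0" using Qi by (simp add: Q_def)
      fix k l assume kl: "i \<le> k" "top i s - int i \<le> l - int k" "(k, l) \<noteq> (i, top i s)"
      show "betti k l ?J = 0"
      proof (rule ccontr)
        assume "betti k l ?J \<noteq> 0"
        then have "Q k s l" by (simp add: Q_def)
        from bound[OF this] have k: "k \<in> A" "l \<le> top k s" by auto
        show False
        proof (cases "k = i")
          case True
          with kl k show False by simp
        next
          case False
          then have "top k s - int k < top i s - int i" using cmp k(1) kl(1) by auto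
          with kl(2) k(2) show False by linarith
        qed
      qed
    qed
  qed
  then show ?thesis unfolding eventually_sequentially by blast
qed

end
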